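(* Let $g\ge 2$ and $G=\langle c_1,\dots,c_{2g}\mid c_1\cdots c_{2g}c_1^{-1}\cdots c_{2g}^{-1}\rangle$, with the length-lexicographical order described in the context. Let $1\ne x\in G$ have normal form $\mathfrak{nf}(x)=YXY^{-1}$ (as a word), where $X=x_1\cdots x_n$ is cyclically freely reduced. Then there exist $1\le i\le n$ and $1\le j\le n'$ such that, with $$x'_1\cdots x'_{n'}=\mathfrak{nf}(x_{i+1}\cdots x_nx_1\cdots x_i),\qquad W=\mathfrak{nf}(x'_{j+1}\cdots x'_{n'}x'_1\cdots x'_j),$$ the word $W$ is cyclically irreducible, $|W|=n'\ge1$, and for every $k\ge2$, as words, $$\mathfrak{nf}(x^k)=Y\,\mathfrak{nf}(X^k)\,Y^{-1}=Y\,x_1\cdots x_i\,(x'_1\cdots x'_j\,W^{k-2}\,x'_{j+1}\cdots x'_{n'})\,x_{i+1}\cdots x_n\,Y^{-1}.$$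
   Context: Let $\mathcal S=\{c_1,\dots,c_{2g}\}$, $\mathcal S^{\pm}=\{c_1^{\pm1},\dots,c_{2g}^{\pm1}\}$; words are finite, possibly empty, strings over $\mathcal S^\pm$, and a word also denotes the element of $G$ it represents. $|X|$ is the number of letters of $X$. Letters are ordered by $c_{2g}^{-1}\succ\cdots\succ c_1^{-1}\succ c_1\succ c_2\succ\cdots\succ c_{2g}$; for words, $X\succ Y$ iff $|X|>|Y|$, or $|X|=|Y|$ and at the first position where they differ the letter of $X$ is $\succ$ that of $Y$. For $x\in G$, $\mathfrak{nf}(x)$ is the minimal word representing $x$; for a word $V$, $\mathfrak{nf}(V)$ is the normal form of the element it represents. A word $V$ is irreducible if $V=\mathfrak{nf}(V)$ as words, and cyclically irreducible if all its cyclic permutations are irreducible. $Y$ is possibly empty and $Y^{-1}$ is its formal inverse word. A word $x_1\cdots x_n$ is cyclically freely reduced if $x_i\ne x_{i+1}^{-1}$ for $1\le i<n$ and $x_1\neq x_n^{-1}$. *)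

theory Defs
  imports "HOL-Algebra.Group"
begin

section \<open>Words and group presentations\<close>

datatype 'a letter = Gen 'a | InvGen 'a

fun letter_inv :: "'a letter \<Rightarrow> 'a letter" where
  "letter_inv (Gen a) = InvGen a"
| "letter_inv (InvGen a) = Gen a"

definition word_inv :: "'a letter list \<Rightarrow> 'a letter list" where
  "word_inv w = rev (map letter_inv w)"

definition word_pow :: "nat \<Rightarrow> 'a letter list \<Rightarrow> 'a letter list" where
  "word_pow k w = concat (replicate k w)"

definition words :: "'a set \<Rightarrow> 'a letter list set" where
  "words S = lists (Gen ` S \<union> InvGen ` S)"

text \<open>Equality in the group \<open>\<langle>S | R\<rangle>\<close>: the least congruence on the words over \<open>S\<close> and its
  formal inverses that makes the relators and the words \<open>a a\<inverse>\<close> trivial. The case \<open>a\<inverse> a\<close> is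
  included in \<open>cancel\<close>, as \<open>a\<close> ranges over all letters.\<close>

inductive pres_eq :: "'a set \<Rightarrow> 'a letter list set \<Rightarrow> 'a letter list \<Rightarrow> 'a letter list \<Rightarrow> bool"
  for S R where
  refl: "w \<in> words S \<Longrightarrow> pres_eq S R w w"
| sym: "pres_eq S R v w \<Longrightarrow> pres_eq S R w v"
| trans: "pres_eq S R u v \<Longrightarrow> pres_eq S R v w \<Longrightarrow> pres_eq S R u w"
| cancel: "u @ [a, letter_inv a] @ v \<in> words S \<Longrightarrow> pres_eq S R (u @ [a, letter_inv a] @ v) (u @ v)"
| relator: "r \<in> R \<Longrightarrow> u @ r @ v \<in> words S \<Longrightarrow> pres_eq S R (u @ r @ v) (u @ v)"

definition pres_rel :: "'a set \<Rightarrow> 'a letter list set \<Rightarrow> 'a letter list rel" where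
  "pres_rel S R = {(v, w). pres_eq S R v w}"

definition pres_class :: "'a set \<Rightarrow> 'a letter list set \<Rightarrow> 'a letter list \<Rightarrow> 'a letter list set" where
  "pres_class S R w = pres_rel S R `` {w}"

definition presented_group :: "'a set \<Rightarrow> 'a letter list set \<Rightarrow> 'a letter list set monoid" where
  "presented_group S R =
     \<lparr>carrier = words S // pres_rel S R,
      mult = (\<lambda>x y. pres_rel S R `` {v @ w | v w. v \<in> x \<and> w \<in> y}),
      one = pres_class S R []\<rparr>"

lemma letter_inv_inv [simp]: "letter_inv (letter_inv a) = a"
  by (cases a) auto

lemma letter_inv_in_iff [simp]:
  "letter_inv a \<in> Gen ` S \<union> InvGen ` S \<longleftrightarrow> a \<in> Gen ` S \<union> InvGen ` S"
  by (cases a) auto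

lemma Nil_in_words [simp]: "[] \<in> words S"
  by (simp add: words_def)

lemma append_in_words [simp]: "v @ w \<in> words S \<longleftrightarrow> v \<in> words S \<and> w \<in> words S"
  by (auto simp: words_def)

lemma Cons_in_words [simp]:
  "a # w \<in> words S \<longleftrightarrow> a \<in> Gen ` S \<union> InvGen ` S \<and> w \<in> words S"
  by (simp add: words_def)

lemma word_inv_in_words [simp]: "w \<in> words S \<Longrightarrow> word_inv w \<in> words S"
  unfolding words_def word_inv_def in_lists_conv_set set_rev set_map
  by (metis imageE letter_inv_in_iff)

lemma pres_eq_words: "pres_eq S R v w \<Longrightarrow> v \<in> words S \<and> w \<in> words S"
  by (induction rule: pres_eq.induct) auto

lemma pres_eq_context:
  assumes "pres_eq S R v w" "p \<in> words S" "q \<in> words S"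
  shows "pres_eq S R (p @ v @ q) (p @ w @ q)"
  using assms(1)
proof (induction rule: pres_eq.induct)
  case (refl w)
  then show ?case using assms by (intro pres_eq.refl) simp
next
  case (sym v w)
  then show ?case by (blast intro: pres_eq.sym)
next
  case (trans u v w)
  then show ?case by (blast intro: pres_eq.trans)
next
  case (cancel u a v)
  then show ?case
    using pres_eq.cancel[of "p @ u" a "v @ q" S R] assms by auto
next
  case (relator r u v)
  then show ?case
    using pres_eq.relator[of r R "p @ u" "v @ q" S] assms by simp
qed

lemma pres_eq_append:
  assumes "pres_eq S R v v'" "pres_eq S R w w'"
  shows "pres_eq S R (v @ w) (v' @ w')"
proof -
  have "pres_eq S R (v @ w) (v' @ w)"
    using pres_eq_context[OF assms(1), of "[]" w] pres_eq_words[OF assms(2)] by simp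
  moreover have "pres_eq S R (v' @ w) (v' @ w')"
    using pres_eq_context[OF assms(2), of v' "[]"] pres_eq_words[OF assms(1)] by simp
  ultimately show ?thesis by (rule pres_eq.trans)
qed

lemma pres_eq_word_inv:
  "w \<in> words S \<Longrightarrow> pres_eq S R (word_inv w @ w) []"
proof (induction w)
  case Nil
  then show ?case by (simp add: word_inv_def pres_eq.refl)
next
  case (Cons a w)
  have w: "w \<in> words S" and a: "a \<in> Gen ` S \<union> InvGen ` S"
    using Cons.prems by (auto simp: words_def)
  have "[letter_inv a, a] \<in> words S"
    using a by (simp only: Cons_in_words letter_inv_in_iff Nil_in_words simp_thms)
  then have "pres_eq S R (word_inv w @ [letter_inv a, letter_inv (letter_inv a)] @ w) (word_inv w @ w)"
    using w by (intro pres_eq.cancel) simp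
  then show ?case
    using Cons.IH[OF w] by (auto simp: word_inv_def intro: pres_eq.trans)
qed

lemma equiv_pres_rel: "equiv (words S) (pres_rel S R)"
proof (rule equivI)
  show "pres_rel S R \<subseteq> words S \<times> words S"
    by (auto simp: pres_rel_def dest: pres_eq_words)
  show "refl_on (words S) (pres_rel S R)"
    by (auto simp: refl_on_def pres_rel_def intro: pres_eq.refl dest: pres_eq_words)
  show "sym (pres_rel S R)"
    by (auto simp: sym_def pres_rel_def intro: pres_eq.sym)
  show "trans (pres_rel S R)"
    by (auto simp: trans_def pres_rel_def intro: pres_eq.trans)
qed

lemma pres_class_eq_iff:
  "v \<in> words S \<Longrightarrow> w \<in> words S \<Longrightarrow> pres_class S R v = pres_class S R w \<longleftrightarrow> pres_eq S R v w"
  using eq_equiv_class_iff[OF equiv_pres_rel] by (fastforce simp: pres_class_def pres_rel_def)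

lemma carrier_presented_group:
  "carrier (presented_group S R) = pres_class S R ` words S"
  by (auto simp: presented_group_def quotient_def pres_class_def)

lemma one_presented_group: "\<one>\<^bsub>presented_group S R\<^esub> = pres_class S R []"
  by (simp add: presented_group_def)

lemma mult_pres_class:
  assumes "v \<in> words S" "w \<in> words S"
  shows "pres_class S R v \<otimes>\<^bsub>presented_group S R\<^esub> pres_class S R w = pres_class S R (v @ w)"
proof -
  have "pres_rel S R `` {v' @ w' | v' w'. v' \<in> pres_class S R v \<and> w' \<in> pres_class S R w}
      = pres_class S R (v @ w)" (is "?A = ?B")
  proof (intro equalityI subsetI)
    fix u assume "u \<in> ?A"
    then obtain v' w' where "pres_eq S R v v'" "pres_eq S R w w'" "pres_eq S R (v' @ w') u"
      by (auto simp: pres_class_def pres_rel_def)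
    then show "u \<in> ?B"
      using pres_eq.trans[OF pres_eq_append] by (simp add: pres_class_def pres_rel_def)
  next
    fix u assume "u \<in> ?B"
    moreover have "v \<in> pres_class S R v" "w \<in> pres_class S R w"
      using assms by (simp_all add: pres_class_def pres_rel_def pres_eq.refl)
    ultimately show "u \<in> ?A"
      unfolding pres_class_def by blast
  qed
  then show ?thesis by (simp add: presented_group_def)
qed

lemma group_presented_group: "group (presented_group S R)"
proof (rule groupI)
  fix x y z
  assume x: "x \<in> carrier (presented_group S R)"
  show "\<exists>y\<in>carrier (presented_group S R).
           y \<otimes>\<^bsub>presented_group S R\<^esub> x = \<one>\<^bsub>presented_group S R\<^esub>"
  proof -
    obtain w where w: "w \<in> words S" "x = pres_class S R w"
      using x by (auto simp: carrier_presented_group)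
    have "pres_class S R (word_inv w) \<otimes>\<^bsub>presented_group S R\<^esub> x = \<one>\<^bsub>presented_group S R\<^esub>"
      using w pres_eq_word_inv[of w S R] pres_class_eq_iff[of "word_inv w @ w" S "[]" R]
      by (simp add: mult_pres_class one_presented_group)
    then show ?thesis
      using w by (auto simp: carrier_presented_group)
  qed
qed (auto simp: carrier_presented_group one_presented_group mult_pres_class)


section \<open>The surface group and its normal forms\<close>

definition surface_relator :: "nat \<Rightarrow> nat letter list" where
  "surface_relator g = map Gen [1..<2 * g + 1] @ map InvGen [1..<2 * g + 1]"

definition surface_group :: "nat \<Rightarrow> nat letter list set monoid" where
  "surface_group g = presented_group {1..2 * g} {surface_relator g}"

text \<open>The element of the surface group represented by a word.\<close>

definition element :: "nat \<Rightarrow> nat letter list \<Rightarrow> nat letter list set" where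
  "element g w = pres_class {1..2 * g} {surface_relator g} w"

fun letter_less :: "nat letter \<Rightarrow> nat letter \<Rightarrow> bool" where
  "letter_less (Gen i) (Gen j) \<longleftrightarrow> j < i"
| "letter_less (Gen i) (InvGen j) \<longleftrightarrow> True"
| "letter_less (InvGen i) (Gen j) \<longleftrightarrow> False"
| "letter_less (InvGen i) (InvGen j) \<longleftrightarrow> i < j"

definition word_less :: "nat letter list \<Rightarrow> nat letter list \<Rightarrow> bool" where
  "word_less v w \<longleftrightarrow> (v, w) \<in> lenlex {(a, b). letter_less a b}"

text \<open>An element of the surface group is the set of all words representing it.\<close>

definition nf :: "nat letter list set \<Rightarrow> nat letter list" where
  "nf x = (THE w. w \<in> x \<and> (\<forall>v\<in>x. v \<noteq> w \<longrightarrow> word_less w v))"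

definition nf_word :: "nat \<Rightarrow> nat letter list \<Rightarrow> nat letter list" where
  "nf_word g w = nf (element g w)"

definition irreducible_word :: "nat \<Rightarrow> nat letter list \<Rightarrow> bool" where
  "irreducible_word g w \<longleftrightarrow> w \<in> words {1..2 * g} \<and> nf_word g w = w"

definition cyclically_irreducible :: "nat \<Rightarrow> nat letter list \<Rightarrow> bool" where
  "cyclically_irreducible g w \<longleftrightarrow> (\<forall>m. irreducible_word g (rotate m w))"

definition cyclically_freely_reduced :: "'a letter list \<Rightarrow> bool" where
  "cyclically_freely_reduced w \<longleftrightarrow>
     (\<forall>i. Suc i < length w \<longrightarrow> w ! i \<noteq> letter_inv (w ! Suc i)) \<and>
     (w \<noteq> [] \<longrightarrow> hd w \<noteq> letter_inv (last w))"

lemma group_surface_group: "group (surface_group g)"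
  by (simp add: surface_group_def group_presented_group)

lemma surface_relator_in_words: "surface_relator g \<in> words {1..2 * g}"
  by (auto simp: surface_relator_def words_def)

lemma carrier_surface_group: "carrier (surface_group g) = element g ` words {1..2 * g}"
  by (simp add: surface_group_def element_def[abs_def] carrier_presented_group)

lemma letter_less_irrefl: "\<not> letter_less a a"
  by (cases a) auto

lemma letter_less_trans: "letter_less a b \<Longrightarrow> letter_less b c \<Longrightarrow> letter_less a c"
  by (cases a; cases b; cases c) auto

lemma letter_less_total: "a \<noteq> b \<Longrightarrow> letter_less a b \<or> letter_less b a"
  by (cases a; cases b) auto

lemma word_less_irrefl: "\<not> word_less w w"
  unfolding word_less_def by (rule lenlex_irreflexive) (simp add: letter_less_irrefl)

lemma word_less_trans: "word_less u v \<Longrightarrow> word_less v w \<Longrightarrow> word_less u w"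
  unfolding word_less_def
  by (erule (1) lenlex_trans) (auto intro: transI letter_less_trans)

lemma word_less_total: "v \<noteq> w \<Longrightarrow> word_less v w \<or> word_less w v"
  using total_lenlex[of "{(a, b). letter_less a b}"] letter_less_total
  by (auto simp: total_on_def word_less_def)

lemma nf_least:
  assumes "x \<in> carrier (surface_group g)"
  shows "nf x \<in> x \<and> (\<forall>v\<in>x. v \<noteq> nf x \<longrightarrow> word_less (nf x) v)"
proof -
  let ?A = "Gen ` {1..2 * g} \<union> InvGen ` {1..2 * g}"
  obtain w where w: "w \<in> words {1..2 * g}" "x = element g w"
    using assms by (auto simp: carrier_surface_group)
  have mem: "w \<in> x"
    using w by (simp add: element_def pres_class_def pres_rel_def pres_eq.refl)
  have sub: "x \<subseteq> words {1..2 * g}"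
    using w by (auto simp: element_def pres_class_def pres_rel_def dest: pres_eq_words)
  define y where "y = {v \<in> x. length v \<le> length w}"
  have "y \<subseteq> {v. set v \<subseteq> ?A \<and> length v \<le> length w}"
    using sub by (auto simp: y_def words_def)
  then have fin: "finite y"
    by (rule finite_subset) (rule finite_lists_length_le, simp)
  have "\<exists>m\<in>z. \<forall>v\<in>z. v \<noteq> m \<longrightarrow> word_less m v" if "finite z" "z \<noteq> {}" for z
    using that
  proof (induction rule: finite_ne_induct)
    case (singleton u)
    then show ?case by simp
  next
    case (insert u z)
    then obtain m where m: "m \<in> z" "\<forall>v\<in>z. v \<noteq> m \<longrightarrow> word_less m v" by blast
    have "u \<noteq> m" using m insert.hyps by blast
    then consider "word_less u m" | "word_less m u" using word_less_total by blast
    then show ?case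
    proof cases
      case 1
      then have "\<forall>v\<in>insert u z. v \<noteq> u \<longrightarrow> word_less u v"
        using m by (metis insert_iff word_less_trans)
      then show ?thesis by blast
    next
      case 2
      then show ?thesis using m by blast
    qed
  qed
  from this[OF fin] obtain m where m: "m \<in> y" "\<forall>v\<in>y. v \<noteq> m \<longrightarrow> word_less m v"
    using mem by (auto simp: y_def)
  have "word_less m v" if "v \<in> x" "v \<noteq> m" for v
  proof (cases "v \<in> y")
    case True
    then show ?thesis using m that by blast
  next
    case False
    then have "length m < length v" using m that by (auto simp: y_def)
    then show ?thesis by (simp add: word_less_def lenlex_conv)
  qed
  then have min: "m \<in> x \<and> (\<forall>v\<in>x. v \<noteq> m \<longrightarrow> word_less m v)"
    using m by (simp add: y_def)
  show ?thesis
    unfolding nf_def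
  proof (rule theI[of "\<lambda>w. w \<in> x \<and> (\<forall>v\<in>x. v \<noteq> w \<longrightarrow> word_less w v)", OF min])
    fix w assume "w \<in> x \<and> (\<forall>v\<in>x. v \<noteq> w \<longrightarrow> word_less w v)"
    then show "w = m" using min by (metis word_less_irrefl word_less_trans)
  qed
qed

end

theory Submission
  imports Defs "HOL-Library.Sublist"
begin

text \<open>The normal forms are exactly the words without a factor \<open>x x\<^sup>-\<^sup>1\<close>, without a half relator that is
  larger than its complementary half, and without a factor \<open>x B\<^sup>k x\<^sup>-\<^sup>1\<close> where \<open>x B\<close> is a half relator and
  \<open>k \<ge> 1\<close> (such a factor shortens because \<open>x\<close> moves across \<open>B\<close>). Any other word can be replaced by a
  smaller one, and the words without these factors are pairwise distinct in \<open>G\<close> because the letters act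
  on them by right multiplication compatibly with the relator.

  Let \<open>Y X Y\<^sup>-\<^sup>1\<close> be a normal form with \<open>X\<close> cyclically freely reduced. If \<open>X X\<close> has no forbidden
  factor, then neither has \<open>Y X\<^sup>k Y\<^sup>-\<^sup>1\<close>. Otherwise a forbidden factor crosses the junction of the two
  copies. Write \<open>X = P Q S\<close> where \<open>S P\<close> collapses to one letter \<open>e\<close> and consider \<open>Q e Q\<close>. Replacing a
  forbidden factor at \<open>e\<close> by the other side of its strip of relator cells, extended maximally to both
  sides, gives a rotation of \<open>X\<close> whose powers have no forbidden factor, unless the strip closes up to an
  annulus; then one further rotation by one letter and one further reduction suffice.\<close>

text \<open>Uniqueness is not proved by confluence of the infinite rewriting system but in the
  manner of van der Waerden: the words in \<open>L\<close> become the vertices of a graph with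
  exactly one outgoing edge per letter, and it suffices that every relator loop closes. A word in
  \<open>L\<close>, read from \<open>[]\<close>, ends at itself. The first letter of a forbidden
  factor never recurs in it. Therefore squares decide about all powers, and the two parts of a
  factor around a junction letter cannot overlap in the word between. The difficulty at a junction
  is that a strip, extended to both sides, might run into itself. A run through the junction letter
  of \<open>n\<close> letters is replaced by \<open>4 * g - n\<close> letters, and at least two are
  needed for the two ends to be independent; stacks are removed first because they are what makes
  longer runs possible. The replaced piece goes from a letter \<open>x\<close> to a letter
  \<open>y = s d x (D + 2 * g)\<close>. The bounds \<open>- 1 <= D <= 2 * g - 3\<close> keep the two
  extensions apart, and the bad half relator, \<open>D = - 1\<close>, is where the annulus can
  occur.\<close>

definition pw :: "nat \<Rightarrow> 'a list \<Rightarrow> 'a list" where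
  "pw k u = concat (replicate k u)"

lemma pw_0 [simp]: "pw 0 u = []"
  and pw_Suc [simp]: "pw (Suc k) u = u @ pw k u"
  by (simp_all add: pw_def)

lemma pw_add: "pw (j + k) u = pw j u @ pw k u"
  by (induction j) auto

lemma pw_comm: "u @ pw k u = pw k u @ u"
  by (induction k) auto

lemma pw_Suc2: "pw (Suc k) u = pw k u @ u"
  using pw_comm[of u k] by simp

lemma set_pw: "set (pw k u) \<subseteq> set u"
  by (induction k) auto

lemma length_pw [simp]: "length (pw k u) = k * length u"
  by (induction k) auto

lemma pw_Nil [simp]: "pw k [] = []"
  by (induction k) auto

lemma pw_eq_Nil [simp]: "pw k u = [] \<longleftrightarrow> k = 0 \<or> u = []"
  by (induction k) auto

lemma hd_pw [simp]: "0 < k \<Longrightarrow> u \<noteq> [] \<Longrightarrow> hd (pw k u) = hd u"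
  by (cases k) auto

lemma last_pw [simp]: "0 < k \<Longrightarrow> u \<noteq> [] \<Longrightarrow> last (pw k u) = last u"
  by (cases k) (auto simp: pw_comm simp del: pw_Suc simp add: pw_Suc2)

lemma map_pw: "map f (pw k u) = pw k (map f u)"
  by (induction k) auto

lemma rev_pw: "rev (pw k u) = pw k (rev u)"
  by (induction k) (auto simp: pw_comm)

lemma pw_split:
  assumes "p @ q = pw k B" "q \<noteq> []"
  shows "\<exists>k1 k2 B1 B2. B = B1 @ B2 \<and> B2 \<noteq> [] \<and> p = pw k1 B @ B1 \<and> q = B2 @ pw k2 B"
  using assms
proof (induction k arbitrary: p)
  case 0
  then show ?case by simp
next
  case (Suc k)
  then have "p @ q = B @ pw k B" by simp
  then obtain us where "p = B @ us \<and> us @ q = pw k B \<or> p @ us = B \<and> q = us @ pw k B"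
    by (auto simp: append_eq_append_conv2)
  then consider us where "p = B @ us" "us @ q = pw k B" | us where "p @ us = B" "q = us @ pw k B" "us \<noteq> []"
    by (cases "us = []") auto
  then show ?case
  proof cases
    case 1
    from Suc.IH[OF 1(2) Suc.prems(2)] obtain k1 k2 B1 B2 where
      "B = B1 @ B2" "B2 \<noteq> []" "us = pw k1 B @ B1" "q = B2 @ pw k2 B" by blast
    then show ?thesis using 1(1) by (intro exI[of _ "Suc k1"] exI[of _ k2] exI[of _ B1] exI[of _ B2]) auto
  next
    case 2
    then show ?thesis by (intro exI[of _ 0] exI[of _ k] exI[of _ p] exI[of _ us]) auto
  qed
qed

definition dir :: "int \<Rightarrow> bool" where "dir d \<longleftrightarrow> d = 1 \<or> d = -1"

lemma dir_minus [simp]: "dir (- d) \<longleftrightarrow> dir d"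
  by (auto simp: dir_def)

section \<open>Letters as residues modulo \<open>4 * g\<close>, runs and blocks\<close>

locale surf =
  fixes g :: nat
  assumes g2: "2 \<le> g"
begin

lemma gi: "2 \<le> int g" using g2 by simp

text \<open>Letters are coded by \<open>0, \<dots>, 4 g - 1\<close> in the order in which they occur in the relator, so that
  the factors of its cyclic powers are the ascending runs modulo \<open>4 g\<close> and those of its inverse the
  descending ones. The parameter \<open>d = \<plusminus> 1\<close> selects the direction.\<close>

definition inr :: "int \<Rightarrow> bool" where "inr x \<longleftrightarrow> 0 \<le> x \<and> x < 4 * int g"

definition s :: "int \<Rightarrow> int \<Rightarrow> int \<Rightarrow> int" where
  "s d x i = (x + d * i) mod (4 * int g)"

text \<open>In the relator a letter and its inverse are half a turn apart, so inversion is
  translation by \<open>2 * g\<close>, in either direction.\<close>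

definition bar :: "int \<Rightarrow> int" where "bar x = (x + 2 * int g) mod (4 * int g)"

lemma inr_s [simp]: "inr (s d x i)"
  using gi by (simp add: inr_def s_def)

lemma inr_bar [simp]: "inr (bar x)"
  using gi by (simp add: inr_def bar_def)

lemma s_s [simp]: "s d (s d x i) j = s d x (i + j)"
  by (simp add: s_def algebra_simps mod_simps)

lemma s_uminus: "s (- d) x i = s d x (- i)"
  by (simp add: s_def)

lemma s_0 [simp]: "inr x \<Longrightarrow> s d x 0 = x"
  by (simp add: s_def inr_def)

lemma bar_s: "dir d \<Longrightarrow> bar x = s d x (2 * int g)"
  by (auto simp: dir_def bar_def s_def mod_eq_dvd_iff)

lemma bar_s1 [simp]: "dir d \<Longrightarrow> bar (s d x i) = s d x (i + 2 * int g)"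
  by (simp add: bar_s)

lemma s_bar [simp]: "dir d \<Longrightarrow> s d (bar x) i = s d x (2 * int g + i)"
  by (simp add: bar_s)

lemma s_eq: "dir d \<Longrightarrow> s d x i = s d x j \<longleftrightarrow> (i - j) mod (4 * int g) = 0"
proof -
  assume "dir d"
  then have "4 * int g dvd (x + d * i) - (x + d * j) \<longleftrightarrow> 4 * int g dvd i - j"
    using dvd_minus_iff[of "4 * int g" "i - j"] by (auto simp: dir_def)
  then show ?thesis by (simp add: s_def mod_eq_dvd_iff dvd_eq_mod_eq_0)
qed

lemma s_period: "dir d \<Longrightarrow> i = j + 4 * int g \<Longrightarrow> s d x i = s d x j"
  by (simp add: s_eq)

lemma bar_bar [simp]: "inr x \<Longrightarrow> bar (bar x) = x"
  using s_period[of 1 "4 * int g" 0 x] by (simp add: bar_s[of 1] dir_def)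



text \<open>The offsets that are compared below differ by less than two periods. In this window a
  congruence modulo \<open>4 * g\<close> splits into three linear equations, so that equality of
  letters becomes linear arithmetic.\<close>

lemma s_eq8:
  assumes "dir d" "i - j < 8 * int g" "j - i < 8 * int g"
  shows "s d x i = s d x j \<longleftrightarrow> i = j \<or> i = j + 4 * int g \<or> j = i + 4 * int g"
proof
  assume "s d x i = s d x j"
  then have "4 * int g dvd i - j" using s_eq[OF assms(1)] by auto
  then obtain k where k: "i - j = 4 * int g * k" by (auto elim: dvdE)
  have "k < 2"
  proof (rule ccontr)
    assume "\<not> k < 2"
    then have "4 * int g * 2 \<le> 4 * int g * k" by (intro mult_left_mono) auto
    then show False using assms(2) k by linarith
  qed
  moreover have "- 2 < k"
  proof (rule ccontr)
    assume "\<not> - 2 < k"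
    then have "4 * int g * k \<le> 4 * int g * (- 2)" by (intro mult_left_mono) auto
    then show False using assms(3) k by linarith
  qed
  ultimately have "k = 0 \<or> k = 1 \<or> k = -1" by auto
  then show "i = j \<or> i = j + 4 * int g \<or> j = i + 4 * int g"
    using k by auto
next
  assume "i = j \<or> i = j + 4 * int g \<or> j = i + 4 * int g"
  then show "s d x i = s d x j" using s_period[OF assms(1)] by metis
qed

lemma s_eq4:
  assumes "dir d" "i - j < 4 * int g" "j - i < 4 * int g"
  shows "s d x i = s d x j \<longleftrightarrow> i = j"
  using s_eq8[OF assms(1), of i j x] assms(2,3) gi by auto

lemma s_move: "inr x \<Longrightarrow> s d x i = s d y j \<longleftrightarrow> x = s d y (j - i)"
  by (metis add.inverse_inverse add.right_inverse diff_conv_add_uminus eq_diff_eq inr_s s_0 s_s)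

lemma eq_s_self8:
  assumes "inr x" "dir d" "i < 8 * int g" "- i < 8 * int g"
  shows "x = s d x i \<longleftrightarrow> i = 0 \<or> i = 4 * int g \<or> i = - (4 * int g)"
  using s_eq8[of d 0 i x] assms by auto

definition run :: "int \<Rightarrow> int \<Rightarrow> nat \<Rightarrow> int list" where
  "run d x n = map (\<lambda>t. s d x (int t)) [0..<n]"

text \<open>The half relator \<open>x # blk d x\<close> equals the other half \<open>blk (- d) (bar x) @ [x]\<close> in the group: a letter
  \<open>x\<close> moves across a block and turns its direction.\<close>

definition blk :: "int \<Rightarrow> int \<Rightarrow> int list" where
  "blk d x = run d (s d x 1) (2 * g - 1)"

lemma length_run [simp]: "length (run d x n) = n"
  by (simp add: run_def)

lemma run_0 [simp]: "run d x 0 = []"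
  by (simp add: run_def)

lemma run_eq_Nil [simp]: "run d x n = [] \<longleftrightarrow> n = 0"
  by (simp add: run_def)

lemma nth_run [simp]: "i < n \<Longrightarrow> run d x n ! i = s d x (int i)"
  by (simp add: run_def)

lemma run_append: "run d x (m + n) = run d x m @ run d (s d x (int m)) n"
  by (rule nth_equalityI) (auto simp: nth_append)

lemma run_Suc: "inr x \<Longrightarrow> run d x (Suc n) = x # run d (s d x 1) n"
  using run_append[of d x 1 n] by (simp add: run_def)

lemma run_Suc2: "run d x (Suc n) = run d x n @ [s d x (int n)]"
  by (simp add: run_def)

lemma hd_run [simp]: "0 < n \<Longrightarrow> hd (run d x n) = s d x 0"
  by (cases n) (simp_all add: run_def upt_conv_Cons del: upt_Suc)

lemma last_run [simp]: "0 < n \<Longrightarrow> last (run d x n) = s d x (int n - 1)"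
  by (cases n) (simp_all add: run_def)

lemma length_blk [simp]: "length (blk d x) = 2 * g - 1"
  by (simp add: blk_def)

lemma blk_neq_Nil [simp]: "blk d x \<noteq> []"
  using g2 by (simp add: blk_def)

lemma hd_blk [simp]: "hd (blk d x) = s d x 1"
  using g2 by (simp add: blk_def)

lemma last_blk [simp]: "last (blk d x) = s d x (2 * int g - 1)"
  using g2 by (simp add: blk_def of_nat_diff)

lemma Cons_blk: "inr x \<Longrightarrow> x # blk d x = run d x (2 * g)"
  using run_Suc[of x d "2 * g - 1"] g2 by (simp add: blk_def)

lemma run_split:
  assumes "p @ q = run d x n"
  shows "p = run d x (length p) \<and> q = run d (s d x (int (length p))) (length q) \<and> n = length p + length q"
proof -
  have n: "n = length p + length q" using assms by (metis length_append length_run)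
  then have "p @ q = run d x (length p) @ run d (s d x (int (length p))) (length q)"
    using assms run_append by metis
  then show ?thesis using n by (simp add: append_eq_append_conv)
qed

lemma set_run: "dir d \<Longrightarrow> y \<in> set (run d x n) \<longleftrightarrow> (\<exists>i. 0 \<le> i \<and> i < int n \<and> y = s d x i)"
proof
  assume "y \<in> set (run d x n)"
  then obtain t where "t < n" "y = s d x (int t)" by (auto simp: run_def)
  then show "\<exists>i. 0 \<le> i \<and> i < int n \<and> y = s d x i" by (intro exI[of _ "int t"]) auto
next
  assume "\<exists>i. 0 \<le> i \<and> i < int n \<and> y = s d x i"
  then obtain i where "0 \<le> i" "i < int n" "y = s d x i" by blast
  then show "y \<in> set (run d x n)"
    unfolding run_def set_map by (intro image_eqI[of _ _ "nat i"]) auto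
qed

lemma set_blk: "dir d \<Longrightarrow> y \<in> set (blk d x) \<longleftrightarrow> (\<exists>i. 1 \<le> i \<and> i < 2 * int g \<and> y = s d x i)"
proof -
  assume d: "dir d"
  have "(\<exists>i. 0 \<le> i \<and> i < int (2 * g - 1) \<and> y = s d x (1 + i)) \<longleftrightarrow> (\<exists>i. 1 \<le> i \<and> i < 2 * int g \<and> y = s d x i)"
    (is "?l = ?r")
  proof
    assume ?l then obtain i where "0 \<le> i" "i < int (2 * g - 1)" "y = s d x (1 + i)" by blast
    then show ?r using g2 by (intro exI[of _ "1 + i"]) auto
  next
    assume ?r then obtain i where "1 \<le> i" "i < 2 * int g" "y = s d x i" by blast
    then show ?l using g2 by (intro exI[of _ "i - 1"]) auto
  qed
  then show ?thesis using d by (simp add: blk_def set_run)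
qed

lemma notin_blk:
  assumes "dir d" "inr x" shows "x \<notin> set (blk d x)" "bar x \<notin> set (blk d x)"
  using assms gi by (auto simp: set_blk bar_s eq_s_self8 s_eq4)

text \<open>\<open>bad d x\<close> says that \<open>x # blk d x\<close> is the lexicographically larger half of its relator.\<close>

definition bad :: "int \<Rightarrow> int \<Rightarrow> bool" where
  "bad d x \<longleftrightarrow> (if d = 1 then x = 0 \<or> 2 * int g < x else 2 * int g \<le> x)"

lemma mod_N:
  "0 \<le> z \<Longrightarrow> z < 4 * int g \<Longrightarrow> z mod (4 * int g) = z"
  "- (4 * int g) \<le> z \<Longrightarrow> z < 0 \<Longrightarrow> z mod (4 * int g) = z + 4 * int g"
  "4 * int g \<le> z \<Longrightarrow> z < 8 * int g \<Longrightarrow> z mod (4 * int g) = z - 4 * int g"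
  using mod_pos_pos_trivial[of "z + 4 * int g" "4 * int g"] mod_pos_pos_trivial[of "z - 4 * int g" "4 * int g"]
    mod_add_self2[of z "4 * int g"] mod_diff_right_eq[of z "4 * int g" "4 * int g"]
  by auto

text \<open>The complementary half of \<open>x # blk d x\<close> starts with
  \<open>s d x (2 * int g - 1)\<close> and runs in direction \<open>- d\<close>. The two halves
  differ in their first letters, so exactly one of them is the larger.\<close>

lemma bad_compl:
  assumes "dir d" "inr x"
  shows "bad (- d) (s d x (2 * int g - 1)) \<longleftrightarrow> \<not> bad d x"
proof -
  consider "d = 1" "x + 2 * int g - 1 < 4 * int g" | "d = 1" "4 * int g \<le> x + 2 * int g - 1"
    | "d = -1" "x + - (2 * int g - 1) < 0" | "d = -1" "0 \<le> x + - (2 * int g - 1)"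
    using assms(1) unfolding dir_def by linarith
  then show ?thesis
    using assms gi by cases (auto simp: bad_def s_def inr_def mod_N)
qed

text \<open>The halves starting at \<open>x\<close> and at \<open>bar x\<close> in the same
  direction make up one cyclic relator. Two such opposite halves can therefore not both occur in a
  reduced word.\<close>

lemma bad_bar:
  assumes "dir d" "inr x"
  shows "bad d x \<or> bad d (bar x)"
proof -
  consider "x + 2 * int g < 4 * int g" | "4 * int g \<le> x + 2 * int g" by linarith
  then show ?thesis
    using assms gi by cases (auto simp: bad_def bar_def inr_def mod_N dir_def)
qed

text \<open>The relabelling \<open>neg\<close> followed by reversal preserves the forbidden factors; it turns statements on
  suffixes into statements on prefixes.\<close>

definition neg :: "int \<Rightarrow> int" where "neg x = (- x) mod (4 * int g)"

lemma inr_neg [simp]: "inr (neg x)"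
  using gi by (simp add: inr_def neg_def)

lemma neg_neg [simp]: "inr x \<Longrightarrow> neg (neg x) = x"
  by (simp add: neg_def inr_def mod_minus_eq)

lemma neg_s: "neg (s d x i) = s d (neg x) (- i)"
  by (simp add: neg_def s_def mod_simps)

lemma neg_bar [simp]: "neg (bar x) = bar (neg x)"
proof -
  have "neg (bar x) = s 1 (neg x) (- (2 * int g))" by (simp add: bar_s[of 1] dir_def neg_s)
  also have "\<dots> = bar (neg x)"
    using s_period[of 1 "2 * int g" "- (2 * int g)"] by (simp add: bar_s[of 1] dir_def)
  finally show ?thesis .
qed

text \<open>A mirrored half relator starts with \<open>neg\<close> of the former last letter.
  \<open>neg\<close> neither preserves nor reverses the order of the letters, so the invariance of
  \<open>bad\<close> is checked by computing the residue in each range.\<close>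

lemma bad_neg:
  assumes "dir d" "inr x"
  shows "bad d (neg (s d x (2 * int g - 1))) \<longleftrightarrow> bad d x"
proof -
  define z where "z = neg (s d x (2 * int g - 1))"
  have e: "z = (- x - d * (2 * int g - 1)) mod (4 * int g)"
    by (simp add: z_def neg_def s_def mod_simps)
  have x: "0 \<le> x" "x < 4 * int g" using assms by (auto simp: inr_def)
  consider (1) "d = 1" "- x - (2 * int g - 1) < - (4 * int g)"
    | (2) "d = 1" "- (4 * int g) \<le> - x - (2 * int g - 1)" "- x - (2 * int g - 1) < 0"
    | (3) "d = -1" "- x + (2 * int g - 1) < 0" | (4) "d = -1" "0 \<le> - x + (2 * int g - 1)"
    using assms gi unfolding dir_def inr_def by linarith
  then have "bad d z \<longleftrightarrow> bad d x"
  proof cases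
    case 1
    have "z = (- x - (2 * int g - 1) + 4 * int g) mod (4 * int g)"
      unfolding e using 1 mod_add_self2[of "- x - (2 * int g - 1)" "4 * int g"] by simp
    then have "z = - x - (2 * int g - 1) + 8 * int g" using mod_N(2) 1 x gi by auto
    then show ?thesis using 1 x by (auto simp: bad_def)
  next
    case 2
    then have "z = - x - (2 * int g - 1) + 4 * int g" unfolding e using mod_N(2)[of "- x - (2 * int g - 1)"] by simp
    then show ?thesis using 2 x by (auto simp: bad_def)
  next
    case 3
    have "z = (- x + (2 * int g - 1)) mod (4 * int g)" unfolding e using 3 by (simp add: algebra_simps)
    then have "z = - x + (2 * int g - 1) + 4 * int g" using 3 mod_N(2)[of "- x + (2 * int g - 1)"] x gi by linarith
    then show ?thesis using 3 x by (auto simp: bad_def)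
  next
    case 4
    have "z = (- x + (2 * int g - 1)) mod (4 * int g)" unfolding e using 4 by (simp add: algebra_simps)
    then have "z = - x + (2 * int g - 1)" using 4 mod_N(1)[of "- x + (2 * int g - 1)"] x gi by linarith
    then show ?thesis using 4 x by (auto simp: bad_def)
  qed
  then show ?thesis by (simp add: z_def)
qed

definition mir :: "int list \<Rightarrow> int list" where "mir w = rev (map neg w)"

lemma mir_append [simp]: "mir (u @ v) = mir v @ mir u"
  by (simp add: mir_def)

lemma mir_mir: "\<forall>x\<in>set w. inr x \<Longrightarrow> mir (mir w) = w"
  by (simp add: mir_def rev_map map_idI)

lemma mir_Nil [simp]: "mir [] = []"
  by (simp add: mir_def)

lemma mir_Cons [simp]: "mir (x # w) = mir w @ [neg x]"
  by (simp add: mir_def)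

lemma mir_eq_Nil [simp]: "mir u = [] \<longleftrightarrow> u = []"
  by (simp add: mir_def)

lemma length_mir [simp]: "length (mir u) = length u"
  by (simp add: mir_def)

lemma set_mir_inr: "x \<in> set (mir w) \<Longrightarrow> inr x"
  by (auto simp: mir_def)

lemma mir_run: "mir (run d x n) = run d (neg (s d x (int n - 1))) n"
  by (rule nth_equalityI) (auto simp: mir_def rev_nth neg_s of_nat_diff algebra_simps)

lemma mir_blk: "dir d \<Longrightarrow> mir (blk d x) = blk d (bar (neg x))"
  using g2 s_eq8[of d "- 2 * int g + 1" "2 * int g + 1" "neg x"]
  by (simp add: blk_def mir_run neg_s of_nat_diff)

lemma mir_pw: "mir (pw k u) = pw k (mir u)"
  by (simp add: mir_def map_pw rev_pw)

section \<open>Forbidden factors and criteria for gluing\<close>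

definition adj :: "int \<Rightarrow> int \<Rightarrow> int \<Rightarrow> bool" where
  "adj d a b \<longleftrightarrow> b = s d a 1 \<or> b = s d a (2 * int g + 2)"

definition forbd :: "int \<Rightarrow> int list \<Rightarrow> bool" where
  "forbd d w \<longleftrightarrow> (\<exists>x k. inr x \<and> 1 \<le> k \<and> w = x # pw k (blk d x) @ [bar x]) \<or>
     (\<exists>x. inr x \<and> bad d x \<and> w = x # blk d x)"

text \<open>The pair \<open>[x, bar x]\<close> is the case \<open>k = 0\<close> of the first kind in
  \<open>forbd\<close>. It is kept apart because it belongs to no direction.\<close>

definition forb :: "int list \<Rightarrow> bool" where
  "forb w \<longleftrightarrow> (\<exists>x. inr x \<and> w = [x, bar x]) \<or> (\<exists>d. dir d \<and> forbd d w)"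

definition L :: "int list \<Rightarrow> bool" where
  "L w \<longleftrightarrow> (\<forall>x\<in>set w. inr x) \<and> (\<forall>f. forb f \<longrightarrow> \<not> sublist f w)"

lemma L_sublist: "L w \<Longrightarrow> sublist u w \<Longrightarrow> L u"
  unfolding L_def using set_mono_sublist sublist_order.order_trans by blast

lemma L_factor: "L (p @ u @ r) \<Longrightarrow> L u"
  by (rule L_sublist) auto

lemma L_app1: "L (u @ v) \<Longrightarrow> L u" and L_app2: "L (u @ v) \<Longrightarrow> L v"
  using L_factor[of "[]" u v] L_factor[of u v "[]"] by auto

lemma forb_F1: "inr x \<Longrightarrow> forb [x, bar x]"
  by (auto simp: forb_def)

lemma forb_F2: "dir d \<Longrightarrow> inr x \<Longrightarrow> forb (x # pw k (blk d x) @ [bar x])"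
proof (cases k)
  case 0
  then show "inr x \<Longrightarrow> forb (x # pw k (blk d x) @ [bar x])" by (simp add: forb_F1)
next
  case (Suc j)
  then show "dir d \<Longrightarrow> inr x \<Longrightarrow> forb (x # pw k (blk d x) @ [bar x])"
    unfolding forb_def forbd_def by (metis One_nat_def Suc_le_mono zero_le)
qed

lemma forb_F3: "dir d \<Longrightarrow> inr x \<Longrightarrow> bad d x \<Longrightarrow> forb (run d x (2 * g))"
  unfolding forb_def forbd_def using Cons_blk by metis

lemma not_L: "forb f \<Longrightarrow> \<not> L (p @ f @ r)"
  unfolding L_def by blast

lemma forb_mir:
  assumes "forb f" shows "forb (mir f)"
proof -
  consider x where "inr x" "f = [x, bar x]" | d x k where "dir d" "inr x" "f = x # pw k (blk d x) @ [bar x]"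
    | d x where "dir d" "inr x" "bad d x" "f = x # blk d x"
    using assms unfolding forb_def forbd_def by blast
  then show ?thesis
  proof cases
    case 1
    then have "mir f = [bar (neg x), bar (bar (neg x))]" by (simp add: mir_def)
    then show ?thesis using forb_F1[of "bar (neg x)"] by simp
  next
    case 2
    have "f = [x] @ pw k (blk d x) @ [bar x]" using 2 by simp
    then have "mir f = bar (neg x) # pw k (blk d (bar (neg x))) @ [bar (bar (neg x))]"
      using 2 by (simp add: mir_pw mir_blk)
    then show ?thesis using forb_F2[OF 2(1), of "bar (neg x)" k] by simp
  next
    case 3
    have "mir f = run d (neg (s d x (2 * int g - 1))) (2 * g)"
      using 3 by (simp add: Cons_blk mir_run)
    then show ?thesis using 3 forb_F3[OF 3(1), of "neg (s d x (2 * int g - 1))"] by (simp add: bad_neg)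
  qed
qed

lemma sublist_mir: "sublist f w \<Longrightarrow> sublist (mir f) (mir w)"
  unfolding sublist_def by (auto) (metis append.assoc)

lemma L_mir: "L w \<Longrightarrow> L (mir w)"
proof -
  assume w: "L w"
  have "\<not> sublist f (mir w)" if "forb f" for f
  proof
    assume "sublist f (mir w)"
    then have "sublist (mir f) (mir (mir w))" by (rule sublist_mir)
    moreover have "mir (mir w) = w" using w by (intro mir_mir) (auto simp: L_def)
    ultimately show False using forb_mir[OF that] w by (auto simp: L_def)
  qed
  then show ?thesis by (auto simp: L_def set_mir_inr)
qed

lemma L_mir_iff: "\<forall>x\<in>set w. inr x \<Longrightarrow> L (mir w) \<longleftrightarrow> L w"
  using L_mir[of w] L_mir[of "mir w"] mir_mir by auto

lemma forb_cases [consumes 1, case_names F1 F2 F3]: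
  assumes "forb f"
  obtains x where "inr x" "f = [x, bar x]"
    | d x k where "dir d" "inr x" "1 \<le> k" "f = x # pw k (blk d x) @ [bar x]"
    | d x where "dir d" "inr x" "bad d x" "f = x # blk d x"
  using assms unfolding forb_def forbd_def by blast

text \<open>A block following \<open>x\<close> runs strictly between \<open>x\<close> and
  \<open>bar x\<close>, hence avoids both. This is what bounds a forbidden factor against a period
  of a power.\<close>

lemma forb_hd: "forb f \<Longrightarrow> f \<noteq> [] \<and> hd f \<notin> set (tl f)"
proof -
  have ne: "x \<noteq> bar x" if "inr x" for x
    using that eq_s_self8[OF that, of 1 "2 * int g"] gi by (simp add: bar_s[of 1] dir_def)
  assume "forb f"
  then show ?thesis
  proof (cases rule: forb_cases)
    case (F2 d x k)
    then show ?thesis using set_pw[of k "blk d x"] notin_blk[of d x] ne by auto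
  next
    case (F3 d x)
    then show ?thesis using notin_blk[of d x] by auto
  qed (use ne in auto)
qed

lemma succ_run: "dir d \<Longrightarrow> successively (adj d) (run d x n)"
proof (induction n)
  case (Suc n)
  then show ?case
    by (cases "n = 0") (auto simp: run_Suc2 successively_append_iff adj_def)
qed simp

text \<open>Inside a block the step is \<open>1\<close>; from the end
  \<open>s d x (2 * int g - 1)\<close> of a block to the start \<open>s d x 1\<close> of the next
  one it is \<open>2 * g + 2\<close> modulo \<open>4 * g\<close>. These are the two alternatives of
  \<open>adj\<close>.\<close>

lemma succ_pw: "dir d \<Longrightarrow> inr x \<Longrightarrow> successively (adj d) (x # pw k (blk d x))"
proof (induction k)
  case (Suc k)
  have e: "x # pw (Suc k) (blk d x) = (x # pw k (blk d x)) @ blk d x"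
    by (simp add: pw_comm)
  have l: "last (x # pw k (blk d x)) = (if k = 0 then s d x 0 else s d x (2 * int g - 1))"
    using Suc.prems by auto
  have "successively (adj d) (blk d x)" unfolding blk_def by (rule succ_run) fact
  moreover have "adj d (last (x # pw k (blk d x))) (hd (blk d x))"
    unfolding l adj_def using Suc.prems s_eq8[of d 1 "4 * int g + 1" x] gi by auto
  ultimately show ?case unfolding e successively_append_iff using Suc by auto
qed simp

lemma forbd_succ: "dir d \<Longrightarrow> forbd d w \<Longrightarrow> successively (adj d) w"
proof -
  assume d: "dir d" and "forbd d w"
  then consider x k where "inr x" "1 \<le> k" "w = (x # pw k (blk d x)) @ [bar x]" | x where "inr x" "w = x # pw 1 (blk d x)"
    unfolding forbd_def by auto
  then show ?thesis
  proof cases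
    case 1
    then show ?thesis unfolding 1(3) successively_append_iff using d succ_pw[of d x k]
      by (auto simp: adj_def bar_s)
  next
    case 2
    then show ?thesis using succ_pw[of d x 1] d by simp
  qed
qed

lemma forbd_adj: "dir d \<Longrightarrow> forbd d (p @ q) \<Longrightarrow> p \<noteq> [] \<Longrightarrow> q \<noteq> [] \<Longrightarrow> adj d (last p) (hd q)"
  using forbd_succ[of d "p @ q"] by (simp add: successively_append_iff)

text \<open>A step of \<open>2 * g + 2\<close> never occurs inside a run, so it marks a boundary
  between two blocks. This excludes half relators and forces both parts to consist of whole
  blocks.\<close>

lemma forbd_break:
  assumes d: "dir d" and f: "forbd d (p @ q)" and ne: "p \<noteq> []" "q \<noteq> []"
    and br: "hd q = s d (last p) (2 * int g + 2)"
  shows "\<exists>x k1 k2. inr x \<and> 1 \<le> k1 \<and> 1 \<le> k2 \<and> p = x # pw k1 (blk d x) \<and> q = pw k2 (blk d x) @ [bar x]"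
proof -
  have nr: False if "p' @ q' = run d x n" "p' \<noteq> []" "q' \<noteq> []" "last p' = last p" "hd q' = hd q" for p' q' x n
  proof -
    from run_split[OF that(1)] have "last p = s d x (int (length p') - 1)" "hd q = s d x (int (length p'))"
      using that by (metis last_run length_greater_0_conv, metis hd_run length_greater_0_conv s_s add.right_neutral)
    then show False using br d gi by (simp add: s_eq8)
  qed
  from f consider x k where "inr x" "1 \<le> k" "p @ q = x # pw k (blk d x) @ [bar x]"
    | x where "inr x" "p @ q = x # blk d x"
    unfolding forbd_def by blast
  then show ?thesis
  proof cases
    case 1
    obtain q' where q': "q = q' @ [bar x]" "p @ q' = x # pw k (blk d x)"
    proof -
      have "q = butlast q @ [last q]" using ne by simp
      moreover have "p @ butlast q @ [last q] = (x # pw k (blk d x)) @ [bar x]" using 1 ne by simp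
      ultimately show ?thesis using that[of "butlast q"]
        by (metis append.assoc append1_eq_conv)
    qed
    have q'ne: "q' \<noteq> []"
    proof
      assume "q' = []"
      then have "last p = s d x (2 * int g - 1)" "hd q = s d x (2 * int g)" using q' 1 d by (auto simp: bar_s)
      then show False using br d gi by (simp add: s_eq8)
    qed
    obtain p' where p': "p = x # p'" "p' @ q' = pw k (blk d x)"
      using q' ne by (cases p) auto
    obtain k1 k2 B1 B2 where B: "blk d x = B1 @ B2" "B2 \<noteq> []" "p' = pw k1 (blk d x) @ B1" "q' = B2 @ pw k2 (blk d x)"
      using pw_split[OF p'(2) q'ne] by blast
    have B1: "B1 = []"
    proof (rule ccontr)
      assume "B1 \<noteq> []"
      then show False using nr[of B1 B2 "s d x 1" "2 * g - 1"] B p' q' by (simp add: blk_def)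
    qed
    have "k1 \<noteq> 0"
    proof
      assume "k1 = 0"
      then have "last p = s d x 0" "hd q = s d x 1" using p' B B1 q' 1 hd_blk[of d x] by auto
      then show False using br d gi by (simp add: s_eq8)
    qed
    then show ?thesis using p' q' B B1 1 by (intro exI[of _ x] exI[of _ k1] exI[of _ "Suc k2"]) auto
  next
    case 2
    then show ?thesis using nr[of p q x "2 * g"] ne by (simp add: Cons_blk)
  qed
qed

text \<open>The condition on \<open>u\<close> under which a word starting with \<open>s d x (2 * int g - 1)\<close> and leaving the relator
  direction \<open>d\<close> at once can be appended to \<open>u\<close> without a forbidden factor.\<close>

definition JL :: "int \<Rightarrow> int list \<Rightarrow> int \<Rightarrow> bool" where
  "JL d u x \<longleftrightarrow> (\<forall>k. \<not> suffix (bar x # pw k (blk (- d) (bar x))) u) \<and>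
     (\<forall>k. \<not> suffix (s d x (- 1) # pw k (blk d (s d x (- 1)))) u) \<and>
     (bad d x \<longrightarrow> \<not> suffix (run d x (2 * g - 1)) u)"

lemma dir_cases: "dir d \<Longrightarrow> dir e \<Longrightarrow> e = d \<or> e = - d"
  by (auto simp: dir_def)

text \<open>\<open>v\<close> leaves direction \<open>d\<close> after one letter, so a factor of
  direction \<open>d\<close> across the junction ends with that letter; the second and third clauses
  of \<open>JL\<close> exclude this. A factor of direction \<open>- d\<close> enters
  \<open>v\<close> either by a unit step, so that \<open>u\<close> ends in \<open>bar x\<close>, or
  at a block boundary, so that \<open>u\<close> ends in \<open>bar x\<close> followed by blocks;
  both are excluded by the first clause.\<close>

lemma JL_glue:
  assumes d: "dir d" and x: "inr x" and Lu: "L u" and Lv: "L v"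
    and v: "v = s d x (2 * int g - 1) # v2 # vs"
    and nadj: "\<not> adj d (s d x (2 * int g - 1)) v2"
    and J: "JL d u x"
  shows "L (u @ v)"
proof -
  have "\<not> sublist f (u @ v)" if f: "forb f" for f
  proof
    assume "sublist f (u @ v)"
    then consider "sublist f u" | "sublist f v" | f1 f2 where "f = f1 @ f2" "suffix f1 u" "prefix f2 v"
      by (auto simp: sublist_append)
    then obtain f1 f2 where ff: "f = f1 @ f2" "suffix f1 u" "prefix f2 v"
      using Lu Lv f by (auto simp: L_def)
    have f1: "f1 \<noteq> []" using ff f Lv by (auto simp: L_def)
    have f2: "f2 \<noteq> []" using ff f Lu by (auto simp: L_def)
    obtain r where r: "v = f2 @ r" using ff(3) by (auto simp: prefix_def)
    have hd2: "hd f2 = s d x (2 * int g - 1)" using r v f2 by (cases f2) auto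
    have l1: "inr (last f1)" using ff(2) f1 Lu by (metis L_def last_in_set set_mono_suffix subsetD)
    have sf1: "suffix [last f1] u" using ff(2) f1
      by (metis append_butlast_last_id suffix_append suffix_order.order_refl suffix_order.order_trans suffixI)
    have J1: "\<not> suffix (bar x # pw k (blk (- d) (bar x))) u"
      and J2: "\<not> suffix (s d x (- 1) # pw k (blk d (s d x (- 1)))) u"
      and J3: "bad d x \<Longrightarrow> \<not> suffix (run d x (2 * g - 1)) u" for k
      using J by (auto simp: JL_def)
    have n1: "last f1 \<noteq> bar x" using J1[of 0] sf1 by auto
    have n2: "last f1 \<noteq> s d x (- 1)" using J2[of 0] sf1 by auto
    from f consider y where "inr y" "f = [y, bar y]" | e where "dir e" "forbd e f"
      unfolding forb_def by blast
    then show False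
    proof cases
      case 1
      then have "f1 = [y]" "f2 = [bar y]" using ff f1 f2 by (auto simp: append_eq_Cons_conv)
      then have "s d y (2 * int g) = s d x (2 * int g - 1)" "last f1 = y" using hd2 d by (auto simp: bar_s)
      then show False using n2 1 by (simp add: s_move)
    next
      case 2
      have ad: "adj e (last f1) (hd f2)" using forbd_adj[OF 2(1)] 2(2) ff f1 f2 by auto
      from dir_cases[OF d 2(1)] show False
      proof
        assume e: "e = d"
        have "f2 = [hd f2]"
        proof (rule ccontr)
          assume "f2 \<noteq> [hd f2]"
          then obtain r' where "f2 = s d x (2 * int g - 1) # v2 # r'" using r v f2 hd2
            by (cases f2; cases "tl f2") auto
          then have "f = (f1 @ [s d x (2 * int g - 1)]) @ (v2 # r')" using ff by simp
          then show False using forbd_adj[OF 2(1), of "f1 @ [s d x (2 * int g - 1)]" "v2 # r'"] 2 e nadj by simp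
        qed
        then have f': "f = f1 @ [s d x (2 * int g - 1)]" using ff hd2 by simp
        from 2(2) consider y k where "inr y" "f = (y # pw k (blk d y)) @ [s d y (2 * int g)]"
          | y where "inr y" "bad d y" "f = run d y (2 * g)"
          unfolding forbd_def e using d by (auto simp: bar_s Cons_blk)
        then show False
        proof cases
          case (1 y k)
          then have "f1 = y # pw k (blk d y)" "s d y (2 * int g) = s d x (2 * int g - 1)" using f' by auto
          then have "f1 = y # pw k (blk d y)" "y = s d x (- 1)" using 1 by (auto simp: s_move)
          then show False using J2[of k] ff by simp
        next
          case (2 y)
          have "run d y (2 * g) = run d y (2 * g - 1) @ [s d y (2 * int g - 1)]"
            using run_Suc2[of d y "2 * g - 1"] g2 by (simp add: of_nat_diff)
          then have "f1 = run d y (2 * g - 1)" "s d y (2 * int g - 1) = s d x (2 * int g - 1)" using f' 2 by auto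
          then have "f1 = run d y (2 * g - 1)" "y = s d x 0" using 2 by (auto simp: s_move)
          then show False using J3 ff 2 x by simp
        qed
      next
        assume e: "e = - d"
        from ad have "s d x (2 * int g - 1) = s d (last f1) (- 1) \<or> s d x (2 * int g - 1) = s e (last f1) (2 * int g + 2)"
          unfolding adj_def hd2 e by (simp add: s_uminus)
        then show False
        proof
          assume "s d x (2 * int g - 1) = s d (last f1) (- 1)"
          then have "s d (last f1) (- 1) = s d x (2 * int g - 1)" by simp
          then have "last f1 = bar x" using l1 d by (simp add: s_move bar_s)
          then show False using n1 by simp
        next
          assume b: "s d x (2 * int g - 1) = s e (last f1) (2 * int g + 2)"
          then obtain y k where y: "inr y" "1 \<le> k" "f1 = y # pw k (blk e y)"
            using forbd_break[OF 2(1), of f1 f2] 2(2) ff f1 f2 hd2 by auto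
          have "last f1 = s e y (2 * int g - 1)" using y by simp
          then have "s d x (2 * int g - 1) = s d y (- 4 * int g - 1)" using b 2(1) by (simp add: e s_uminus)
          also have "\<dots> = s d y (- 1)" using d gi by (simp add: s_eq8)
          finally have "s d y (- 1) = s d x (2 * int g - 1)" by simp
          then have "y = bar x" using y d by (simp add: s_move bar_s)
          then show False using J1[of k] y ff e by simp
        qed
      qed
    qed
  qed
  moreover have "\<forall>z\<in>set (u @ v). inr z" using Lu Lv by (auto simp: L_def)
  ultimately show ?thesis by (simp add: L_def)
qed

text \<open>Here \<open>y\<close> is the last letter of the replaced piece, and the word put to the
  left of \<open>v\<close> ends in \<open>s d y (2 * int g + 1)\<close>, the mirror image of
  starting in \<open>s d x (2 * int g - 1)\<close>.\<close>

definition JR :: "int \<Rightarrow> int list \<Rightarrow> int \<Rightarrow> bool" where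
  "JR d v y \<longleftrightarrow> JL d (mir v) (neg y)"

lemma adj_neg: "dir d \<Longrightarrow> inr a \<Longrightarrow> inr b \<Longrightarrow> adj d (neg b) (neg a) \<longleftrightarrow> adj d a b"
proof -
  assume d: "dir d" and ab: "inr a" "inr b"
  have "neg a = s d (neg b) i \<longleftrightarrow> b = s d a i" for i
    using ab neg_s[of d b "-i"] neg_s[of d a i]
    by (metis add.inverse_inverse add.right_inverse neg_neg neg_s s_0 s_s)
  then show ?thesis by (simp add: adj_def)
qed

lemma JR_glue:
  assumes d: "dir d" and y: "inr y" and Lu: "L u" and Lv: "L v"
    and u: "u = us @ [u2, s d y (2 * int g + 1)]"
    and nadj: "\<not> adj d u2 (s d y (2 * int g + 1))"
    and J: "JR d v y"
  shows "L (u @ v)"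
proof -
  have u2: "inr u2" using Lu u by (simp add: L_def)
  have "s d (neg y) (- (2 * int g + 1)) = s d (neg y) (2 * int g - 1)" using d gi by (simp add: s_eq8)
  then have m: "mir u = s d (neg y) (2 * int g - 1) # neg u2 # mir us"
    using u by (simp add: mir_def neg_s)
  have "neg (s d y (2 * int g + 1)) = s d (neg y) (2 * int g - 1)" using d gi by (simp add: neg_s s_eq8)
  then have "\<not> adj d (s d (neg y) (2 * int g - 1)) (neg u2)" 
    using adj_neg[OF d u2, of "s d y (2 * int g + 1)"] nadj by simp
  then have "L (mir v @ mir u)"
    using JL_glue[OF d _ L_mir[OF Lv] L_mir[OF Lu] m, of ] J d by (simp add: JR_def)
  then have "L (mir (u @ v))" by simp
  moreover have "\<forall>z\<in>set (u @ v). inr z" using Lu Lv by (auto simp: L_def)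
  ultimately show ?thesis using L_mir_iff by blast
qed

text \<open>A forbidden factor that starts in one copy of \<open>w\<close> and covers the whole next
  copy would repeat its first letter. Hence it meets at most two copies.\<close>

lemma L_pw:
  assumes "L (w @ w)" shows "L (pw k w)"
proof (induction k)
  case 0
  then show ?case using assms by (auto simp: L_def forb_hd)
next
  case (Suc k)
  have "\<not> sublist f (w @ pw k w)" if f: "forb f" for f
  proof
    assume "sublist f (w @ pw k w)"
    then obtain f1 f2 where ff: "f = f1 @ f2" "suffix f1 w" "prefix f2 (pw k w)"
      using f Suc.IH assms L_app1[OF assms] by (auto simp: sublist_append L_def)
    have f1: "f1 \<noteq> []" using ff f Suc.IH by (auto simp: L_def)
    have k: "k \<noteq> 0" using ff f L_app1[OF assms] by (intro notI) (auto simp: L_def)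
    then obtain k' where k': "k = Suc k'" by (cases k) auto
    consider "prefix f2 w" | r where "f2 = w @ r"
      using ff(3) unfolding k' pw_Suc prefix_append by auto
    then show False
    proof cases
      case 1
      then have "sublist f (w @ w)" using ff sublist_append by blast
      then show False using f assms by (simp add: L_def)
    next
      case 2
      then have "hd f \<in> set (tl f)" using ff(1,2) f1 set_mono_suffix[OF ff(2)]
        by (cases f1) auto
      then show False using forb_hd[OF f] by simp
    qed
  qed
  then show ?case using Suc.IH assms by (auto simp: L_def)
qed

lemma L_rotate:
  assumes "L (w @ w)" shows "L (rotate m w)"
proof -
  have "w @ w = take (m mod length w) w @ rotate m w @ drop (m mod length w) w"
    by (simp add: rotate_drop_take)
  then show ?thesis using assms L_factor by metis
qed

section \<open>Words that turn in one direction only\<close>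

definition norun :: "int \<Rightarrow> int list \<Rightarrow> bool" where
  "norun d w \<longleftrightarrow> (\<forall>b. inr b \<longrightarrow> \<not> sublist (run d b (2 * g)) w)"

text \<open>The steps that occur on the reduced side of a strip. The step \<open>3\<close> appears
  when a block of the left extension is followed immediately by a block of the right one, from
  \<open>s e f (2 * int g - 1)\<close> to \<open>s e f (2 * int g + 2)\<close>.\<close>

definition stp :: "int \<Rightarrow> int \<Rightarrow> int \<Rightarrow> bool" where
  "stp d a b \<longleftrightarrow> b = s d a 1 \<or> b = s d a (2 * int g + 2) \<or> b = s d a 3"

lemma norun_sublist: "norun d w \<Longrightarrow> sublist u w \<Longrightarrow> norun d u"
  unfolding norun_def using sublist_order.order_trans by blast

lemma norun_no:
  assumes "norun d w" "inr b" "sublist f w" "f = p @ run d b (2 * g) @ r"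
  shows False
proof -
  have "sublist (run d b (2 * g)) f" unfolding assms(4) sublist_def by blast
  then have "sublist (run d b (2 * g)) w" using assms(3) by (rule sublist_order.order_trans)
  then show False using assms(1,2) by (simp add: norun_def)
qed

lemma norun_short: "length w < 2 * g \<Longrightarrow> norun d w"
  unfolding norun_def using sublist_length_le by fastforce

lemma norun_Nil [simp]: "norun d []"
  using g2 by (intro norun_short) simp

lemma norun_blk [simp]: "norun d (blk d x)"
  using g2 by (intro norun_short) simp

lemma run_cut:
  assumes "dir d" "f1 @ f2 = run d b n" "f1 \<noteq> []" "f2 \<noteq> []"
  shows "hd f2 = s d (last f1) 1"
proof -
  from run_split[OF assms(2)] have "last f1 = s d b (int (length f1) - 1)" "hd f2 = s d b (int (length f1))"
    using assms(3,4) by (metis last_run length_greater_0_conv, metis hd_run length_greater_0_conv s_s add.right_neutral)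
  then show ?thesis by simp
qed

lemma suffix_last: "suffix f u \<Longrightarrow> f \<noteq> [] \<Longrightarrow> last f = last u"
  by (auto simp: suffix_def)

lemma prefix_hd: "prefix f u \<Longrightarrow> f \<noteq> [] \<Longrightarrow> hd f = hd u"
  by (auto simp: prefix_def)

lemma run_glue:
  assumes "dir d" "u = [] \<or> v = [] \<or> hd v \<noteq> s d (last u) 1" "0 < n" "sublist (run d b n) (u @ v)"
  shows "sublist (run d b n) u \<or> sublist (run d b n) v"
proof (rule ccontr)
  assume c: "\<not> ?thesis"
  with assms(4) obtain f1 f2 where f: "run d b n = f1 @ f2" "suffix f1 u" "prefix f2 v"
    by (auto simp: sublist_append)
  have ne: "f1 \<noteq> []" "f2 \<noteq> []" using f c by auto
  have "u \<noteq> []" "v \<noteq> []" using ne f by auto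
  moreover have "hd v = s d (last u) 1"
    using run_cut[OF assms(1) f(1)[symmetric] ne] suffix_last[OF f(2) ne(1)] prefix_hd[OF f(3) ne(2)] by simp
  ultimately show False using assms(2) by auto
qed

lemma norun_glue:
  "dir d \<Longrightarrow> norun d u \<Longrightarrow> norun d v \<Longrightarrow> u = [] \<or> v = [] \<or> hd v \<noteq> s d (last u) 1 \<Longrightarrow> norun d (u @ v)"
  unfolding norun_def
proof (intro allI impI notI)
  fix b
  assume *: "dir d" "\<forall>b. inr b \<longrightarrow> \<not> sublist (run d b (2 * g)) u" "\<forall>b. inr b \<longrightarrow> \<not> sublist (run d b (2 * g)) v"
    "u = [] \<or> v = [] \<or> hd v \<noteq> s d (last u) 1" "inr b" "sublist (run d b (2 * g)) (u @ v)"
  then have "sublist (run d b (2 * g)) u \<or> sublist (run d b (2 * g)) v"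
    using g2 by (intro run_glue) simp_all
  then show False using * by simp
qed

lemma norun_pw: "dir d \<Longrightarrow> norun d (pw k (blk d x))"
proof (induction k)
  case (Suc k)
  have "s d x 1 \<noteq> s d x (2 * int g)" using gi s_eq8[OF Suc.prems, of 1 "2 * int g" x] by auto
  then have "pw k (blk d x) = [] \<or> hd (pw k (blk d x)) \<noteq> s d (last (blk d x)) 1"
    by (cases "k = 0") simp_all
  then show ?case unfolding pw_Suc using norun_glue[OF Suc.prems norun_blk Suc.IH[OF Suc.prems]] by blast
qed simp

lemma succ_mono: "successively P w \<Longrightarrow> (\<And>a b. P a b \<Longrightarrow> Q a b) \<Longrightarrow> successively Q w"
  by (induction w rule: induct_list012) auto

lemma adj_stp: "adj d a b \<Longrightarrow> stp d a b"
  by (auto simp: adj_def stp_def)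

lemma forbd_len: "forbd d f \<Longrightarrow> \<exists>a b r. f = a # b # r"
proof -
  assume "forbd d f"
  then obtain x r where "f = x # r" "r \<noteq> []" unfolding forbd_def by auto
  then show ?thesis by (cases r) auto
qed

lemma successively_sublist: "successively P w \<Longrightarrow> sublist u w \<Longrightarrow> successively P u"
  by (auto simp: sublist_def successively_append_iff)

lemma stp_nadj: "dir d \<Longrightarrow> stp d a b \<Longrightarrow> \<not> adj (- d) a b"
proof
  assume d: "dir d" and a: "stp d a b" "adj (- d) a b"
  \<comment> \<open>This separates the step \<open>3\<close> from the backward step
    \<open>- (2 * g + 2)\<close>, by parity. The remaining coincidences are excluded by size, using
    \<open>2 <= g\<close>.\<close>
  have "2 * int g + 5 \<noteq> 4 * int g" by presburger
  then show False using a gi d by (auto simp: stp_def adj_def s_uminus s_eq8)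
qed

text \<open>Steps in \<open>stp d\<close> are neither cancellations nor steps of direction
  \<open>- d\<close>, so only the factors of direction \<open>d\<close> remain to be
  excluded.\<close>

lemma desc_L:
  assumes d: "dir d" and w: "\<forall>x\<in>set w. inr x" and st: "successively (stp d) w"
    and nf: "\<And>f. forbd d f \<Longrightarrow> \<not> sublist f w"
  shows "L w"
proof -
  have "\<not> sublist f w" if "forb f" for f
  proof
    assume "sublist f w"
    then have sf: "successively (stp d) f" using st successively_sublist by blast
    from \<open>forb f\<close> consider x where "inr x" "f = [x, bar x]" | e where "dir e" "forbd e f"
      unfolding forb_def by blast
    then show False
    proof cases
      case 1
      have "2 * int g \<noteq> 3" by presburger
      then show ?thesis using sf gi 1 d by (auto simp: stp_def bar_s[of d] s_eq8)
    next
      case 2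
      then obtain a b r where f: "f = a # b # r" using forbd_len by blast
      show ?thesis
      proof (cases "e = d")
        case True
        then show ?thesis using nf 2 \<open>sublist f w\<close> by blast
      next
        case False
        then have e: "e = - d" using dir_cases[OF d 2(1)] by simp
        have "adj e a b" using forbd_succ[OF 2] f by simp
        then show ?thesis using sf f e stp_nadj[OF d] by simp
      qed
    qed
  qed
  then show ?thesis using w by (simp add: L_def)
qed

lemma blk_snoc_run: "dir d \<Longrightarrow> inr x \<Longrightarrow> blk d x @ [bar x] = run d (s d x 1) (2 * g)"
  using run_Suc2[of d "s d x 1" "2 * g - 1"] g2 by (simp add: blk_def of_nat_diff bar_s)

text \<open>Every directed forbidden factor starts with a half relator. Either it is that half,
  which is then bad, or it also ends with a second half, starting one letter further on in the
  relator. So counting half relators suffices to exclude forbidden factors.\<close>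

lemma forbd_start:
  assumes "dir d" "forbd d f"
  shows "\<exists>x r. inr x \<and> f = run d x (2 * g) @ r \<and> hd f = x \<and> (r = [] \<longrightarrow> bad d x) \<and>
    (r \<noteq> [] \<longrightarrow> last f = bar x \<and> (\<exists>r'. r' \<noteq> [] \<and> f = r' @ run d (s d x 1) (2 * g)))"
proof -
  from assms(2) consider x k where "inr x" "1 \<le> k" "f = x # pw k (blk d x) @ [bar x]"
    | x where "inr x" "bad d x" "f = x # blk d x"
    unfolding forbd_def by blast
  then show ?thesis
  proof cases
    case 1
    then obtain j where k: "k = Suc j" by (cases k) auto
    have "f = (x # blk d x) @ pw j (blk d x) @ [bar x]" using 1 k by simp
    then have a: "f = run d x (2 * g) @ pw j (blk d x) @ [bar x]" using Cons_blk[OF 1(1)] by simp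
    have "f = (x # pw j (blk d x)) @ (blk d x @ [bar x])" using 1 k by (simp add: pw_comm)
    then have "f = (x # pw j (blk d x)) @ run d (s d x 1) (2 * g)" using blk_snoc_run[OF assms(1) 1(1)] by simp
    then have "\<exists>r'. r' \<noteq> [] \<and> f = r' @ run d (s d x 1) (2 * g)" by blast
    moreover have "hd f = x" "last f = bar x" using 1 by simp_all
    moreover have "pw j (blk d x) @ [bar x] \<noteq> []" by simp
    ultimately show ?thesis using 1(1) a by blast
  next
    case 2
    moreover have "hd f = x" using 2 by simp
    moreover have "f = run d x (2 * g) @ []" using 2 Cons_blk[of x d] by simp
    ultimately show ?thesis by blast
  qed
qed

lemma succ_stp_run: "dir d \<Longrightarrow> successively (stp d) (run d x n)"
  using succ_mono[OF succ_run[of d x n], of "stp d"] adj_stp by blast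

lemma succ_stp_pw: "dir d \<Longrightarrow> inr x \<Longrightarrow> successively (stp d) (x # pw k (blk d x))"
  using succ_mono[OF succ_pw[of d x k], of "stp d"] adj_stp by blast

lemma succ_stp_pw': "dir d \<Longrightarrow> inr x \<Longrightarrow> successively (stp d) (pw k (blk d x))"
  using succ_stp_pw[of d x k] by (cases "pw k (blk d x)") auto

lemma inr_run: "\<forall>y\<in>set (run d x n). inr y" by (auto simp: run_def)

lemma inr_blk: "\<forall>y\<in>set (blk d x). inr y" by (simp add: blk_def inr_run)

lemma inr_pw: "\<forall>y\<in>set (pw k (blk d x)). inr y"
  using set_pw[of k "blk d x"] inr_blk[of d x] by (meson subsetD)

lemma L_pw_blk: "dir d \<Longrightarrow> inr x \<Longrightarrow> L (pw k (blk d x))"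
proof (rule desc_L)
  fix f assume d: "dir d" and "forbd d f"
  then obtain x' r where "inr x'" "f = [] @ run d x' (2 * g) @ r" using forbd_start by force
  then show "\<not> sublist f (pw k (blk d x))" using norun_no[OF norun_pw[OF d]] by blast
qed (auto simp: inr_pw succ_stp_pw')

text \<open>Blocks alone contain no half relator, so the only one is the good half at the front. A
  longer forbidden factor would need a second half inside the blocks.\<close>

lemma L_Cons_pw_blk:
  assumes d: "dir d" and x: "inr x" and nb: "\<not> bad d x"
  shows "L (x # pw k (blk d x))"
proof (rule desc_L[OF d])
  show "\<forall>y\<in>set (x # pw k (blk d x)). inr y" using inr_pw x by auto
  show "successively (stp d) (x # pw k (blk d x))" using succ_stp_pw[OF d x] .
  fix f assume f: "forbd d f"
  obtain y r where y0: "inr y \<and> f = run d y (2 * g) @ r \<and> hd f = y \<and> (r = [] \<longrightarrow> bad d y) \<and>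
    (r \<noteq> [] \<longrightarrow> last f = bar y \<and> (\<exists>r'. r' \<noteq> [] \<and> f = r' @ run d (s d y 1) (2 * g)))"
    using forbd_start[OF d f] by (elim exE)
  have y: "inr y" "f = run d y (2 * g) @ r" "hd f = y" "r = [] \<Longrightarrow> bad d y"
    "r \<noteq> [] \<Longrightarrow> \<exists>r'. r' \<noteq> [] \<and> f = r' @ run d (s d y 1) (2 * g)" using y0 by auto
  note nr = norun_no[OF norun_pw[OF d, of k x]]
  show "\<not> sublist f (x # pw k (blk d x))"
  proof
    assume "sublist f (x # pw k (blk d x))"
    then consider "prefix f (x # pw k (blk d x))" | "sublist f (pw k (blk d x))"
      by (auto simp: sublist_Cons_right)
    then show False
    proof cases
      case 2
      then show ?thesis using nr[OF y(1) 2, of "[]" r] y(2) by simp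
    next
      case 1
      have "y = x" using prefix_hd[OF 1] y(2,3) g2 by auto
      then have "r \<noteq> []" using y nb by auto
      then obtain r' where r': "r' \<noteq> []" "f = r' @ run d (s d y 1) (2 * g)" using y by blast
      then have "prefix (tl r' @ run d (s d y 1) (2 * g)) (pw k (blk d x))" using 1 by (cases r') auto
      then have "sublist (tl r' @ run d (s d y 1) (2 * g)) (pw k (blk d x))" by (rule prefix_imp_sublist)
      then show ?thesis using nr[of "s d y 1" _ "tl r'" "[]"] by simp
    qed
  qed
qed

subsection \<open>The group acts on the words without forbidden factors\<close>

text \<open>The effect of right multiplication by the letter \<open>b\<close> when it lengthens the word: \<open>b\<close> moves to the left
  across the blocks at the end of \<open>p\<close>. In general \<open>edge p b q\<close> means \<open>q = p b\<close> in the group.\<close>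

definition cross :: "int list \<Rightarrow> int \<Rightarrow> int list \<Rightarrow> bool" where
  "cross p b q \<longleftrightarrow> L p \<and> L q \<and> inr b \<and>
     (\<exists>p' d k. dir d \<and> p = p' @ pw k (blk d (bar b)) \<and> q = p' @ b # pw k (blk (- d) b))"

definition edge :: "int list \<Rightarrow> int \<Rightarrow> int list \<Rightarrow> bool" where
  "edge p b q \<longleftrightarrow> inr b \<and> (cross p b q \<or> cross q (bar b) p)"

lemma edge_sym: "edge p b q \<Longrightarrow> edge q (bar b) p"
  by (auto simp: edge_def)

lemma edge_L: "edge p b q \<Longrightarrow> L p \<and> L q \<and> inr b"
  by (auto simp: edge_def cross_def)

lemma cross_len: "cross p b q \<Longrightarrow> length q = Suc (length p)"
  by (auto simp: cross_def)

lemma dir1: "dir 1" by (simp add: dir_def)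

lemma cross_tree:
  assumes "L (p @ [b])" shows "cross p b (p @ [b])"
proof -
  have "L p" "inr b" using assms L_app1[of p "[b]"] by (auto simp: L_def)
  then show ?thesis unfolding cross_def using assms dir1
    by (intro conjI exI[of _ p] exI[of _ "1::int"] exI[of _ "0::nat"]) simp_all
qed

lemma pw_blk_last: "1 \<le> k \<Longrightarrow> last (p @ pw k (blk d x)) = s d x (2 * int g - 1)"
  by (simp add: last_append)

lemma dir_eq:
  assumes "dir d" "dir e" "inr b" "s d (bar b) (2 * int g - 1) = s e (bar b) (2 * int g - 1)"
  shows "d = e"
proof (rule ccontr)
  assume "d \<noteq> e"
  then have "e = - d" using dir_cases[OF assms(1,2)] by simp
  then have "s d b (4 * int g - 1) = s d (bar b) (1 - 2 * int g)" using assms by (simp add: s_uminus)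
  also have "\<dots> = s d b 1" using assms(1) by simp
  finally show False using assms(1) gi by (auto simp: s_eq8)
qed

lemma forb_len2: "forb f \<Longrightarrow> 2 \<le> length f"
proof -
  assume "forb f"
  then show ?thesis by (cases rule: forb_cases) (use g2 in auto)
qed

text \<open>If \<open>b\<close> could stop after \<open>k'\<close> as well as after
  \<open>k > k'\<close> blocks, one result would contain the half \<open>blk d (bar b) @ [b]\<close>
  and the other its complement \<open>b # blk (- d) b\<close>. One of the two is bad. The direction
  is determined by the last letter of \<open>p\<close>.\<close>

lemma cross_fun:
  assumes "cross p b q" "cross p b q'" shows "q = q'"
proof -
  have key: "k = k'" if "L q" "L p" "inr b" "dir d" "p = p' @ pw k (blk d (bar b))" "q = p' @ b # pw k (blk (- d) b)"
      "L (p'' @ b # pw k' (blk (- d) b))" "p = p'' @ pw k' (blk d (bar b))" "k \<ge> k'"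
    for p q p' p'' k k' d
  proof (rule ccontr)
    assume "k \<noteq> k'"
    then have "k' < k" using \<open>k \<ge> k'\<close> by simp
    then obtain j where "k = Suc (k' + j)" using less_imp_Suc_add by blast
    then have j: "k = Suc j + k'" by simp
    have "pw k (blk d (bar b)) = pw j (blk d (bar b)) @ blk d (bar b) @ pw k' (blk d (bar b))"
      unfolding j pw_add pw_Suc2 by simp
    then have "p'' = p' @ pw j (blk d (bar b)) @ blk d (bar b)"
      using that(5,8) by simp
    then have "L (blk d (bar b) @ [bar (bar b)])"
      using that(3,7) L_factor[of "p' @ pw j (blk d (bar b))" "blk d (bar b) @ [b]" "pw k' (blk (- d) b)"] by simp
    then have "\<not> bad d (s d (bar b) 1)"
      using blk_snoc_run[of d "bar b"] forb_F3[OF that(4), of "s d (bar b) 1"] not_L[of _ "[]" "[]"] that(4) by auto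
    moreover have "L (b # blk (- d) b)"
      using that(1,6) j L_factor[of p' "b # blk (- d) b" "pw (j + k') (blk (- d) b)"] by simp
    then have "\<not> bad (- d) b"
      using Cons_blk[OF that(3)] forb_F3[of "- d" b] not_L[of _ "[]" "[]"] that(3,4) by auto
    moreover have "s d (s d (bar b) 1) (2 * int g - 1) = b"
      using that(3,4) s_period[of d "4 * int g" 0 b] by simp
    ultimately show False using bad_compl[OF that(4), of "s d (bar b) 1"] by simp
  qed
  obtain p1 d1 k1 where A: "dir d1" "p = p1 @ pw k1 (blk d1 (bar b))" "q = p1 @ b # pw k1 (blk (- d1) b)"
    using assms(1) by (auto simp: cross_def)
  obtain p2 d2 k2 where B: "dir d2" "p = p2 @ pw k2 (blk d2 (bar b))" "q' = p2 @ b # pw k2 (blk (- d2) b)"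
    using assms(2) by (auto simp: cross_def)
  have L: "L p" "L q" "L q'" "inr b" using assms by (auto simp: cross_def)
  have zero: "k = 0" if "L q" "L q'" "dir d" "p = p' @ pw k (blk d (bar b))" "q = p' @ b # pw k (blk (- d) b)" "q' = p @ [b]"
    for q q' d p' k
    using key[OF that(1) L(1,4) that(3,4,5), of p 0] that(2,6) by simp
  consider "k1 = 0" | "k2 = 0" | "k1 \<noteq> 0" "k2 \<noteq> 0" by blast
  then have e: "k1 = k2 \<and> (d1 = d2 \<or> k1 = 0)"
  proof cases
    case 1
    then have "q = p @ [b]" using A by simp
    from zero[OF L(3,2) B this] show ?thesis using 1 by simp
  next
    case 2
    then have "q' = p @ [b]" using B by simp
    from zero[OF L(2,3) A this] show ?thesis using 2 by simp
  next
    case 3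
    then have "s d1 (bar b) (2 * int g - 1) = s d2 (bar b) (2 * int g - 1)"
      using pw_blk_last[of k1 p1 d1 "bar b", folded A(2)] pw_blk_last[of k2 p2 d2 "bar b", folded B(2)] by simp
    then have d: "d1 = d2" using dir_eq A(1) B(1) L(4) by blast
    show ?thesis
    proof (cases "k2 \<le> k1")
      case True
      from key[OF L(2,1,4) A _ _ this] B L(3) d show ?thesis by simp
    next
      case False
      then have "k1 \<le> k2" by simp
      from key[OF L(3,1,4) B _ _ this] A L(2) d show ?thesis by simp
    qed
  qed
  then show ?thesis using A B by auto
qed

lemma split_last_occ:
  assumes "p @ x # u = p' @ x # v" "x \<notin> set u" "x \<notin> set v"
  shows "p = p' \<and> u = v"
  using assms by (auto simp: append_eq_append_conv2 Cons_eq_append_conv append_eq_Cons_conv)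

lemma notin_pw: "dir d \<Longrightarrow> inr x \<Longrightarrow> x \<notin> set (pw k (blk d x))" "dir d \<Longrightarrow> inr x \<Longrightarrow> bar x \<notin> set (pw k (blk d x))"
  using notin_blk[of d x] set_pw[of k "blk d x"] by auto

text \<open>\<open>b\<close> does not occur in the blocks behind it, so its last occurrence in
  \<open>p\<close> shows where it was inserted.\<close>

lemma cross_inj:
  assumes "cross q b p" "cross q' b p" shows "q = q'"
proof -
  obtain p1 d1 k1 where 1: "dir d1" "q = p1 @ pw k1 (blk d1 (bar b))" "p = p1 @ b # pw k1 (blk (- d1) b)"
    using assms(1) by (auto simp: cross_def)
  obtain p2 d2 k2 where 2: "dir d2" "q' = p2 @ pw k2 (blk d2 (bar b))" "p = p2 @ b # pw k2 (blk (- d2) b)"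
    using assms(2) by (auto simp: cross_def)
  have b: "inr b" using assms by (simp add: cross_def)
  have e: "p1 = p2" "pw k1 (blk (- d1) b) = pw k2 (blk (- d2) b)"
    using split_last_occ[of p1 b "pw k1 (blk (- d1) b)" p2 "pw k2 (blk (- d2) b)"] 1 2
      notin_pw(1)[of "- d1" b k1] notin_pw(1)[of "- d2" b k2] b by auto
  then have "length (pw k1 (blk (- d1) b)) = length (pw k2 (blk (- d2) b))" by simp
  then have k: "k1 = k2" using g2 by simp
  show ?thesis
  proof (cases "k1 = 0")
    case False
    then have "s (- d1) b (2 * int g - 1) = s (- d2) b (2 * int g - 1)"
      using e k pw_blk_last[of k1 "[]" "- d1" b] pw_blk_last[of k2 "[]" "- d2" b] by simp
    then have "- d1 = - d2" using dir_eq[of "- d1" "- d2" "bar b"] 1 2 b by simp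
    then show ?thesis using 1 2 e k by simp
  qed (use 1 2 e k in simp)
qed

text \<open>A word that ends in \<open>bar b\<close> followed by blocks cannot be lengthened by
  \<open>b\<close>: some factor \<open>bar b\<close>, blocks, \<open>b\<close> would survive in
  \<open>q\<close>.\<close>

lemma cross_excl:
  assumes "cross p b q" "cross q' (bar b) p" shows False
proof -
  obtain p1 d1 k1 where 1: "dir d1" "p = p1 @ pw k1 (blk d1 (bar b))" "q = p1 @ b # pw k1 (blk (- d1) b)"
    using assms(1) by (auto simp: cross_def)
  obtain p2 d2 k2 where 2: "dir d2" "p = p2 @ bar b # pw k2 (blk (- d2) (bar b))"
    using assms(2) by (auto simp: cross_def)
  have b: "inr b" and Lq: "L q" using assms by (auto simp: cross_def)
  have bb: "bar b \<notin> set (pw k (blk d (bar b)))" if "dir d" for k d using notin_pw[OF that, of "bar b"] by simp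
  show False
  proof (cases "k1 = 0")
    case True
    then have "q = p2 @ (bar b # pw k2 (blk (- d2) (bar b)) @ [bar (bar b)]) @ []" using 1 2 b by simp
    then show ?thesis using forb_F2[of "- d2" "bar b" k2] not_L Lq 2(1) by (metis dir_minus inr_bar)
  next
    case False
    have k2: "k2 \<noteq> 0"
    proof
      assume "k2 = 0"
      then have "last p = bar b" using 2 by simp
      moreover have "last p = last (pw k1 (blk d1 (bar b)))" using 1(2) False by (simp add: last_append del: last_pw)
      then have "last p \<in> set (pw k1 (blk d1 (bar b)))" using False by (metis blk_neq_Nil last_in_set pw_eq_Nil)
      ultimately show False using bb[OF 1(1)] by metis
    qed
    have p2: "p = (p2 @ [bar b]) @ pw k2 (blk (- d2) (bar b))" using 2 by simp
    have "s d1 (bar b) (2 * int g - 1) = s (- d2) (bar b) (2 * int g - 1)"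
      using pw_blk_last[of k1 p1 d1 "bar b", folded 1(2)] pw_blk_last[of k2 "p2 @ [bar b]" "- d2" "bar b", folded p2]
        False k2 by simp
    then have "d1 = - d2" using dir_eq[OF 1(1) _ b] 2(1) by simp
    then have eq: "p1 @ pw k1 (blk d1 (bar b)) = (p2 @ [bar b]) @ pw k2 (blk d1 (bar b))" using 1 2 by simp
    have "k1 \<le> k2"
    proof (rule ccontr)
      assume "\<not> k1 \<le> k2"
      then obtain j where "k1 = Suc (k2 + j)" using less_imp_Suc_add[of k2 k1] by auto
      then have "k1 = Suc j + k2" by simp
      then have "p1 @ pw (Suc j) (blk d1 (bar b)) = p2 @ [bar b]" using eq pw_add[of "Suc j" k2 "blk d1 (bar b)"] by simp
      then have "last (pw (Suc j) (blk d1 (bar b))) = bar b" using last_appendR[of "pw (Suc j) (blk d1 (bar b))" p1]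
        by (metis blk_neq_Nil last_snoc nat.distinct(1) pw_eq_Nil)
      then have "bar b \<in> set (pw (Suc j) (blk d1 (bar b)))" by (metis blk_neq_Nil last_in_set nat.distinct(1) pw_eq_Nil)
      then show False using bb[OF 1(1)] by blast
    qed
    then obtain j where "k2 = j + k1" by (metis le_add_diff_inverse2)
    then have "p1 = p2 @ bar b # pw j (blk d1 (bar b))" using eq pw_add[of j k1 "blk d1 (bar b)"] by simp
    then have "q = p2 @ (bar b # pw j (blk d1 (bar b)) @ [bar (bar b)]) @ pw k1 (blk (- d1) b)" using 1 b by simp
    then show ?thesis using forb_F2[of d1 "bar b" j] not_L Lq 1(1) by (metis inr_bar)
  qed
qed

lemma edge_fun: "edge p b q \<Longrightarrow> edge p b q' \<Longrightarrow> q = q'"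
  unfolding edge_def using cross_fun cross_inj cross_excl by blast

text \<open>Each suffix excluded by \<open>JL\<close>, continued by \<open>x # blk d x\<close>,
  yields a forbidden factor. For the second clause, \<open>x # blk d x\<close> is a block of
  \<open>s d x (- 1)\<close> followed by the inverse of that letter.\<close>

lemma JL_of_long:
  assumes d: "dir d" and x: "inr x" and L: "L (u @ x # blk d x)"
  shows "JL d u x"
proof -
  have ux: "L (u @ [x])" using L L_app1[of "u @ [x]" "blk d x"] by simp
  have 1: "\<not> suffix (bar x # pw k (blk (- d) (bar x))) u" for k
  proof
    assume "suffix (bar x # pw k (blk (- d) (bar x))) u"
    then obtain r where "u = r @ bar x # pw k (blk (- d) (bar x))" by (auto simp: suffix_def)
    then have "u @ [x] = r @ (bar x # pw k (blk (- d) (bar x)) @ [bar (bar x)]) @ []" using x by simp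
    then show False using forb_F2[of "- d" "bar x" k] not_L ux d by (metis dir_minus inr_bar)
  qed
  have 2: "\<not> suffix (s d x (- 1) # pw k (blk d (s d x (- 1)))) u" for k
  proof
    assume "suffix (s d x (- 1) # pw k (blk d (s d x (- 1)))) u"
    then obtain r where r: "u = r @ s d x (- 1) # pw k (blk d (s d x (- 1)))" by (auto simp: suffix_def)
    have "x # blk d x = blk d (s d x (- 1)) @ [bar (s d x (- 1))]"
      using blk_snoc_run[of d "s d x (- 1)"] Cons_blk[OF x] d x by simp
    then have "u @ x # blk d x = r @ (s d x (- 1) # pw (Suc k) (blk d (s d x (- 1))) @ [bar (s d x (- 1))]) @ []"
      using r by (simp add: pw_Suc2 del: pw_Suc)
    then show False using forb_F2[of d "s d x (- 1)" "Suc k"] not_L L d by (metis inr_s)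
  qed
  have "\<not> bad d x"
    using L forb_F3[OF d x] not_L[of "run d x (2 * g)" u "[]"] Cons_blk[OF x] by auto
  then show ?thesis using 1 2 by (simp add: JL_def)
qed

lemma nadj_blk2: "dir d \<Longrightarrow> inr a \<Longrightarrow> \<not> adj d a (s d a (- 1))"
  using gi s_eq8[of d "-1" 1 a] s_eq8[of d "-1" "2 * int g + 2" a] by (auto simp: adj_def)

lemma blk_Cons2: "\<exists>r. blk d x = s d x 1 # s d x 2 # r"
proof -
  obtain m where m: "2 * g - 1 = Suc (Suc m)" using g2 that[of "2 * g - 3"] by simp
  show ?thesis unfolding blk_def m by (simp add: run_Suc)
qed

text \<open>If \<open>p\<close> ends in \<open>bar b\<close> followed by blocks, \<open>b\<close>
  moves across them and cancels. Otherwise \<open>b\<close> is appended; the only possible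
  obstruction is a bad half ending in \<open>b\<close>, and then \<open>b\<close> moves across all
  blocks at the end of \<open>p\<close>.\<close>

lemma edge_total:
  assumes L: "L p" and b: "inr b"
  shows "\<exists>q. edge p b q"
proof (cases "\<exists>d p' k. dir d \<and> p = p' @ bar b # pw k (blk d (bar b))")
  case True
  then obtain d p' k where d: "dir d" and p: "p = p' @ bar b # pw k (blk d (bar b))" by blast
  have "L (p' @ pw k (blk (- d) b))"
  proof (cases k)
    case 0
    then show ?thesis using L p L_app1 by auto
  next
    case (Suc j)
    have e1: "s d (bar b) (2 * int g - 1) = s (- d) b 1"
      using d s_period[of d "4 * int g - 1" "- 1" b] by (simp add: s_uminus)
    have e2: "s (- d) b 2 = s d (s (- d) b 1) (- 1)" by (simp add: s_uminus)
    obtain r where r: "blk (- d) b = s (- d) b 1 # s (- d) b 2 # r" using blk_Cons2 by blast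
    have "L (p' @ bar b # blk d (bar b))"
      using L p Suc L_app1[of "p' @ bar b # blk d (bar b)" "pw j (blk d (bar b))"] by simp
    then have J: "JL d p' (bar b)" by (rule JL_of_long[OF d inr_bar])
    have v: "pw k (blk (- d) b) = s d (bar b) (2 * int g - 1) # s (- d) b 2 # (r @ pw j (blk (- d) b))"
      unfolding e1 using Suc r by simp
    have na: "\<not> adj d (s d (bar b) (2 * int g - 1)) (s (- d) b 2)"
      unfolding e1 e2 by (rule nadj_blk2[OF d]) simp
    have "L p'" using L p L_app1 by blast
    moreover have "L (pw k (blk (- d) b))" using L_pw_blk d b by simp
    ultimately show ?thesis by (rule JL_glue[OF d inr_bar _ _ v na J])
  qed
  then have "cross (p' @ pw k (blk (- d) b)) (bar b) p"
    unfolding cross_def using p L d b by (auto intro!: exI[of _ p'] exI[of _ "- d"] exI[of _ k])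
  then show ?thesis using b by (auto simp: edge_def)
next
  case F: False
  show ?thesis
  proof (cases "L (p @ [b])")
    case True
    then show ?thesis using cross_tree b by (auto simp: edge_def)
  next
    case False
    have "\<forall>x\<in>set (p @ [b]). inr x" using L b by (auto simp: L_def)
    then obtain f where f: "forb f" "sublist f (p @ [b])" using False by (auto simp: L_def)
    have "\<not> sublist f p" using L f by (simp add: L_def)
    moreover have "\<not> sublist f [b]" using forb_len2[OF f(1)] sublist_length_le[of f "[b]"] by auto
    ultimately obtain f1 f2 where f1: "suffix f1 p" "f = f1 @ f2" "prefix f2 [b]" using f(2) by (auto simp: sublist_append)
    have "f2 \<noteq> []" using f1 \<open>\<not> sublist f p\<close> by auto
    then have f1: "suffix f1 p" "f = f1 @ [b]" using f1 by (auto simp: prefix_Cons)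
    obtain r where r: "p = r @ f1" using f1 by (auto simp: suffix_def)
    from f(1) obtain d where d: "dir d" "bad d (s d (bar b) 1)" "f1 = blk d (bar b)"
    proof (cases rule: forb_cases)
      case (F1 x)
      then have "p = r @ bar b # pw 0 (blk 1 (bar b))" using f1 r by simp
      then show ?thesis using F dir1 by blast
    next
      case (F2 d x k)
      then have "f1 = x # pw k (blk d x)" "b = bar x" using f1 by auto
      then have "p = r @ bar b # pw k (blk d (bar b))" using r F2 by simp
      then show ?thesis using F F2 by blast
    next
      case (F3 d x)
      then have "f1 @ [b] = run d x (2 * g - 1) @ [s d x (2 * int g - 1)]"
        using f1 run_Suc2[of d x "2 * g - 1"] g2 by (simp add: of_nat_diff Cons_blk)
      then have e: "f1 = run d x (2 * g - 1)" "b = s d x (2 * int g - 1)" by auto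
      have "s d (bar b) 1 = x" using F3 e s_period[of d "4 * int g" 0 x] by simp
      then show ?thesis using that[OF F3(1)] F3 e by (simp add: blk_def)
    qed
    let ?P = "\<lambda>k. \<exists>p'. p = p' @ pw k (blk d (bar b))"
    have P1: "?P 1" using r d by simp
    have "k \<le> length p" if "?P k" for k
    proof -
      from that have "k * (2 * g - 1) \<le> length p" by auto
      moreover have "k \<le> k * (2 * g - 1)" using g2 by (cases "2 * g - 1") auto
      ultimately show ?thesis by linarith
    qed
    then have bnd: "\<forall>k. ?P k \<longrightarrow> k \<le> length p" by blast
    \<comment> \<open>All blocks have to be crossed: one left in front of \<open>b\<close> would
      again form the bad half relator with it.\<close>
    define k where "k = (GREATEST k. ?P k)"
    have k: "?P k" "1 \<le> k" "\<And>j. ?P j \<Longrightarrow> j \<le> k"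
      using GreatestI_nat[of ?P, OF P1 bnd[rule_format]] Greatest_le_nat[of ?P _ "length p"] P1 bnd unfolding k_def by blast+
    then obtain p' where p': "p = p' @ pw k (blk d (bar b))" by blast
    obtain j where j: "k = Suc j" using k(2) by (cases k) auto
    \<comment> \<open>\<open>x\<close> is the first letter of the block, so
      \<open>blk d (bar b) @ [b]\<close> is the half starting at \<open>x\<close>, and
      \<open>b\<close> is the first letter of its complement, as \<open>JL_glue\<close>
      requires.\<close>
    define x where "x = s d (bar b) 1"
    have x: "inr x" "s d x (2 * int g - 1) = b" "s d x (- 1) = bar b"
      using d b s_period[of d "4 * int g" 0 b] by (auto simp: x_def bar_s)
    have px: "L (p' @ [x])"
    proof -
      obtain r' where "blk d (bar b) = x # r'" using blk_Cons2[of d "bar b"] x_def by auto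
      then show ?thesis using L p' j L_app1[of "p' @ [x]" "r' @ pw j (blk d (bar b))"] by simp
    qed
    have "JL d p' x"
      unfolding JL_def
    proof (intro conjI allI impI notI)
      fix i assume "suffix (bar x # pw i (blk (- d) (bar x))) p'"
      then obtain r where "p' = r @ bar x # pw i (blk (- d) (bar x))" by (auto simp: suffix_def)
      then have "p' @ [x] = r @ (bar x # pw i (blk (- d) (bar x)) @ [bar (bar x)]) @ []" using x by simp
      then show False using forb_F2[of "- d" "bar x" i] not_L px d by (metis dir_minus inr_bar)
    next
      fix i assume "suffix (s d x (- 1) # pw i (blk d (s d x (- 1)))) p'"
      then obtain r where "p' = r @ bar b # pw i (blk d (bar b))" by (auto simp: suffix_def x(3))
      then have "p = r @ bar b # pw (i + k) (blk d (bar b))" using p' by (simp add: pw_add)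
      then show False using F d by blast
    next
      assume "suffix (run d x (2 * g - 1)) p'"
      then obtain r where "p' = r @ blk d (bar b)" by (auto simp: suffix_def blk_def x_def)
      then have "p = r @ pw (Suc k) (blk d (bar b))" using p' by simp
      then show False using k(3)[of "Suc k"] by auto
    qed
    note J = this
    have "bad d x" using d x_def by simp
    then have "\<not> bad (- d) b" using bad_compl[OF d(1) x(1)] x by simp
    then have Lb: "L (b # pw k (blk (- d) b))" using L_Cons_pw_blk[of "- d" b k] d b by simp
    obtain r' where "pw k (blk (- d) b) = s (- d) b 1 # r'" using blk_Cons2[of "- d" b] j by auto
    then have v: "b # pw k (blk (- d) b) = s d x (2 * int g - 1) # s (- d) b 1 # r'" using x(2) by simp
    have na: "\<not> adj d (s d x (2 * int g - 1)) (s (- d) b 1)"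
      using nadj_blk2[OF d(1) b] unfolding x(2) by (simp add: s_uminus)
    have "L p'" using L p' L_app1 by blast
    then have "L (p' @ b # pw k (blk (- d) b))"
      using Lb by (rule JL_glue[OF d(1) x(1) _ _ v na J])
    then have "cross p b (p' @ b # pw k (blk (- d) b))"
      unfolding cross_def using L b d p' by blast
    then show ?thesis using b by (auto simp: edge_def)
  qed
qed

section \<open>Walks in the graph and the closing of relator loops\<close>

fun walk :: "int list \<Rightarrow> int list \<Rightarrow> int list \<Rightarrow> bool" where
  "walk p [] q \<longleftrightarrow> p = q"
| "walk p (b # w) q \<longleftrightarrow> (\<exists>r. edge p b r \<and> walk r w q)"

lemma walk_append: "walk p (u @ v) q \<longleftrightarrow> (\<exists>r. walk p u r \<and> walk r v q)"
  by (induction u arbitrary: p) auto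

lemma walk_fun: "walk p w q \<Longrightarrow> walk p w q' \<Longrightarrow> q = q'"
  by (induction w arbitrary: p) (auto dest: edge_fun)

lemma walk_tree: "L (p @ w) \<Longrightarrow> walk p w (p @ w)"
proof (induction w arbitrary: p)
  case (Cons b w)
  then have "L (p @ [b])" using L_app1[of "p @ [b]" w] by simp
  then have "edge p b (p @ [b])" using cross_tree by (auto simp: edge_def L_def)
  then show ?case using Cons.IH[of "p @ [b]"] Cons.prems by auto
qed simp

lemma walk_L: "walk p w q \<Longrightarrow> L p \<Longrightarrow> L q"
  by (induction w arbitrary: p) (auto dest: edge_L)

lemma edge_back: "edge p b q \<Longrightarrow> edge r b q \<Longrightarrow> p = r"
  using edge_fun[OF edge_sym edge_sym] by blast

lemma walk_inv: "walk p w q \<Longrightarrow> walk q (rev (map bar w)) p"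
  by (induction w arbitrary: p) (auto simp: walk_append dest: edge_sym)

text \<open>The step at the junction is \<open>2 * g + 2\<close>, so a forbidden factor across it
  has a block boundary there. It would then contain, right of the junction, a whole block and one
  more letter, which does not fit.\<close>

lemma L_blk_glue:
  assumes d: "dir d" and x: "inr x" and L: "L u" and l: "last u = s d x (2 * int g - 1)"
  shows "L (u @ blk d x)"
proof -
  have Lb: "L (blk d x)" using L_pw_blk[OF d x, of 1] by simp
  have "\<not> sublist f (u @ blk d x)" if f: "forb f" for f
  proof
    assume "sublist f (u @ blk d x)"
    moreover have "\<not> sublist f u" "\<not> sublist f (blk d x)" using L Lb f by (auto simp: L_def)
    ultimately obtain f1 f2 where ff: "f = f1 @ f2" "suffix f1 u" "prefix f2 (blk d x)"
      by (auto simp: sublist_append)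
    have ne: "f1 \<noteq> []" "f2 \<noteq> []"
      using ff \<open>\<not> sublist f u\<close> \<open>\<not> sublist f (blk d x)\<close> by auto
    have lh: "last f1 = s d x (2 * int g - 1)" "hd f2 = s d x 1"
      using suffix_last[OF ff(2) ne(1)] prefix_hd[OF ff(3) ne(2)] l by auto
    from f consider y where "inr y" "f = [y, bar y]" | e where "dir e" "forbd e f"
      unfolding forb_def by blast
    then show False
    proof cases
      case 1
      then have "f1 = [y]" "f2 = [bar y]" using ff(1) ne by (auto simp: append_eq_Cons_conv)
      then have "s d x (4 * int g - 1) = s d x 1" using lh d by simp
      then show False using d gi by (simp add: s_eq8)
    next
      case 2
      have ad: "adj e (last f1) (hd f2)" using forbd_adj[OF 2(1)] 2(2) ff ne by simp
      from dir_cases[OF d 2(1)] show False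
      proof
        assume e: "e = d"
        have "s d x 1 \<noteq> s d (s d x (2 * int g - 1)) 1" using d gi by (simp add: s_eq8)
        then have "hd f2 = s e (last f1) (2 * int g + 2)" using ad lh e by (auto simp: adj_def)
        then obtain z k2 where "1 \<le> k2" "f2 = pw k2 (blk e z) @ [bar z]"
          using forbd_break[OF 2(1), of f1 f2] 2(2) ff ne by auto
        then have "length f2 = k2 * (2 * g - 1) + 1" by simp
        moreover have "2 * g - 1 \<le> k2 * (2 * g - 1)" using \<open>1 \<le> k2\<close> by simp
        moreover have "length f2 \<le> 2 * g - 1" using ff(3) prefix_length_le by fastforce
        ultimately show False by linarith
      next
        assume e: "e = - d"
        have "s d x 1 \<noteq> s d (s d x (2 * int g - 1)) (- 1)" using d gi by (simp add: s_eq8)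
        moreover have "s d x 1 \<noteq> s d (s d x (2 * int g - 1)) (- (2 * int g + 2))" using d gi by (simp add: s_eq8)
        ultimately show False using ad lh e by (auto simp: adj_def s_uminus)
      qed
    qed
  qed
  then show ?thesis using L Lb by (auto simp: L_def)
qed

text \<open>A forbidden factor across the junction either starts at \<open>x\<close>, and then is
  the bad half at \<open>x\<close>, or continues to the left, and then \<open>p\<close> ends in
  \<open>s d x (- 1)\<close> followed by blocks.\<close>

lemma L_run_glue:
  assumes d: "dir d" and x: "inr x" and L: "L (p @ [x])"
    and sx: "\<And>k. \<not> suffix (s d x (- 1) # pw k (blk d (s d x (- 1)))) p"
    and n: "1 \<le> n" "n \<le> 2 * g" "n = 2 * g \<Longrightarrow> \<not> bad d x"
  shows "L (p @ run d x n)"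
proof -
  obtain m where m: "n = Suc m" using n by (cases n) auto
  have eq: "p @ run d x n = (p @ [x]) @ run d (s d x 1) m" using m run_Suc[OF x] by simp
  have Lr: "L (run d (s d x 1) m)"
  proof -
    have "run d (s d x 1) (2 * g - 1) = run d (s d x 1) m @ run d (s d x (1 + int m)) (2 * g - 1 - m)"
      using run_append[of d "s d x 1" m "2 * g - 1 - m"] n m by simp
    then show ?thesis using L_pw_blk[OF d x, of 1] L_app1 by (simp add: blk_def)
  qed
  have "\<not> sublist f ((p @ [x]) @ run d (s d x 1) m)" if f: "forb f" for f
  proof
    assume "sublist f ((p @ [x]) @ run d (s d x 1) m)"
    moreover have nf: "\<not> sublist f (p @ [x])" "\<not> sublist f (run d (s d x 1) m)" using L Lr f by (auto simp: L_def)
    ultimately obtain f1 f2 where ff: "f = f1 @ f2" "suffix f1 (p @ [x])" "prefix f2 (run d (s d x 1) m)"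
      using sublist_append[of f "p @ [x]" "run d (s d x 1) m"] by blast
    have ne: "f1 \<noteq> []" "f2 \<noteq> []" using ff nf by auto
    have "0 < m" using ne ff(3) by (cases m) auto
    then have lh: "last f1 = x" "hd f2 = s d x 1"
      using suffix_last[OF ff(2) ne(1)] prefix_hd[OF ff(3) ne(2)] by auto
    have len2: "length f2 \<le> m" using ff(3) prefix_length_le by fastforce
    from f consider y where "inr y" "f = [y, bar y]" | e where "dir e" "forbd e f"
      unfolding forb_def by blast
    then show False
    proof cases
      case 1
      then have "f1 = [y]" "f2 = [bar y]" using ff(1) ne by (auto simp: append_eq_Cons_conv)
      then have "s d x 1 = s d x (2 * int g)" using lh bar_s[OF d, of x] by simp
      then show False using d gi by (simp add: s_eq8)
    next
      case 2
      have ad: "adj e (last f1) (hd f2)" using forbd_adj[OF 2(1)] 2(2) ff ne by simp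
      from dir_cases[OF d 2(1)] show False
      proof
        assume e: "e = d"
        show False
        proof (cases "butlast f1 = []")
          case True
          then have "f1 = [x]" using ne lh by (metis append_butlast_last_id append_Nil)
          then have hf: "hd f = x" "length f \<le> n" using ff(1) len2 m by auto
          from 2(2) consider z k where "1 \<le> k" "f = z # pw k (blk e z) @ [bar z]" | z where "bad e z" "f = z # blk e z"
            unfolding forbd_def by blast
          then show False
          proof cases
            case (1 z k)
            then have "length f = k * (2 * g - 1) + 2" by simp
            moreover have "2 * g - 1 \<le> k * (2 * g - 1)" using 1 by simp
            ultimately show False using hf n by linarith
          next
            case (2 z)
            then have "length f = 2 * g" using g2 by simp
            then show False using 2 hf n e by auto
          qed
        next
          case False
          have f1: "f1 = butlast f1 @ [x]" using ne lh by (metis append_butlast_last_id)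
          have sp: "suffix (butlast f1) p" using ff(2) f1 by (metis suffix_append snoc_suffix_snoc)
          let ?l = "last (butlast f1)"
          have fs: "f = butlast f1 @ (x # f2)" using ff(1) f1 by (metis append.assoc append_Cons append_Nil)
          have lin: "inr ?l" using sp False L
            by (metis L_def Un_iff last_in_set set_append set_mono_suffix subsetD)
          have "adj d ?l x" using forbd_adj[OF 2(1), of "butlast f1" "x # f2"] 2(2) fs False e by simp
          then consider "x = s d ?l 1" | "x = s d ?l (2 * int g + 2)" by (auto simp: adj_def)
          then show False
          proof cases
            case 1
            then have "?l = s d x (- 1)" using lin by (metis add.right_inverse s_0 s_s)
            moreover have "suffix [?l] p" using sp False
              by (metis append_butlast_last_id suffixI suffix_order.order_trans)
            ultimately show False using sx[of 0] by simp
          next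
            case b: 2
            obtain z k1 k2 where z: "inr z" "1 \<le> k2" "butlast f1 = z # pw k1 (blk d z)" "x # f2 = pw k2 (blk d z) @ [bar z]"
              using forbd_break[OF d, of "butlast f1" "x # f2"] 2(2) fs False e b by auto
            have "x = hd (pw k2 (blk d z) @ [bar z])" using z(4) by (metis list.sel(1))
            then have "x = s d z 1" using z(2) by (simp add: hd_append)
            then have "z = s d x (- 1)" using z(1) by simp
            then show False using sx[of k1] sp z(3) by simp
          qed
        qed
      next
        assume e: "e = - d"
        have "s d x 1 \<noteq> s d x (- 1)" using d gi by (simp add: s_eq8)
        moreover have "s d x 1 \<noteq> s d x (- (2 * int g + 2))"
        proof -
          have "2 * int g + 3 \<noteq> 4 * int g" by presburger
          then show ?thesis using d gi by (simp add: s_eq8)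
        qed
        ultimately show False using ad lh e by (auto simp: adj_def s_uminus)
      qed
    qed
  qed
  moreover have "\<forall>y\<in>set ((p @ [x]) @ run d (s d x 1) m). inr y" using L Lr by (auto simp: L_def)
  ultimately show ?thesis unfolding eq L_def by blast
qed

lemma cross_last:
  assumes "cross p b q" "p \<noteq> []" shows "last p \<noteq> bar b"
proof
  assume "last p = bar b"
  then have "p = butlast p @ [bar b]" using assms(2) by (metis append_butlast_last_id)
  moreover have "L p" using assms(1) by (simp add: cross_def)
  ultimately have "cross (butlast p) (bar b) p" using cross_tree[of "butlast p" "bar b"] by simp
  then show False using cross_excl assms(1) by blast
qed

text \<open>The second run is the complementary half: both ways around the face lead from
  \<open>p\<close> to its opposite vertex \<open>t\<close>.\<close>

definition top :: "int list \<Rightarrow> int \<Rightarrow> int \<Rightarrow> bool" where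
  "top p x d \<longleftrightarrow> (\<exists>t. walk p (run d x (2 * g)) t \<and> walk p (run (- d) (s d x (2 * int g - 1)) (2 * g)) t)"

lemma top_swap: "dir d \<Longrightarrow> inr x \<Longrightarrow> top p (s d x (2 * int g - 1)) (- d) \<longleftrightarrow> top p x d"
  unfolding top_def by (auto simp: s_uminus)

lemma top_intro:
  assumes d: "dir d" and x: "inr x" and p: "p = p1 @ pw k (blk (- d) (bar x))"
    and q: "L (p1 @ x # pw k (blk d x))" "edge p x (p1 @ x # pw k (blk d x))"
    and t: "L (p1 @ x # pw (Suc k) (blk d x))" and t': "L (p @ blk (- d) (bar x))"
  shows "top p x d"
proof -
  let ?t = "p1 @ x # pw (Suc k) (blk d x)"
  have tq: "?t = (p1 @ x # pw k (blk d x)) @ blk d x" by (simp add: pw_comm)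
  have "walk (p1 @ x # pw k (blk d x)) (blk d x) ?t"
    using walk_tree[of "p1 @ x # pw k (blk d x)" "blk d x"] t unfolding tq by simp
  then have 1: "walk p (run d x (2 * g)) ?t"
    using q(2) Cons_blk[OF x, of d, symmetric] by auto
  have "p @ blk (- d) (bar x) = p1 @ pw (Suc k) (blk (- d) (bar x))" using p by (simp add: pw_comm)
  then have "cross (p @ blk (- d) (bar x)) x ?t"
    unfolding cross_def using t t' x d
    by (intro conjI exI[of _ p1] exI[of _ "- d"] exI[of _ "Suc k"]) simp_all
  then have "edge (p @ blk (- d) (bar x)) x ?t" using x by (simp add: edge_def)
  then have "walk p (blk (- d) (bar x) @ [x]) ?t"
    unfolding walk_append using walk_tree[OF t'] by auto
  moreover have "blk (- d) (bar x) @ [x] = run (- d) (s d x (2 * int g - 1)) (2 * g)"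
    using blk_snoc_run[of "- d" "bar x"] d x by (simp add: s_uminus)
  ultimately show ?thesis unfolding top_def using 1 by auto
qed

lemma top_step:
  assumes d: "dir d" and x: "inr x" and p: "L p" "p = p1 @ pw k (blk (- d) (bar x))" and k: "1 \<le> k"
    and q: "L (p1 @ x # pw k (blk d x))"
  shows "top p x d"
proof (rule top_intro[OF d x p(2) q])
  have "cross p x (p1 @ x # pw k (blk d x))"
    unfolding cross_def using p q x d by (intro conjI exI[of _ p1] exI[of _ "- d"] exI[of _ k]) simp_all
  then show "edge p x (p1 @ x # pw k (blk d x))" using x by (simp add: edge_def)
  have "p1 @ x # pw (Suc k) (blk d x) = (p1 @ x # pw k (blk d x)) @ blk d x" by (simp add: pw_comm)
  then show "L (p1 @ x # pw (Suc k) (blk d x))" using L_blk_glue[OF d x q] k by simp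
  show "L (p @ blk (- d) (bar x))"
    using L_blk_glue[of "- d" "bar x" p] p k d by (simp add: last_append)
qed

lemma top_flat:
  assumes d: "dir d" and x: "inr x" and q: "L (p @ [x])" "L (p @ [s d x (2 * int g - 1)])" and nb: "\<not> bad d x"
  shows "top p x d"
proof (rule top_intro[OF d x, of p p 0])
  show "p = p @ pw 0 (blk (- d) (bar x))" "L (p @ x # pw 0 (blk d x))" using q by simp_all
  show "edge p x (p @ x # pw 0 (blk d x))" using cross_tree[OF q(1)] x by (simp add: edge_def)
  define y where "y = s d x (2 * int g - 1)"
  have y: "bar y = s d x (- 1)" using d s_period[of d "4 * int g - 1" "- 1" x] by (simp add: y_def)
  have "\<not> suffix (s d x (- 1) # pw k (blk d (s d x (- 1)))) p" for k
  proof
    assume "suffix (s d x (- 1) # pw k (blk d (s d x (- 1)))) p"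
    then obtain r where "p = r @ bar y # pw k (blk d (bar y))" unfolding y by (auto simp: suffix_def)
    then have "p @ [y] = r @ (bar y # pw k (blk d (bar y)) @ [bar (bar y)]) @ []" by (simp add: y_def)
    then show False using forb_F2[OF d, of "bar y" k] not_L q(2) by (metis inr_bar y_def)
  qed
  then have "L (p @ run d x (2 * g))" by (intro L_run_glue[OF d x q(1)]) (use nb g2 in auto)
  then show "L (p @ x # pw (Suc 0) (blk d x))" using Cons_blk[OF x, of d] by simp
  have b: "s (- d) y (- 1) = bar x" using d by (simp add: y_def s_uminus bar_s[of d])
  have "\<not> suffix (s (- d) y (- 1) # pw k (blk (- d) (s (- d) y (- 1)))) p" for k
  proof
    assume "suffix (s (- d) y (- 1) # pw k (blk (- d) (s (- d) y (- 1)))) p"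
    then obtain r where "p = r @ bar x # pw k (blk (- d) (bar x))" unfolding b by (auto simp: suffix_def)
    then have "p @ [x] = r @ (bar x # pw k (blk (- d) (bar x)) @ [bar (bar x)]) @ []" using x by simp
    then show False using forb_F2[of "- d" "bar x" k] not_L q(1) d by (metis inr_bar dir_minus)
  qed
  then have "L (p @ run (- d) y (2 * g - 1))"
    by (intro L_run_glue[of "- d"]) (use q d g2 in \<open>auto simp: y_def\<close>)
  moreover have "run (- d) y (2 * g - 1) = blk (- d) (bar x)"
    unfolding blk_def y_def using d by (simp add: s_uminus bar_s[of d])
  ultimately show "L (p @ blk (- d) (bar x))" by simp
qed

text \<open>\<open>x\<close> and \<open>s d x (2 * int g - 1)\<close> start the two halves of the
  face. If one of them crosses a positive number of blocks, the last letter of \<open>p\<close>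
  fixes the direction and \<open>top_step\<close> adds one more block to the strip. If both are
  merely appended, \<open>top_flat\<close> applies to whichever half is good.\<close>

lemma top_local:
  assumes d: "dir d" and x: "inr x" and c: "cross p x q" "cross p (s d x (2 * int g - 1)) q'"
  shows "top p x d"
proof -
  define y where "y = s d x (2 * int g - 1)"
  have y: "inr y" "bar y = s d x (- 1)" "s (- d) y (2 * int g - 1) = x"
    using d x s_period[of d "4 * int g - 1" "- 1" x] by (simp_all add: y_def s_uminus)
  have Lp: "L p" using c by (simp add: cross_def)
  obtain p1 e1 k1 where A: "dir e1" "p = p1 @ pw k1 (blk e1 (bar x))" "q = p1 @ x # pw k1 (blk (- e1) x)" "L q"
    using c(1) by (auto simp: cross_def)
  obtain p2 e2 k2 where B: "dir e2" "p = p2 @ pw k2 (blk e2 (bar y))" "q' = p2 @ y # pw k2 (blk (- e2) y)" "L q'"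
    using c(2) by (auto simp: cross_def y_def)
  have nx: "p = [] \<or> last p \<noteq> bar x" and ny: "p = [] \<or> last p \<noteq> bar y"
    using cross_last c y_def by blast+
  show ?thesis
  proof (cases "k1 = 0")
    case k1: False
    then have ne: "p \<noteq> []" using A by simp
    have "e1 = - d"
    proof (rule ccontr)
      assume "e1 \<noteq> - d"
      then have "e1 = d" using dir_cases[OF d A(1)] by blast
      then have "last p = s d (bar x) (2 * int g - 1)" using A(2) k1 by (simp add: last_append)
      also have "\<dots> = bar y" using d y(2) s_period[of d "4 * int g - 1" "- 1" x] by simp
      finally show False using ny ne by simp
    qed
    then show ?thesis using top_step[OF d x Lp, of p1 k1] A k1 by simp
  next
    case k1: True
    show ?thesis
    proof (cases "k2 = 0")
      case k2: False
      then have ne: "p \<noteq> []" using B by simp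
      have "e2 = d"
      proof (rule ccontr)
        assume "e2 \<noteq> d"
        then have e: "e2 = - d" using dir_cases[OF d B(1)] by blast
        then have "last p = s (- d) (bar y) (2 * int g - 1)" using B(2) k2 by (simp add: last_append)
        also have "\<dots> = bar x" using d s_period[of d "- 2 * int g" "2 * int g" x] y(2)
          by (simp add: s_uminus bar_s[of d] y_def del: s_bar) (smt (verit) s_period)
        finally show False using nx ne by simp
      qed
      then have "top p y (- d)" using top_step[of "- d" y p p2 k2] B k2 d y Lp by simp
      then show ?thesis using top_swap[OF d x] y_def by simp
    next
      case k2: True
      have q: "L (p @ [x])" "L (p @ [y])" using A B k1 k2 by simp_all
      show ?thesis
      proof (cases "bad d x")
        case False
        then show ?thesis using top_flat[OF d x q(1)] q(2) y_def by simp
      next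
        case True
        then have "\<not> bad (- d) y" using bad_compl[OF d x] y_def by simp
        then have "top p y (- d)" using top_flat[of "- d" y p] q d y by simp
        then show ?thesis using top_swap[OF d x] y_def by simp
      qed
    qed
  qed
qed

text \<open>That every relator walk closes is proved by induction on the length of its base point: if both
  neighbours on the face are longer, then the two halves of the face meet in a \<open>top\<close>; otherwise the base
  point moves to a shorter neighbour.\<close>

definition face :: "int list \<Rightarrow> int \<Rightarrow> int \<Rightarrow> bool" where
  "face p x d \<longleftrightarrow> walk p (run d x (4 * g)) p"

lemma bar_run: "dir d \<Longrightarrow> rev (map bar (run d x n)) = run (- d) (s d x (int n - 1 + 2 * int g)) n"
  by (rule nth_equalityI) (auto simp: rev_nth s_uminus of_nat_diff algebra_simps)

lemma face_top: "dir d \<Longrightarrow> inr x \<Longrightarrow> top p x d \<Longrightarrow> face p x d"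
proof -
  assume d: "dir d" and x: "inr x" and "top p x d"
  then obtain t where t: "walk p (run d x (2 * g)) t" "walk p (run (- d) (s d x (2 * int g - 1)) (2 * g)) t"
    by (auto simp: top_def)
  have "rev (map bar (run (- d) (s d x (2 * int g - 1)) (2 * g))) = run d (s d x (2 * int g)) (2 * g)"
    using bar_run[of "- d" "s d x (2 * int g - 1)" "2 * g"] d s_period[of d "2 * int g" "- 2 * int g" x]
    by (simp add: s_uminus)
  then have "walk t (run d (s d x (2 * int g)) (2 * g)) p" using walk_inv[OF t(2)] by simp
  then show ?thesis using t(1) run_append[of d x "2 * g" "2 * g"] by (auto simp: face_def walk_append)
qed

lemma face_rot:
  assumes d: "dir d" and e: "edge p x q"
  shows "face p x d \<longleftrightarrow> face q (s d x 1) d"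
proof -
  have x: "inr x" using e by (simp add: edge_def)
  obtain m where m: "4 * g = Suc m" using g2 by (cases "4 * g") auto
  have 1: "run d x (4 * g) = x # run d (s d x 1) m" using m run_Suc[OF x] by simp
  have "s d x (1 + int m) = s d x 0" using m by (intro s_period[OF d]) linarith
  then have 2: "run d (s d x 1) (4 * g) = run d (s d x 1) m @ [x]" using m run_Suc2[of d "s d x 1" m] x by simp
  let ?m = "run d (s d x 1) m"
  show ?thesis unfolding face_def 1 2
  proof
    assume "walk p (x # ?m) p"
    then obtain r where "edge p x r" "walk r ?m p" by auto
    then have "walk q ?m p" using edge_fun[OF e] by simp
    then show "walk q (?m @ [x]) q" using e unfolding walk_append by auto
  next
    assume "walk q (?m @ [x]) q"
    then obtain r where "walk q ?m r" "edge r x q" unfolding walk_append by auto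
    then have "walk q ?m p" using edge_back[OF e] by simp
    then show "walk p (x # ?m) p" using e by auto
  qed
qed

lemma edge_cross: "edge p b q \<Longrightarrow> \<not> length q < length p \<Longrightarrow> cross p b q"
  unfolding edge_def using cross_len by fastforce

lemma face_all: "L p \<Longrightarrow> inr x \<Longrightarrow> dir d \<Longrightarrow> face p x d"
proof (induction "length p" arbitrary: p x rule: less_induct)
  case less
  define y where "y = s d x (2 * int g - 1)"
  obtain q where q: "edge p x q" using edge_total less.prems by blast
  obtain q' where q': "edge p y q'" using edge_total[of p y] less.prems by (auto simp: y_def)
  show ?case
  proof (cases "length q < length p")
    case True
    then show ?thesis using less.hyps[OF True] face_rot[OF less.prems(3) q] edge_L[OF q] less.prems by simp
  next
    case F1: False
    show ?thesis
    proof (cases "length q' < length p")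
      case True
      have b: "bar y = s d x (- 1)"
        using less.prems s_period[of d "4 * int g - 1" "- 1" x] by (simp add: y_def)
      have e: "edge q' (s d x (- 1)) p" using edge_sym[OF q'] b by simp
      show ?thesis using less.hyps[OF True] face_rot[OF less.prems(3) e] edge_L[OF q'] less.prems by simp
    next
      case False
      then show ?thesis using top_local[of d x p q q'] edge_cross[OF q F1] edge_cross[OF q' False] less.prems face_top
        by (simp add: y_def)
    qed
  qed
qed

subsection \<open>Normal forms are the words without forbidden factors\<close>

abbreviation W :: "int list \<Rightarrow> bool" where "W w \<equiv> \<forall>x\<in>set w. inr x"

section \<open>Translation between residues and letters\<close>

definition enc :: "int \<Rightarrow> nat letter" where
  "enc k = (if k < 2 * int g then Gen (nat k + 1) else InvGen (nat k + 1 - 2 * g))"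

definition dec :: "nat letter \<Rightarrow> int" where
  "dec a = (case a of Gen i \<Rightarrow> int i - 1 | InvGen i \<Rightarrow> int i + 2 * int g - 1)"

lemma dec_enc [simp]: "inr x \<Longrightarrow> dec (enc x) = x"
  by (auto simp: dec_def enc_def inr_def of_nat_diff)

lemma enc_dec: "a \<in> Gen ` {1..2 * g} \<union> InvGen ` {1..2 * g} \<Longrightarrow> enc (dec a) = a \<and> inr (dec a)"
  by (auto simp: dec_def enc_def inr_def)

lemma enc_in: "inr x \<Longrightarrow> enc x \<in> Gen ` {1..2 * g} \<union> InvGen ` {1..2 * g}"
  by (auto simp: enc_def inr_def intro!: imageI)

lemma bar_cases: "inr x \<Longrightarrow> bar x = (if x < 2 * int g then x + 2 * int g else x - 2 * int g)"
  by (auto simp: bar_def inr_def mod_N)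

lemma enc_bar: "inr x \<Longrightarrow> enc (bar x) = letter_inv (enc x)"
  by (auto simp: bar_cases enc_def inr_def nat_add_distrib nat_diff_distrib nat_mult_distrib)

lemma dec_inv: "a \<in> Gen ` {1..2 * g} \<union> InvGen ` {1..2 * g} \<Longrightarrow> dec (letter_inv a) = bar (dec a)"
  using enc_dec[of a] enc_bar[of "dec a"] dec_enc[of "bar (dec a)"] by simp

lemma map_dec_enc [simp]: "W w \<Longrightarrow> map dec (map enc w) = w"
  by (induction w) auto

lemma enc_words: "W w \<Longrightarrow> map enc w \<in> words {1..2 * g}"
  using enc_in by (induction w) auto

lemma words_dec: "w \<in> words {1..2 * g} \<Longrightarrow> map enc (map dec w) = w \<and> W (map dec w)"
  using enc_dec by (induction w) auto

text \<open>This ties \<open>bad\<close> to the actual order: complementary halves have equal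
  length, and their first letters already decide the comparison.\<close>

lemma letter_less_bad:
  assumes "dir d" "inr x" "bad d x"
  shows "letter_less (enc (s d x (2 * int g - 1))) (enc x)"
proof -
  have x: "0 \<le> x" "x < 4 * int g" using assms by (auto simp: inr_def)
  consider "d = 1" "x = 0" | "d = 1" "2 * int g < x" | "d = -1" "2 * int g \<le> x"
    using assms by (auto simp: dir_def bad_def split: if_splits)
  then show ?thesis
  proof cases
    case 1
    then have "s d x (2 * int g - 1) = 2 * int g - 1" using gi by (simp add: s_def mod_N)
    then show ?thesis using 1 gi by (auto simp: enc_def)
  next
    case 2
    then have "s d x (2 * int g - 1) = x - 2 * int g - 1"
      using gi x mod_N(3)[of "x + (2 * int g - 1)"] by (simp add: s_def)
    then show ?thesis using 2 x by (auto simp: enc_def)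
  next
    case 3
    then have "s d x (2 * int g - 1) = x - 2 * int g + 1"
      using gi x mod_N(1)[of "x - (2 * int g - 1)"] by (simp add: s_def)
    then show ?thesis using 3 x gi by (auto simp: enc_def)
  qed
qed

lemma enc_relator: "map enc (run 1 0 (4 * g)) = surface_relator g"
proof (rule nth_equalityI)
  show "length (map enc (run 1 0 (4 * g))) = length (surface_relator g)" by (simp add: surface_relator_def)
  fix i assume "i < length (map enc (run 1 0 (4 * g)))"
  then have i: "i < 4 * g" by simp
  then have "s 1 0 (int i) = int i" by (simp add: s_def mod_N)
  then show "map enc (run 1 0 (4 * g)) ! i = surface_relator g ! i"
    using i by (auto simp: surface_relator_def nth_append enc_def simp del: upt_Suc)
qed

section \<open>Equality in the group and its invariance under walks\<close>

definition eqv :: "int list \<Rightarrow> int list \<Rightarrow> bool" where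
  "eqv u v \<longleftrightarrow> pres_eq {1..2 * g} {surface_relator g} (map enc u) (map enc v)"

lemma eqv_refl: "W w \<Longrightarrow> eqv w w"
  unfolding eqv_def by (rule pres_eq.refl) (rule enc_words)

lemma eqv_sym: "eqv u v \<Longrightarrow> eqv v u"
  unfolding eqv_def by (rule pres_eq.sym)

lemma eqv_trans [trans]: "eqv u v \<Longrightarrow> eqv v w \<Longrightarrow> eqv u w"
  unfolding eqv_def by (rule pres_eq.trans)

lemma eqv_app: "eqv u u' \<Longrightarrow> eqv v v' \<Longrightarrow> eqv (u @ v) (u' @ v')"
  unfolding eqv_def using pres_eq_append by fastforce

lemma eqv_ctx: "W p \<Longrightarrow> W q \<Longrightarrow> eqv u v \<Longrightarrow> eqv (p @ u @ q) (p @ v @ q)"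
  by (intro eqv_app eqv_refl)

lemma eqv_cancel: "inr x \<Longrightarrow> eqv [x, bar x] []"
  unfolding eqv_def using pres_eq.cancel[of "[]" "enc x" "[]" "{1..2 * g}" "{surface_relator g}"] enc_words[of "[x, bar x]"]
  by (simp add: enc_bar)

lemma eqv_cancel': "inr x \<Longrightarrow> eqv [bar x, x] []"
  using eqv_cancel[of "bar x"] by simp

lemma eqv_del: "W p \<Longrightarrow> W q \<Longrightarrow> eqv v [] \<Longrightarrow> eqv (p @ v @ q) (p @ q)"
  using eqv_ctx[of p q v "[]"] by simp

lemma eqv_relator: "eqv (run 1 0 (4 * g)) []"
  unfolding eqv_def enc_relator
  using pres_eq.relator[of "surface_relator g" "{surface_relator g}" "[]" "[]" "{1..2 * g}"] surface_relator_in_words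
  by simp

definition winv :: "int list \<Rightarrow> int list" where "winv w = rev (map bar w)"

lemma W_winv [simp]: "W (winv w)"
  by (auto simp: winv_def)

lemma eqv_winv: "W w \<Longrightarrow> eqv (w @ winv w) []"
proof (induction w)
  case Nil
  then show ?case by (simp add: winv_def eqv_refl)
next
  case (Cons x w)
  then have "eqv ([x] @ (w @ winv w) @ [bar x]) ([x] @ [bar x])" by (intro eqv_del) auto
  moreover have "(x # w) @ winv (x # w) = [x] @ (w @ winv w) @ [bar x]" by (simp add: winv_def)
  ultimately show ?case using eqv_trans[of _ "[x] @ [bar x]" "[]"] eqv_cancel[of x] Cons.prems by simp
qed

lemma W_run: "W (run d x n)" by (rule inr_run)

lemma eqv_full1: "inr x \<Longrightarrow> eqv (run 1 x (4 * g)) []"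
proof -
  have "eqv (run 1 (s 1 0 (int n)) (4 * g)) []" for n
  proof (induction n)
    case 0
    have "s 1 0 0 = 0" using gi by (simp add: inr_def)
    then show ?case using eqv_relator by simp
  next
    case (Suc n)
    define x where "x = s 1 0 (int n)"
    have x: "inr x" by (simp add: x_def)
    obtain m where m: "4 * g = Suc m" using g2 by (cases "4 * g") auto
    have 1: "run 1 x (4 * g) = x # run 1 (s 1 x 1) m" using m run_Suc[OF x] by simp
    have "s 1 x (1 + int m) = s 1 x 0" using m by (intro s_period[OF dir1]) linarith
    then have 2: "run 1 (s 1 x 1) (4 * g) = run 1 (s 1 x 1) m @ [x]" using m run_Suc2[of 1 "s 1 x 1" m] x by simp
    let ?m = "run 1 (s 1 x 1) m"
    have "eqv ([] @ [bar x, x] @ (?m @ [x])) ([] @ (?m @ [x]))"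
      using x W_run by (intro eqv_del eqv_cancel') auto
    then have "eqv (?m @ [x]) ([bar x] @ (x # ?m) @ [x])" using eqv_sym by simp
    also have "eqv ([bar x] @ (x # ?m) @ [x]) ([bar x] @ [x])"
      using Suc x unfolding x_def[symmetric] 1 by (intro eqv_del) auto
    also have "eqv ([bar x] @ [x]) []" using eqv_cancel'[OF x] by simp
    finally show ?case using 2 by (simp add: x_def add.commute)
  qed
  from this[of "nat x"] show "inr x \<Longrightarrow> eqv (run 1 x (4 * g)) []"
    by (simp add: inr_def s_def)
qed

lemma eqv_winv_Nil: "W w \<Longrightarrow> eqv w [] \<Longrightarrow> eqv (winv w) []"
proof -
  assume w: "W w" "eqv w []"
  have "eqv ([] @ w @ winv w) ([] @ winv w)" using w by (intro eqv_del) auto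
  then have "eqv (winv w) (w @ winv w)" using eqv_sym by simp
  then show ?thesis using eqv_winv[OF w(1)] eqv_trans by blast
qed

lemma winv_run: "dir d \<Longrightarrow> winv (run d x n) = run (- d) (s d x (int n - 1 + 2 * int g)) n"
  unfolding winv_def by (rule bar_run)

lemma eqv_full: "dir d \<Longrightarrow> inr x \<Longrightarrow> eqv (run d x (4 * g)) []"
proof -
  assume d: "dir d" and x: "inr x"
  consider "d = 1" | "d = -1" using d by (auto simp: dir_def)
  then show ?thesis
  proof cases
    case 1
    then show ?thesis using eqv_full1 x by simp
  next
    case 2
    have "winv (run 1 (s 1 x (1 - 6 * int g)) (4 * g)) = run (- 1) x (4 * g)"
      using winv_run[OF dir1, of "s 1 x (1 - 6 * int g)" "4 * g"] x by simp
    then show ?thesis using eqv_winv_Nil[OF W_run eqv_full1] 2 by (metis inr_s)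
  qed
qed

text \<open>The other side of the cell is the inverse of the rest of the cyclic relator. Its first
  letter is the inverse of the letter preceding \<open>x\<close>, hence does not depend on
  \<open>r\<close>.\<close>

lemma eqv_run:
  assumes d: "dir d" and x: "inr x" and r: "r \<le> 4 * g"
  shows "eqv (run d x r) (run (- d) (s d x (2 * int g - 1)) (4 * g - r))"
proof -
  define v where "v = run d (s d x (int r)) (4 * g - r)"
  have 1: "run d x (4 * g) = run d x r @ v" using run_append[of d x r "4 * g - r"] r by (simp add: v_def)
  have "s d x (6 * int g - 1) = s d x (2 * int g - 1)" by (intro s_period[OF d]) simp
  then have 2: "winv v = run (- d) (s d x (2 * int g - 1)) (4 * g - r)"
    using winv_run[OF d, of "s d x (int r)" "4 * g - r"] r by (simp add: v_def of_nat_diff)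
  have "eqv (run d x r @ (v @ winv v) @ []) (run d x r @ [])"
    using eqv_winv[of v] W_run by (intro eqv_del) (auto simp: v_def)
  then have "eqv (run d x r) (run d x (4 * g) @ winv v)" using eqv_sym 1 by simp
  also have "eqv ([] @ run d x (4 * g) @ winv v) ([] @ winv v)"
    using eqv_full[OF d x] by (intro eqv_del) auto
  then have "eqv (run d x (4 * g) @ winv v) (winv v)" by simp
  finally show ?thesis unfolding 2 .
qed

lemma swap_eq: "dir d \<Longrightarrow> inr x \<Longrightarrow> blk (- d) (bar x) @ [x] = run (- d) (s d x (2 * int g - 1)) (2 * g)"
  using blk_snoc_run[of "- d" "bar x"] by (simp add: s_uminus)

lemma W_blk: "W (blk d x)" by (rule inr_blk)

lemma W_pw: "W w \<Longrightarrow> W (pw k w)" using set_pw[of k w] by (meson subsetD)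

lemma eqv_swap: "dir d \<Longrightarrow> inr x \<Longrightarrow> eqv ([x] @ blk d x) (blk (- d) (bar x) @ [x])"
  using eqv_run[of d x "2 * g"] Cons_blk[of x d] swap_eq[of d x] by simp

lemma eqv_swaps: "dir d \<Longrightarrow> inr x \<Longrightarrow> eqv ([x] @ pw k (blk d x)) (pw k (blk (- d) (bar x)) @ [x])"
proof (induction k)
  case 0
  then show ?case by (simp add: eqv_refl)
next
  case (Suc k)
  have a: "eqv (([x] @ blk d x) @ pw k (blk d x)) ((blk (- d) (bar x) @ [x]) @ pw k (blk d x))"
    using Suc.prems W_pw[OF W_blk] by (intro eqv_app eqv_swap eqv_refl) auto
  have b: "eqv (blk (- d) (bar x) @ ([x] @ pw k (blk d x))) (blk (- d) (bar x) @ (pw k (blk (- d) (bar x)) @ [x]))"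
    by (rule eqv_app[OF eqv_refl[OF W_blk] Suc.IH[OF Suc.prems]])
  from eqv_trans[OF a[unfolded append_assoc] b[unfolded append_assoc]] show ?case by simp
qed

lemma eqv_F2: "dir d \<Longrightarrow> inr x \<Longrightarrow> eqv (x # pw k (blk d x) @ [bar x]) (pw k (blk (- d) (bar x)))"
proof -
  assume d: "dir d" and x: "inr x"
  have a: "eqv (([x] @ pw k (blk d x)) @ [bar x]) ((pw k (blk (- d) (bar x)) @ [x]) @ [bar x])"
    using x by (intro eqv_app eqv_swaps d eqv_refl) auto
  have "eqv (pw k (blk (- d) (bar x)) @ [x, bar x] @ []) (pw k (blk (- d) (bar x)) @ [])"
    using eqv_cancel[OF x] W_pw[OF W_blk] by (intro eqv_del) auto
  then have b: "eqv ((pw k (blk (- d) (bar x)) @ [x]) @ [bar x]) (pw k (blk (- d) (bar x)))" by simp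
  from eqv_trans[OF a b] show ?thesis by simp
qed

text \<open>Each defining relation acts trivially on the vertices: cancelling pairs because edges
  are reversible and unique, the relator because all faces close.\<close>

lemma walk_pres_eq:
  assumes "pres_eq {1..2 * g} {surface_relator g} v w" "L p"
  shows "walk p (map dec v) q \<longleftrightarrow> walk p (map dec w) q"
  using assms
proof (induction arbitrary: p q rule: pres_eq.induct)
  case (cancel u a v)
  define b where "b = dec a"
  have a: "a \<in> Gen ` {1..2 * g} \<union> InvGen ` {1..2 * g}" using cancel.hyps by simp
  then have b: "inr b" "dec (letter_inv a) = bar b" using enc_dec dec_inv by (auto simp: b_def)
  have one: "walk r [b, bar b] t \<longleftrightarrow> r = t" if "L r" for r t
  proof -
    obtain q where q: "edge r b q" using edge_total[OF \<open>L r\<close> b(1)] by blast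
    show ?thesis
    proof
      assume "walk r [b, bar b] t"
      then obtain q' where "edge r b q'" "edge q' (bar b) t" by auto
      then have "edge q (bar b) t" using edge_fun[OF q] by simp
      then show "r = t" using edge_fun[OF edge_sym[OF q]] by simp
    next
      assume "r = t"
      then show "walk r [b, bar b] t" using q edge_sym[OF q] by auto
    qed
  qed
  have *: "walk r ([b, bar b] @ z) t \<longleftrightarrow> walk r z t" if "L r" for r z t
    by (simp only: walk_append one[OF that] simp_thms)
  have eq: "map dec (u @ [a, letter_inv a] @ v) = map dec u @ ([b, bar b] @ map dec v)" using b by (simp add: b_def)
  have "walk p (map dec u @ ([b, bar b] @ map dec v)) q \<longleftrightarrow>
      (\<exists>r. walk p (map dec u) r \<and> walk r ([b, bar b] @ map dec v) q)" by (rule walk_append)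
  also have "\<dots> \<longleftrightarrow> (\<exists>r. walk p (map dec u) r \<and> walk r (map dec v) q)"
    using * walk_L[OF _ cancel.prems] by blast
  also have "\<dots> \<longleftrightarrow> walk p (map dec u @ map dec v) q" by (rule walk_append[symmetric])
  finally show ?case unfolding eq unfolding map_append .
next
  case (relator r u v)
  have dr: "map dec r = run 1 0 (4 * g)" using relator.hyps enc_relator[symmetric] map_dec_enc[OF W_run] by simp
  have one: "walk p' (run 1 0 (4 * g)) t \<longleftrightarrow> p' = t" if "L p'" for p' t
  proof -
    have "inr 0" using gi by (simp add: inr_def)
    then have "walk p' (run 1 0 (4 * g)) p'" using face_all[OF that _ dir1] by (simp add: face_def)
    then show ?thesis using walk_fun by blast
  qed
  have *: "walk p' (run 1 0 (4 * g) @ z) t \<longleftrightarrow> walk p' z t" if "L p'" for p' z t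
    by (simp only: walk_append one[OF that] simp_thms)
  have "walk p (map dec u @ (run 1 0 (4 * g) @ map dec v)) q \<longleftrightarrow>
      (\<exists>r. walk p (map dec u) r \<and> walk r (run 1 0 (4 * g) @ map dec v) q)" by (rule walk_append)
  also have "\<dots> \<longleftrightarrow> (\<exists>r. walk p (map dec u) r \<and> walk r (map dec v) q)"
    using * walk_L[OF _ relator.prems] by blast
  also have "\<dots> \<longleftrightarrow> walk p (map dec u @ map dec v) q" by (rule walk_append[symmetric])
  finally show ?case unfolding map_append dr .
qed auto

lemma L_Nil [simp]: "L []"
  using forb_hd by (auto simp: L_def)

lemma L_W: "L w \<Longrightarrow> W w"
  by (simp add: L_def)

text \<open>From \<open>[]\<close> both words lead to themselves, and as equal elements they lead to
  the same vertex.\<close>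

lemma L_unique:
  assumes "L u" "L v" "eqv u v" shows "u = v"
proof -
  have "walk [] u u" "walk [] v v" using walk_tree[of "[]"] assms by simp_all
  moreover have "walk [] u u \<longleftrightarrow> walk [] v u"
    using walk_pres_eq[OF assms(3)[unfolded eqv_def] L_Nil, of u] map_dec_enc[OF L_W[OF assms(1)]]
      map_dec_enc[OF L_W[OF assms(2)]] by simp
  ultimately show ?thesis using walk_fun by blast
qed

lemma word_less_len: "length v < length w \<Longrightarrow> word_less v w"
  by (simp add: word_less_def lenlex_conv)

lemma word_less_lex: "length v = length w \<Longrightarrow> letter_less a b \<Longrightarrow> word_less (p @ a # v) (p @ b # w)"
  by (auto simp: word_less_def lenlex_conv lex_conv)

lemma forb_reduce:
  assumes "forb f"
  shows "\<exists>f'. W f' \<and> eqv f f' \<and> (\<forall>p r. word_less (map enc (p @ f' @ r)) (map enc (p @ f @ r)))"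
  using assms
proof (cases rule: forb_cases)
  case (F1 x)
  then show ?thesis using eqv_cancel by (intro exI[of _ "[]"]) (auto intro: word_less_len)
next
  case (F2 d x k)
  then show ?thesis using eqv_F2[OF F2(1,2), of k] W_pw[OF W_blk]
    by (intro exI[of _ "pw k (blk (- d) (bar x))"]) (auto intro: word_less_len)
next
  case (F3 d x)
  let ?y = "s d x (2 * int g - 1)"
  obtain m where m: "2 * g = Suc m" using g2 by (cases "2 * g") auto
  have r: "run (- d) ?y (2 * g) = ?y # run (- d) (s (- d) ?y 1) m" "run d x (2 * g) = x # run d (s d x 1) m"
    using m run_Suc F3 by simp_all
  have "eqv f (run (- d) ?y (2 * g))" using eqv_run[OF F3(1,2), of "2 * g"] F3 Cons_blk by simp
  moreover have "word_less (map enc (p @ run (- d) ?y (2 * g) @ r)) (map enc (p @ f @ r))" for p r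
    using F3 Cons_blk letter_less_bad[OF F3(1-3)] word_less_lex[of "map enc (run (- d) (s (- d) ?y 1) m @ r)" "map enc (run d (s d x 1) m @ r)" "enc ?y" "enc x" "map enc p"] \<open>run d x (2 * g) = _\<close>
    unfolding \<open>run (- d) ?y (2 * g) = _\<close> by simp
  ultimately show ?thesis using W_run by blast
qed

lemma nf_L:
  assumes "x \<in> carrier (surface_group g)"
  shows "L (map dec (nf x)) \<and> map enc (map dec (nf x)) = nf x \<and> nf x \<in> words {1..2 * g} \<and> x = element g (nf x)"
proof -
  obtain w where w: "w \<in> words {1..2 * g}" "x = element g w"
    using assms by (auto simp: carrier_surface_group)
  have least: "nf x \<in> x" "\<And>v. v \<in> x \<Longrightarrow> v \<noteq> nf x \<Longrightarrow> word_less (nf x) v" using nf_least[OF assms] by auto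
  then have p: "pres_eq {1..2 * g} {surface_relator g} w (nf x)"
    using w by (simp add: element_def pres_class_def pres_rel_def)
  have nw: "nf x \<in> words {1..2 * g}" using pres_eq_words[OF p] by simp
  define u where "u = map dec (nf x)"
  have u: "map enc u = nf x" "W u" using words_dec[OF nw] by (auto simp: u_def)
  have "\<not> sublist f u" if f: "forb f" for f
  proof
    assume "sublist f u"
    then obtain a b where ab: "u = a @ f @ b" by (auto simp: sublist_def)
    obtain f' where f': "W f'" "eqv f f'" "word_less (map enc (a @ f' @ b)) (map enc (a @ f @ b))"
      using forb_reduce[OF f] by blast
    have "eqv u (a @ f' @ b)" unfolding ab using u(2) f' ab by (intro eqv_ctx) auto
    then have "map enc (a @ f' @ b) \<in> x" using pres_eq.trans[OF p] w u(1)
      by (simp add: element_def pres_class_def pres_rel_def eqv_def)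
    moreover have "word_less (map enc (a @ f' @ b)) (nf x)" using f'(3) ab u by simp
    ultimately show False using least(2) word_less_irrefl word_less_trans by metis
  qed
  then have "L u" using u(2) by (simp add: L_def)
  moreover have "x = element g (nf x)" unfolding w(2) element_def
    using p pres_class_eq_iff[OF w(1) nw, of "{surface_relator g}"] w(2) by (simp add: element_def)
  ultimately show ?thesis using u nw by (simp add: u_def)
qed

lemma nf_word_eq:
  assumes "W u" "L v" "eqv u v"
  shows "nf_word g (map enc u) = map enc v"
proof -
  let ?x = "element g (map enc u)"
  have x: "?x \<in> carrier (surface_group g)" using enc_words[OF assms(1)] by (simp add: carrier_surface_group)
  define n where "n = map dec (nf ?x)"
  have n: "L n" "map enc n = nf ?x" "nf ?x \<in> words {1..2 * g}" "?x = element g (nf ?x)"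
    using nf_L[OF x] by (auto simp: n_def)
  have "eqv u n" unfolding eqv_def n(2)
    using n(3,4) pres_class_eq_iff[OF enc_words[OF assms(1)] n(3)] by (simp add: element_def)
  then have "eqv n v" using assms(3) eqv_sym eqv_trans by blast
  then have "n = v" using L_unique n(1) assms(2) by blast
  then show ?thesis using n(2) by (simp add: nf_word_def)
qed

lemma nf_word_L: "L w \<Longrightarrow> nf_word g (map enc w) = map enc w"
  by (intro nf_word_eq eqv_refl) (auto dest: L_W)

subsection \<open>Resolving a forbidden factor at a junction\<close>

text \<open>Appending \<open>bar z\<close> turns the strip into a forbidden factor, to which
  \<open>forbd_break\<close> applies.\<close>

lemma blk_break:
  assumes d: "dir d" and z: "inr z" and eq: "z # pw i (blk d z) = p @ q" and ne: "p \<noteq> []" "q \<noteq> []"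
    and h: "hd q \<noteq> s d (last p) 1"
  shows "\<exists>k1 k2. 1 \<le> k1 \<and> 1 \<le> k2 \<and> p = z # pw k1 (blk d z) \<and> q = pw k2 (blk d z)"
proof -
  have i: "1 \<le> i" using eq ne by (cases i) (auto simp: Cons_eq_append_conv)
  have e: "p @ (q @ [bar z]) = z # pw i (blk d z) @ [bar z]" using eq by simp
  then have f: "forbd d (p @ (q @ [bar z]))" unfolding forbd_def e using z i by blast
  have "adj d (last p) (hd (q @ [bar z]))" using forbd_adj[OF d f] ne by simp
  then have "hd (q @ [bar z]) = s d (last p) (2 * int g + 2)" using h ne by (simp add: adj_def)
  then obtain x k1 k2 where x: "1 \<le> k1" "1 \<le> k2" "p = x # pw k1 (blk d x)" "q @ [bar z] = pw k2 (blk d x) @ [bar x]"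
    using forbd_break[OF d f ne(1)] by auto
  have "x = z" using x(3) eq by simp
  then show ?thesis using x by auto
qed

text \<open>A letter of a strip that is not continued by a unit step ends a block. This pins its
  residue, which is then compared with the letters known at the border of the junction.\<close>

lemma reach:
  assumes d: "dir d" and z: "inr z" and Lw: "Lw = pw i (blk d z) \<or> (Lw = z # pw i (blk d z) \<and> 1 \<le> i)"
    and q: "Lw = q @ [a] @ B" and h: "B \<noteq> [] \<Longrightarrow> hd B \<noteq> s d a 1"
  shows "a = s d z (2 * int g - 1)"
proof (cases "B = []")
  case True
  then have "a = last Lw" using q by simp
  moreover have "1 \<le> i" using Lw q by (cases i) auto
  then have "last Lw = s d z (2 * int g - 1)" using Lw by auto
  ultimately show ?thesis by simp
next
  case False
  have "\<exists>p. z # pw i (blk d z) = (p @ [a]) @ B" using Lw q by (metis append.assoc append_Cons)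
  then obtain p where p: "z # pw i (blk d z) = (p @ [a]) @ B" by blast
  have "hd B \<noteq> s d (last (p @ [a])) 1" using h False by simp
  from blk_break[OF d z p _ False this] obtain k1 where "1 \<le> k1" "p @ [a] = z # pw k1 (blk d z)" by auto
  then have "last (p @ [a]) = s d z (2 * int g - 1)" by simp
  then show ?thesis by simp
qed

lemma reach_right:
  assumes d: "dir d" and z: "inr z" and Rw: "Rw = pw j (blk d z) \<or> (Rw = pw j (blk d z) @ [bar z] \<and> 1 \<le> j)"
    and q: "Rw = B @ [c] @ q" and h: "B \<noteq> [] \<Longrightarrow> c \<noteq> s d (last B) 1"
  shows "c = s d z 1"
proof -
  have j: "1 \<le> j" using Rw q by (cases j) auto
  show ?thesis
  proof (cases "B = []")
    case True
    then have "c = hd Rw" using q by simp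
    then show ?thesis using Rw j by (auto simp: hd_append)
  next
    case False
    have "\<exists>q'. pw j (blk d z) = B @ c # q'"
    proof (cases "Rw = pw j (blk d z)")
      case True
      then show ?thesis using q by (intro exI[of _ q]) simp
    next
      case F: False
      then have e: "pw j (blk d z) @ [bar z] = B @ c # q" using Rw q by simp
      show ?thesis
      proof (cases q rule: rev_cases)
        case Nil
        then have "B = pw j (blk d z)" "c = bar z" using e by auto
        then have "c = s d (last B) 1" using j d by (simp add: bar_s)
        then show ?thesis using h False by simp
      next
        case (snoc q' y)
        then have "pw j (blk d z) @ [bar z] = (B @ c # q') @ [y]" using e by simp
        then show ?thesis by blast
      qed
    qed
    then obtain q' where "z # pw j (blk d z) = (z # B) @ (c # q')" by auto
    moreover have "hd (c # q') \<noteq> s d (last (z # B)) 1" using h False by simp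
    ultimately obtain k2 where "1 \<le> k2" "c # q' = pw k2 (blk d z)" using blk_break[OF d z, of j "z # B" "c # q'"] by auto
    then have "c = hd (pw k2 (blk d z))" by (metis list.sel(1))
    then show ?thesis using \<open>1 \<le> k2\<close> by simp
  qed
qed

text \<open>The first clause of \<open>JL\<close> alone. It is inherited from the original reduced
  word, whereas the other two clauses are obtained by extending the strip as far as
  possible.\<close>

definition weak :: "int \<Rightarrow> int list \<Rightarrow> int \<Rightarrow> bool" where
  "weak d u x \<longleftrightarrow> (\<forall>k. \<not> suffix (bar x # pw k (blk (- d) (bar x))) u)"

lemma weak_of_L:
  assumes d: "dir d" and x: "inr x" and L: "L (u @ [x])"
  shows "weak d u x"
  unfolding weak_def
proof (intro allI notI)
  fix k assume "suffix (bar x # pw k (blk (- d) (bar x))) u"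
  then obtain r where "u = r @ bar x # pw k (blk (- d) (bar x))" by (auto simp: suffix_def)
  then have "u @ [x] = r @ (bar x # pw k (blk (- d) (bar x)) @ [bar (bar x)]) @ []" using x by simp
  then show False using forb_F2[of "- d" "bar x" k] not_L L d by (metis dir_minus inr_bar)
qed

lemma max_pow:
  fixes B :: "'a list"
  assumes "B \<noteq> []"
  obtains k u where "w = u @ pw k B" "\<not> suffix B u"
proof -
  have "\<exists>k u. w = u @ pw k B \<and> \<not> suffix B u"
  proof (induction "length w" arbitrary: w rule: less_induct)
    case less
    show ?case
    proof (cases "suffix B w")
      case False
      then show ?thesis by (intro exI[of _ 0] exI[of _ w]) simp
    next
      case True
      then obtain r where r: "w = r @ B" by (auto simp: suffix_def)
      then have "length r < length w" using assms by simp
      from less(1)[OF this] obtain k u where "r = u @ pw k B" "\<not> suffix B u" by blast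
      then show ?thesis using r by (intro exI[of _ "Suc k"] exI[of _ u]) (simp add: pw_comm)
    qed
  qed
  then show ?thesis using that by blast
qed

text \<open>\<open>f\<close> is the first letter of the new side and
  \<open>s d f (1 - 2 * int g)\<close> that of the replaced piece. If \<open>w\<close> ends in
  \<open>bar f\<close> followed by blocks, \<open>f\<close> crosses them and cancels
  (\<open>p = []\<close>). Otherwise it stays when the half at \<open>y\<close> is good, and crosses
  all blocks when that half is bad. What remains satisfies \<open>JL\<close> because nothing more
  can be absorbed.\<close>

lemma left_ext:
  assumes d: "dir d" and f: "inr f" and L: "L w" and wk: "weak d w (s d f (1 - 2 * int g))"
    and nl: "\<not> suffix [bar f] w"
  shows "\<exists>u Lw y p i. w = u @ Lw \<and> JL d u y \<and> inr y \<and>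
    eqv (Lw @ [f]) (p @ pw i (blk (- d) f)) \<and>
    ((y = s d f (1 - 2 * int g) \<and> Lw = pw i (blk d (bar f)) \<and> p = [f] \<and> (i = 0 \<or> bad d y)) \<or>
     (y = bar f \<and> Lw = bar f # pw i (blk d (bar f)) \<and> p = [] \<and> 1 \<le> i))"
proof -
  define z where "z = bar f"
  define x where "x = s d f (1 - 2 * int g)"
  have z: "inr z" "bar z = f" using f by (simp_all add: z_def)
  have x: "inr x" "s d x (- 1) = z" "s d z 1 = x"
    using d s_period[of d "2 * int g" "- 2 * int g" f] s_period[of d "2 * int g + 1" "1 - 2 * int g" f]
    by (simp_all add: x_def z_def bar_s[of d])
  have T: "run d x (2 * g - 1) = blk d z" by (simp add: blk_def x)
  show ?thesis
  proof (cases "\<exists>u k. w = u @ z # pw k (blk d z)")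
    case True
    then obtain u k where u: "w = u @ z # pw k (blk d z)" by blast
    have "k \<noteq> 0"
    proof
      assume "k = 0"
      then have "w = u @ [bar f]" using u z_def by simp
      then show False using nl unfolding suffix_def by blast
    qed
    then obtain j where j: "k = Suc j" by (cases k) auto
    have "L (u @ z # blk d z)" using L u j L_app1[of "u @ z # blk d z" "pw j (blk d z)"] by simp
    then have "JL d u z" by (rule JL_of_long[OF d z(1)])
    moreover have "eqv ((z # pw k (blk d z)) @ [f]) ([] @ pw k (blk (- d) f))"
      using eqv_F2[OF d z(1), of k] z(2) by simp
    ultimately show ?thesis using u z(1) \<open>k \<noteq> 0\<close>
      by - (rule exI[of _ u], rule exI[of _ "z # pw k (blk d z)"], rule exI[of _ z], rule exI[of _ "[]"],
        rule exI[of _ k], simp add: z_def)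
  next
    case F: False
    show ?thesis
    proof (cases "bad d x")
      case False
      have "JL d w x" using F False wk by (auto simp: JL_def weak_def x x_def[symmetric] suffix_def)
      then show ?thesis using False f x
        by - (rule exI[of _ w], rule exI[of _ "[]"], rule exI[of _ x], rule exI[of _ "[f]"],
          rule exI[of _ 0], auto simp: x_def eqv_refl)
    next
      case True
      obtain k u where u: "w = u @ pw k (blk d z)" "\<not> suffix (blk d z) u" using max_pow[OF blk_neq_Nil, of w d z] by blast
      have wu: "weak d u x"
      proof (cases k)
        case 0
        then show ?thesis using u wk x_def by simp
      next
        case (Suc j)
        obtain r where "blk d z = x # r" using blk_Cons2[of d z] x by auto
        then have "L (u @ [x])" using L u Suc L_app1[of "u @ [x]" "r @ pw j (blk d z)"] by simp
        then show ?thesis by (rule weak_of_L[OF d x(1)])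
      qed
      have "\<not> suffix (z # pw i (blk d z)) u" for i
      proof
        assume "suffix (z # pw i (blk d z)) u"
        then obtain r where "w = r @ z # pw (i + k) (blk d z)" using u by (auto simp: suffix_def pw_add)
        then show False using F by blast
      qed
      then have "JL d u x" using wu u(2) unfolding JL_def weak_def T x(2) by blast
      moreover have "eqv (pw k (blk d z) @ [f]) ([f] @ pw k (blk (- d) f))"
        using eqv_sym[OF eqv_swaps[of "- d" f k]] d f by (simp add: z_def)
      ultimately show ?thesis using u x True
        by - (rule exI[of _ u], rule exI[of _ "pw k (blk d z)"], rule exI[of _ x], rule exI[of _ "[f]"],
          rule exI[of _ k], simp add: z_def x_def)
    qed
  qed
qed

text \<open>The combinatorial clauses come from \<open>left_ext\<close> through \<open>mir\<close>;
  the group equation is derived afresh from \<open>eqv_swaps\<close> and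
  \<open>eqv_F2\<close>.\<close>

lemma right_ext:
  assumes d: "dir d" and l: "inr l" and L: "L w" and wk: "weak d (mir w) (neg (s d l (2 * int g - 1)))"
    and nl: "\<not> prefix [bar l] w"
  shows "\<exists>v Rw y q j. w = Rw @ v \<and> JR d v y \<and> inr y \<and>
    eqv ([l] @ Rw) (pw j (blk (- d) (bar l)) @ q) \<and>
    ((y = s d l (2 * int g - 1) \<and> Rw = pw j (blk d l) \<and> q = [l] \<and> (j = 0 \<or> bad d l)) \<or>
     (y = bar l \<and> Rw = pw j (blk d l) @ [bar l] \<and> q = [] \<and> 1 \<le> j))"
proof -
  define f where "f = neg l"
  have f: "inr f" "bar f = neg (bar l)" by (simp_all add: f_def)
  have Ww: "W w" using L by (simp add: L_def)
  have n: "neg (s d l (2 * int g - 1)) = s d f (1 - 2 * int g)" by (simp add: f_def neg_s)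
  have "\<not> suffix [bar f] (mir w)"
  proof
    assume "suffix [bar f] (mir w)"
    then obtain r where "mir w = r @ [bar f]" by (auto simp: suffix_def)
    then have "mir (mir w) = neg (bar f) # mir r" by simp
    then have "w = bar l # mir r" using mir_mir[OF Ww] l f by simp
    then show False using nl by simp
  qed
  from left_ext[OF d f(1) L_mir[OF L] wk[unfolded n] this]
  obtain u Lw y p i where e: "mir w = u @ Lw" "JL d u y" "inr y"
     "((y = s d f (1 - 2 * int g) \<and> Lw = pw i (blk d (bar f)) \<and> p = [f] \<and> (i = 0 \<or> bad d y)) \<or>
     (y = bar f \<and> Lw = bar f # pw i (blk d (bar f)) \<and> p = [] \<and> 1 \<le> i))" by blast
  have Wu: "W u" "W Lw" using e(1) set_mir_inr[of _ w] by auto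
  have w: "w = mir Lw @ mir u" using mir_mir[OF Ww] e(1) by simp
  have J: "JR d (mir u) (neg y)" using e(2,3) mir_mir[OF Wu(1)] by (simp add: JR_def)
  have mb: "mir (pw i (blk d (bar f))) = pw i (blk d l)"
    using d l by (simp add: mir_pw mir_blk f_def)
  from e(4) show ?thesis
  proof
    assume a: "y = s d f (1 - 2 * int g) \<and> Lw = pw i (blk d (bar f)) \<and> p = [f] \<and> (i = 0 \<or> bad d y)"
    have "neg y = s d l (2 * int g - 1)" using a l by (simp add: f_def neg_s)
    moreover have "bad d y = bad d l" using a n bad_neg[OF d l] by simp
    ultimately show ?thesis using w J a mb eqv_swaps[OF d l, of i]
      by - (rule exI[of _ "mir u"], rule exI[of _ "mir Lw"], rule exI[of _ "neg y"], rule exI[of _ "[l]"],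
        rule exI[of _ i], auto)
  next
    assume a: "y = bar f \<and> Lw = bar f # pw i (blk d (bar f)) \<and> p = [] \<and> 1 \<le> i"
    have "neg y = bar l" using a f l by simp
    moreover from this have "mir Lw = pw i (blk d l) @ [bar l]" using a mb by simp
    ultimately show ?thesis using w J a eqv_F2[OF d l, of i]
      by - (rule exI[of _ "mir u"], rule exI[of _ "mir Lw"], rule exI[of _ "neg y"], rule exI[of _ "[]"],
        rule exI[of _ i], simp)
  qed
qed

section \<open>The reduced side of a maximal strip\<close>

lemma prefix_run_cut:
  assumes "dir e" "prefix (run e b n) (a @ v)" "a \<noteq> []" "v = [] \<or> hd v \<noteq> s e (last a) 1"
  shows "prefix (run e b n) a"
proof (rule ccontr)
  assume "\<not> ?thesis"
  then obtain r where r: "run e b n = a @ r" "prefix r v" using assms(2) by (auto simp: prefix_append)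
  have "r \<noteq> []" using r \<open>\<not> prefix (run e b n) a\<close> by auto
  then have "hd r = s e (last a) 1" "hd r = hd v" "v \<noteq> []"
    using run_cut[OF assms(1) r(1)[symmetric] assms(3)] prefix_hd[OF r(2)] r(2) by auto
  then show False using assms(4) by auto
qed

lemma sublist_snocD: "sublist f (I @ [l]) \<Longrightarrow> sublist f I \<or> suffix f (I @ [l])"
  by (auto simp: sublist_append sublist_Cons_right prefix_Cons suffix_def)

lemma sublist_ConsD: "sublist f (x # I) \<Longrightarrow> sublist f I \<or> prefix f (x # I)"
  by (auto simp: sublist_Cons_right)

lemma succ_append:
  "successively P u \<Longrightarrow> successively P v \<Longrightarrow> u = [] \<or> v = [] \<or> P (last u) (hd v) \<Longrightarrow> successively P (u @ v)"
  by (auto simp: successively_append_iff)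

text \<open>\<open>f # mid @ [l]\<close> is the other side of the innermost strip of relator cells; it runs in direction \<open>e\<close>.\<close>

definition midok :: "int \<Rightarrow> int \<Rightarrow> int list \<Rightarrow> int \<Rightarrow> bool" where
  "midok e f mid l \<longleftrightarrow> successively (stp e) (f # mid @ [l]) \<and> W mid \<and>
     (if mid = [] then l = s e f 1 else hd mid = s e f 1 \<and> l = s e (last mid) 1)"

lemma midok_last: "inr f \<Longrightarrow> midok e f mid l \<Longrightarrow> last (f # mid) = s e l (- 1)"
  by (auto simp: midok_def L_def split: if_splits)

text \<open>The junctions between the blocks and the middle part are never unit steps, so no half
  relator can extend across them.\<close>

lemma chain_norun:
  assumes e: "dir e" and f: "inr f" and l: "inr l" and m: "midok e f mid l" and nm: "norun e mid"
  shows "norun e (pw i (blk e f) @ mid @ pw j (blk e (bar l)))"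
    and "norun e (f # mid) \<Longrightarrow> norun e (f # mid @ pw j (blk e (bar l)))"
    and "norun e (mid @ [l]) \<Longrightarrow> norun e (pw i (blk e f) @ mid @ [l])"
proof -
  have ne: "s e f 1 \<noteq> s e f (2 * int g)" "s e f (2 * int g + 2) \<noteq> s e f (2 * int g)"
    "s e l (2 * int g + 1) \<noteq> s e l 0"
    using e gi by (simp_all only: s_eq8) auto
  have la: "last (f # mid) = s e l (- 1)" by (rule midok_last[OF f m])
  have hj: "j \<noteq> 0 \<Longrightarrow> hd (pw j (blk e (bar l))) = s e l (2 * int g + 1)" for j using e by simp
  have 1: "norun e (mid @ pw j (blk e (bar l)))"
  proof (rule norun_glue[OF e nm norun_pw[OF e]])
    show "mid = [] \<or> pw j (blk e (bar l)) = [] \<or> hd (pw j (blk e (bar l))) \<noteq> s e (last mid) 1"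
      using la hj[of j] ne(3) l by (cases "mid = []"; cases "j = 0") auto
  qed
  have li: "last (pw i (blk e f)) = s e f (2 * int g - 1)" if "i \<noteq> 0" for i using that by simp
  have hm: "hd (mid @ v) \<noteq> s e f (2 * int g)" if "mid @ v \<noteq> []" "mid = [] \<Longrightarrow> hd v = s e f (2 * int g + 2) \<or> hd v = s e f 1" for v
    using that m ne by (auto simp: midok_def hd_append split: if_splits)
  have l2: "mid = [] \<Longrightarrow> s e l (2 * int g + 1) = s e f (2 * int g + 2)" using m by (simp add: midok_def add.commute)
  show "norun e (pw i (blk e f) @ mid @ pw j (blk e (bar l)))"
  proof (rule norun_glue[OF e norun_pw[OF e] 1])
    show "pw i (blk e f) = [] \<or> mid @ pw j (blk e (bar l)) = [] \<or>
      hd (mid @ pw j (blk e (bar l))) \<noteq> s e (last (pw i (blk e f))) 1"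
      using li[of i] hm[of "pw j (blk e (bar l))"] hj[of j] l2 by (cases "i = 0"; cases "j = 0") auto
  qed
  show "norun e (f # mid @ pw j (blk e (bar l)))" if "norun e (f # mid)"
  proof -
    have "norun e ((f # mid) @ pw j (blk e (bar l)))"
    proof (rule norun_glue[OF e that norun_pw[OF e]])
      show "f # mid = [] \<or> pw j (blk e (bar l)) = [] \<or> hd (pw j (blk e (bar l))) \<noteq> s e (last (f # mid)) 1"
        unfolding la using hj[of j] ne(3) l by (cases "j = 0") auto
    qed
    then show ?thesis by simp
  qed
  show "norun e (pw i (blk e f) @ mid @ [l])" if "norun e (mid @ [l])"
  proof (rule norun_glue[OF e norun_pw[OF e] that])
    show "pw i (blk e f) = [] \<or> mid @ [l] = [] \<or> hd (mid @ [l]) \<noteq> s e (last (pw i (blk e f))) 1"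
      using li[of i] hm[of "[l]"] m by (cases "i = 0") (auto simp: midok_def)
  qed
qed

lemma chain_succ:
  assumes e: "dir e" and f: "inr f" and l: "inr l" and m: "midok e f mid l"
  shows "successively (stp e) (f # pw i (blk e f) @ mid @ pw j (blk e (bar l)) @ [l])"
proof -
  have la: "last (f # mid) = s e l (- 1)" by (rule midok_last[OF f m])
  define C where "C = pw j (blk e (bar l)) @ [l]"
  have C: "successively (stp e) C" "C \<noteq> []" "hd C = l \<or> hd C = s e l (2 * int g + 1)"
  proof -
    have "stp e (s e l (4 * int g - 1)) l"
      using e l s_period[of e "4 * int g" 0 l] by (simp add: stp_def)
    then show "successively (stp e) C"
      unfolding C_def using succ_append[OF succ_stp_pw'[OF e, of "bar l" j], of "[l]"] e by (cases "j = 0") auto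
    show "C \<noteq> []" "hd C = l \<or> hd C = s e l (2 * int g + 1)"
      unfolding C_def using e by (cases "j = 0"; simp add: hd_append)+
  qed
  have st: "stp e a (s e a 1)" "stp e a (s e a (2 * int g + 2))" "stp e a (s e a 3)" for a by (auto simp: stp_def)
  define A where "A = f # pw i (blk e f)"
  have A: "successively (stp e) A" "A \<noteq> []" "last A = f \<or> last A = s e f (2 * int g - 1)"
    using succ_stp_pw[OF e f] by (auto simp: A_def)
  have fp: "s e f (4 * int g + 1) = s e f 1" by (rule s_period[OF e]) simp
  have A1: "stp e (last A) (s e f 1)" "stp e (last A) (s e f (2 * int g + 2))"
    using A(3) st[of f] st(2,3)[of "s e f (2 * int g - 1)"] fp by (auto simp: add.commute)
  have M: "successively (stp e) (mid @ C)"
  proof (rule succ_append[OF _ C(1)])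
    show "successively (stp e) mid" using m by (auto simp: midok_def successively_append_iff dest: successively_Cons[THEN iffD1])
    show "mid = [] \<or> C = [] \<or> stp e (last mid) (hd C)"
    proof (cases "mid = []")
      case False
      then have "last mid = s e l (- 1)" using la by simp
      then show ?thesis using C(3) st(1,2)[of "s e l (- 1)"] l by (auto simp: add.commute)
    qed simp
  qed
  have "successively (stp e) (A @ (mid @ C))"
  proof (rule succ_append[OF A(1) M])
    have "hd (mid @ C) = s e f 1 \<or> hd (mid @ C) = s e f (2 * int g + 2)"
      using m C by (auto simp: midok_def hd_append add.commute split: if_splits)
    then show "A = [] \<or> mid @ C = [] \<or> stp e (last A) (hd (mid @ C))" using A1 by auto
  qed
  then show ?thesis by (simp add: A_def C_def)
qed

text \<open>Only direction \<open>- d\<close> matters, by \<open>desc_L\<close>, and the inner part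
  has no half relator. So a forbidden factor starts at \<open>f\<close> or ends at \<open>l\<close>.
  A bad half starting at \<open>f\<close> makes the complementary half good, which forces
  \<open>i = 0\<close> and puts the bad half inside \<open>f # mid @ [l]\<close>, against
  \<open>c2\<close>; the end at \<open>l\<close> is symmetric. A longer factor would need
  \<open>l = bar f\<close>.\<close>

lemma chain_L:
  assumes d: "dir d" and f: "inr f" and l: "inr l" and m: "midok (- d) f mid l"
    and c2: "norun (- d) (f # mid @ [l]) \<or>
      (f # mid @ [l] = run (- d) f (2 * g) \<and> bad d (s d f (1 - 2 * int g)) \<and> bad d l)"
    and c4: "l \<noteq> bar f"
    and p: "p = [f] \<and> (i = 0 \<or> bad d (s d f (1 - 2 * int g))) \<or> p = [] \<and> 1 \<le> i"
    and q: "q = [l] \<and> (j = 0 \<or> bad d l) \<or> q = [] \<and> 1 \<le> j"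
  shows "norun (- d) mid" "L (p @ pw i (blk (- d) f) @ mid @ pw j (blk (- d) (bar l)) @ q)"
proof -
  define e where "e = - d"
  have e: "dir e" using d by (simp add: e_def)
  have e': "d = - e" by (simp add: e_def)
  have sub: "sublist mid (f # mid @ [l])" "sublist (f # mid) (f # mid @ [l])" "sublist (mid @ [l]) (f # mid @ [l])"
    by (auto simp: sublist_def) (metis append_Nil append_Cons append_Nil2)+
  have nm: "norun e mid"
    using c2
  proof
    assume "norun (- d) (f # mid @ [l])"
    then show ?thesis using norun_sublist sub(1) e_def by blast
  next
    assume "f # mid @ [l] = run (- d) f (2 * g) \<and> bad d (s d f (1 - 2 * int g)) \<and> bad d l"
    then have "length (f # mid @ [l]) = 2 * g" by simp
    then show ?thesis by (intro norun_short) simp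
  qed
  then show "norun (- d) mid" by (simp add: e_def)
  note cn = chain_norun[OF e f l m[folded e_def] nm]
  define I where "I = pw i (blk e f) @ mid @ pw j (blk e (bar l))"
  have nI: "norun e I" using cn(1) by (simp add: I_def)
  have st: "successively (stp e) ([f] @ I @ [l])" using chain_succ[OF e f l m[folded e_def]] by (simp add: I_def)
  define w where "w = p @ I @ q"
  have wsub: "sublist w ([f] @ I @ [l])"
    unfolding w_def using p q by (auto simp: sublist_def) (metis append_Nil append_Cons append_Nil2)+
  have Wi: "W ([f] @ I @ [l])" using f l m W_pw[OF W_blk] by (auto simp: I_def midok_def)
  have "L w"
  proof (rule desc_L[OF e])
    show "\<forall>x\<in>set w. inr x" using Wi set_mono_sublist[OF wsub] by blast
    show "successively (stp e) w" using successively_sublist[OF st wsub] .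
    fix fw assume fb: "forbd e fw"
    obtain b r where b0: "inr b \<and> fw = run e b (2 * g) @ r \<and> hd fw = b \<and> (r = [] \<longrightarrow> bad e b) \<and>
      (r \<noteq> [] \<longrightarrow> last fw = bar b \<and> (\<exists>r'. r' \<noteq> [] \<and> fw = r' @ run e (s e b 1) (2 * g)))"
      using forbd_start[OF e fb] by (elim exE)
    have b: "inr b" "fw = run e b (2 * g) @ r" "hd fw = b" "r = [] \<Longrightarrow> bad e b"
      "r \<noteq> [] \<Longrightarrow> last fw = bar b" "r \<noteq> [] \<Longrightarrow> \<exists>r'. r' \<noteq> [] \<and> fw = r' @ run e (s e b 1) (2 * g)"
      using b0 by blast+
    have fwne: "fw \<noteq> []" using b(2) g2 by auto
    have nsub: "\<not> sublist fw I" using norun_no[OF nI b(1)] b(2) by (metis append_Nil)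
    have case_q: False if sf: "sublist fw (I @ q)"
    proof -
      have ql: "q = [l]" "j = 0 \<or> bad d l" using q sf nsub by auto
      have "suffix fw (I @ [l])" using sublist_snocD[of fw I l] sf ql nsub by auto
      then obtain a where a: "I @ [l] = a @ fw" by (auto simp: suffix_def)
      have r: "r = []"
      proof (rule ccontr)
        assume "r \<noteq> []"
        then have "I = a @ run e b (2 * g) @ butlast r" using a b(2)
          by (metis append.assoc append_butlast_last_id butlast_snoc butlast_append append_is_Nil_conv)
        then have "sublist (run e b (2 * g)) I" by (auto simp: sublist_def)
        then show False using nI b(1) by (simp add: norun_def)
      qed
      have "last fw = l" using a fwne by (metis last_appendR last_snoc)
      then have "l = s e b (2 * int g - 1)" using b(2) r g2 by simp
      then have bl: "b = s d l (2 * int g - 1)" using b(1) by (simp add: e_def s_uminus)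
      show False
      proof (cases "bad d l")
        case True
        then show ?thesis using bad_compl[OF d l] b(4)[OF r] bl e_def by simp
      next
        case False
        then have "j = 0" using ql by simp
        then have "I @ [l] = pw i (blk e f) @ mid @ [l]" by (simp add: I_def)
        moreover have "norun e (mid @ [l])" using c2 False norun_sublist[OF _ sub(3)] e_def by blast
        ultimately have "norun e (I @ [l])" using cn(3) by simp
        then show ?thesis using norun_no[of e "I @ [l]" b fw "[]" r] b(1,2) sf ql by simp
      qed
    qed
    show "\<not> sublist fw w"
    proof
      assume sw: "sublist fw w"
      have pf: "p = [f]" "i = 0 \<or> bad d (s d f (1 - 2 * int g))" using p sw case_q w_def by auto
      then have pr: "prefix fw (f # I @ q)" using sublist_ConsD[of fw f "I @ q"] sw case_q w_def by auto
      then have bf: "b = f" using prefix_hd[OF pr fwne] b(3) by simp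
      obtain t where t: "f # I @ q = fw @ t" using pr by (auto simp: prefix_def)
      have r: "r = []"
      proof (rule ccontr)
        assume "r \<noteq> []"
        then obtain r' where r': "r' \<noteq> []" "fw = r' @ run e (s e b 1) (2 * g)" using b(6) by blast
        then obtain r'' where "I @ q = r'' @ run e (s e b 1) (2 * g) @ t" using t by (cases r') auto
        then have iq: "I @ q = r'' @ run e (s e b 1) (2 * g) @ t" .
        show False
        proof (cases "q = [] \<or> t \<noteq> []")
          case True
          then have "I = r'' @ run e (s e b 1) (2 * g) @ (if q = [] then t else butlast t)"
            using iq q by (auto simp: butlast_append dest: arg_cong[of _ _ butlast])
          then have "sublist (run e (s e b 1) (2 * g)) I" by (metis sublist_appendI)
          then show False using nI by (simp add: norun_def)
        next
          case False
          then have "q = [l]" "t = []" using q by auto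
          then have "last fw = l" using t by (metis append_Cons append_Nil2 last_appendR last_snoc append_is_Nil_conv list.distinct(1) last_ConsR)
          then show False using b(5)[OF \<open>r \<noteq> []\<close>] bf c4 by simp
        qed
      qed
      have be: "bad e f" using b(4)[OF r] bf by simp
      define x where "x = s d f (1 - 2 * int g)"
      have "s d x (2 * int g - 1) = f" using f by (simp add: x_def)
      then have nb: "\<not> bad d x" using bad_compl[OF d, of x] be e_def x_def by auto
      then have i0: "i = 0" using pf x_def by simp
      have nr: "norun e (f # mid @ [l])" using c2 nb x_def e_def by blast
      have fr: "fw = run e f (2 * g)" using b(2) r bf by simp
      have "prefix (run e f (2 * g)) ((f # mid) @ (pw j (blk e (bar l)) @ q))"
        using pr fr i0 by (simp add: I_def)
      moreover have "j \<noteq> 0 \<Longrightarrow> hd (pw j (blk e (bar l)) @ q) \<noteq> s e (last (f # mid)) 1"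
        using midok_last[OF f m[folded e_def]] l e gi s_eq8[OF e, of "2 * int g + 1" 0 l] by (auto simp: hd_append)
      ultimately have "prefix (run e f (2 * g)) (f # mid) \<or> (j = 0 \<and> prefix (run e f (2 * g)) (f # mid @ q))"
        using prefix_run_cut[OF e, of f "2 * g" "f # mid" "pw j (blk e (bar l)) @ q"] by (cases "j = 0") auto
      then have "sublist (run e f (2 * g)) (f # mid @ [l])"
      proof
        assume "prefix (run e f (2 * g)) (f # mid)"
        then show ?thesis using sub(2) sublist_order.order_trans prefix_imp_sublist by blast
      next
        assume "j = 0 \<and> prefix (run e f (2 * g)) (f # mid @ q)"
        then show ?thesis using q prefix_imp_sublist by auto
      qed
      then show False using nr f by (simp add: norun_def)
    qed
  qed
  then show "L (p @ pw i (blk (- d) f) @ mid @ pw j (blk (- d) (bar l)) @ q)" by (simp add: w_def I_def e_def)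
qed

section \<open>Closing the reduced junction up cyclically\<close>

lemma suffix_app_cases:
  assumes "suffix w (m @ B)"
  shows "suffix w B \<or> (\<exists>w1. w1 \<noteq> [] \<and> w = w1 @ B \<and> suffix w1 m)"
proof -
  from assms obtain a where "m @ B = a @ w" by (auto simp: suffix_def)
  then obtain us where "m = a @ us \<and> us @ B = w \<or> m @ us = a \<and> B = us @ w"
    by (auto simp: append_eq_append_conv2)
  then show ?thesis by (cases "us = []") (auto simp: suffix_def)
qed

lemma no_mixed_pair:
  assumes d: "dir d" and w: "suffix w m" "2 \<le> length w" "successively (adj d) w" and m: "successively (stp (- d)) m"
  shows False
proof -
  obtain a b r where w': "w = a # b # r" using w(2) by (metis Suc_le_length_iff numeral_2_eq_2)
  have "successively (stp (- d)) w" using successively_sublist[OF m] w(1) by (auto simp: suffix_def)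
  then show False using w(3) stp_nadj[of "- d" a b] d unfolding w' by simp
qed

lemma JR_hd: "JR d v y \<Longrightarrow> v \<noteq> [] \<Longrightarrow> hd v \<noteq> bar y \<and> hd v \<noteq> s d y 1"
proof -
  assume J: "JR d v y" and ne: "v \<noteq> []"
  obtain a t where v: "v = a # t" using ne by (cases v) auto
  have sf: "suffix [neg a] (mir v)" by (simp add: v suffix_def)
  have 1: "\<not> suffix (bar (neg y) # pw 0 (blk (- d) (bar (neg y)))) (mir v)"
    and 2: "\<not> suffix (s d (neg y) (- 1) # pw 0 (blk d (s d (neg y) (- 1)))) (mir v)"
    using J unfolding JR_def JL_def by blast+
  show ?thesis using sf 1 2 by (auto simp: v neg_s)
qed

lemma JL_last: "JL d u x \<Longrightarrow> u \<noteq> [] \<Longrightarrow> last u \<noteq> bar x \<and> last u \<noteq> s d x (- 1)"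
proof -
  assume J: "JL d u x" and ne: "u \<noteq> []"
  have sf: "suffix [last u] u" using ne by (metis append_butlast_last_id suffixI)
  have 1: "\<not> suffix (bar x # pw 0 (blk (- d) (bar x))) u"
    and 2: "\<not> suffix (s d x (- 1) # pw 0 (blk d (s d x (- 1)))) u"
    using J unfolding JL_def by blast+
  show ?thesis using sf 1 2 by auto
qed

text \<open>Decides whether another copy of \<open>m\<close> may follow \<open>m @ B\<close>. A
  suffix excluded by \<open>JL\<close> either lies in \<open>B\<close>, against the hypothesis on
  \<open>P @ B\<close>, or reaches into \<open>m\<close>. In the first clause the residues and
  \<open>N\<close> carry the conflict back to \<open>P @ B\<close> or \<open>B @ R\<close>. In the
  others \<open>m\<close>, which turns the other way, contributes a single letter; this is
  impossible by residues unless that letter is \<open>x\<close> and \<open>B\<close> completes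
  \<open>run d x (2 * g - 1)\<close>, the annular case.\<close>

lemma JL_mB:
  assumes d: "dir d" and x: "inr x" and y: "y = s d x (D + 2 * int g)" and D: "- 1 \<le> D" "D \<le> 2 * int g - 1"
    and m: "2 \<le> length m" "successively (stp (- d)) m" "last m = s d y (2 * int g + 1)"
    and J: "JL d (P @ B) x" "JR d (B @ R) y" and ne: "P \<noteq> []" "R \<noteq> []"
    and N: "last P = y \<or> hd R = x"
  shows "JL d (m @ B) x \<or> (D = - 1 \<and> bad d x \<and> B = run d (s d x 1) (2 * g - 2))"
proof (rule ccontr)
  assume c: "\<not> ?thesis"
  define e where "e = - d"
  have e: "dir e" using d by (simp add: e_def)
  have mu: "last m = s d x (D + 4 * int g + 1)" using m(3) y by (simp add: algebra_simps)
  have Psplit: "P = butlast P @ [last P]" using ne by simp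
  obtain R' where R: "R = hd R # R'" using ne(2) by (cases R) auto
  have suf: "suffix w B \<Longrightarrow> suffix w (P @ B)" for w by (auto simp: suffix_def)
  have lastw: "last w1 = last m" if "w1 \<noteq> []" "suffix w1 m" for w1 using suffix_last that by blast
  from c consider k where "suffix (bar x # pw k (blk e (bar x))) (m @ B)"
    | k where "suffix (s d x (- 1) # pw k (blk d (s d x (- 1)))) (m @ B)"
    | "bad d x" "suffix (run d x (2 * g - 1)) (m @ B)"
    unfolding JL_def e_def by blast
  then show False
  proof cases
    case (1 k)
    have "\<not> suffix (bar x # pw k (blk e (bar x))) B" using J(1) suf unfolding JL_def e_def by blast
    then obtain w1 where w1: "w1 \<noteq> []" "bar x # pw k (blk e (bar x)) = w1 @ B" "suffix w1 m"
      using suffix_app_cases[OF 1] by blast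
    show ?thesis
    proof (cases "B = []")
      case B: True
      show ?thesis
      proof (cases "k = 0")
        case True
        then have "w1 = [bar x]" using w1(2) B by simp
        then have "last m = bar x" using lastw[OF w1(1,3)] by simp
        then have "D = 2 * int g - 1" using mu d D gi by (auto simp: bar_s[of d] s_eq8)
        then have "D + 2 * int g = 4 * int g - 1" by linarith
        then have "y = s d x (4 * int g - 1)" using y by (simp only:)
        then have yy: "y = s d x (- 1)" using s_period[OF d, of "4 * int g - 1" "- 1" x] by simp
        then have "s d y 1 = x" using x by simp
        then show ?thesis using N yy JL_last[OF J(1)] JR_hd[OF J(2)] B ne by auto
      next
        case False
        then have "last m = s e (bar x) (2 * int g - 1)" using w1 B lastw by (metis append_Nil2 last_ConsR last_pw pw_eq_Nil blk_neq_Nil last_blk neq0_conv)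
        then have "s d x (D + 4 * int g + 1) = s d x 1" using mu d by (simp add: e_def s_uminus)
        then have "D = 0" using d D gi by (auto simp: s_eq8)
        then have "y = bar x" using y d by (simp add: bar_s)
        then show ?thesis using N x JL_last[OF J(1)] JR_hd[OF J(2)] B ne by auto
      qed
    next
      case B: False
      have hv: "hd B \<noteq> bar y" using JR_hd[OF J(2)] B by simp
      have "s e (last w1) 1 = bar y" using lastw[OF w1(1,3)] m(3) d by (simp add: e_def s_uminus bar_s[of d])
      then have "hd B \<noteq> s e (last w1) 1" using hv by simp
      from blk_break[OF e _ w1(2) w1(1) B this] obtain k1 k2 where k: "1 \<le> k1" "w1 = bar x # pw k1 (blk e (bar x))"
        "B = pw k2 (blk e (bar x))" by auto
      have "last m = s e (bar x) (2 * int g - 1)" using k lastw[OF w1(1,3)] by simp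
      then have "s d x (D + 4 * int g + 1) = s d x 1" using mu d by (simp add: e_def s_uminus)
      then have "D = 0" using d D gi by (auto simp: s_eq8)
      then have yb: "y = bar x" using y d by (simp add: bar_s)
      from N show ?thesis
      proof
        assume "last P = y"
        then have "P @ B = butlast P @ (bar x # pw k2 (blk e (bar x)))" using Psplit k yb by simp
        then have "suffix (bar x # pw k2 (blk e (bar x))) (P @ B)" unfolding suffix_def by blast
        then show False using J(1) unfolding JL_def e_def by blast
      next
        assume "hd R = x"
        then have "R = bar y # R'" using R yb x by simp
        then have "mir (B @ R) = mir R' @ (bar (neg y) # mir (pw k2 (blk e y)))" using k yb by simp
        also have "mir (pw k2 (blk e y)) = pw k2 (blk (- d) (bar (neg y)))" using d by (simp add: mir_pw mir_blk e_def)
        finally have "suffix (bar (neg y) # pw k2 (blk (- d) (bar (neg y)))) (mir (B @ R))" unfolding suffix_def by blast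
        then show False using J(2) unfolding JR_def JL_def by blast
      qed
    qed
  next
    case (2 k)
    define z where "z = s d x (- 1)"
    have "\<not> suffix (z # pw k (blk d z)) B" using J(1) suf unfolding JL_def z_def by blast
    then obtain w1 where w1: "w1 \<noteq> []" "z # pw k (blk d z) = w1 @ B" "suffix w1 m"
      using suffix_app_cases[OF 2[folded z_def]] by blast
    have "successively (adj d) (w1 @ B)" using succ_pw[OF d, of z k] w1(2) z_def by simp
    then have "successively (adj d) w1" by (simp add: successively_append_iff)
    then have "\<not> 2 \<le> length w1" using no_mixed_pair[OF d w1(3)] m(2) by blast
    then obtain a where "w1 = [a]" using w1(1) by (cases w1; cases "tl w1") auto
    then have "last m = z" using w1(2) lastw[OF w1(1,3)] by simp
    then have "s d x (D + 4 * int g + 1) = s d x (- 1)" using mu z_def by simp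
    then show ?thesis using d D gi by (auto simp: s_eq8)
  next
    case 3
    have "\<not> suffix (run d x (2 * g - 1)) B" using J(1) 3(1) suf unfolding JL_def by blast
    then obtain w1 where w1: "w1 \<noteq> []" "run d x (2 * g - 1) = w1 @ B" "suffix w1 m"
      using suffix_app_cases[OF 3(2)] by blast
    have "successively (adj d) (w1 @ B)" using succ_run[OF d, of x "2 * g - 1"] w1(2) by simp
    then have "successively (adj d) w1" by (simp add: successively_append_iff)
    then have "\<not> 2 \<le> length w1" using no_mixed_pair[OF d w1(3)] m(2) by blast
    then obtain a where a: "w1 = [a]" using w1(1) by (cases w1; cases "tl w1") auto
    obtain n where n: "2 * g - 1 = Suc n" "n = 2 * g - 2" using g2 by simp
    have "run d x (2 * g - 1) = x # run d (s d x 1) (2 * g - 2)" using run_Suc[OF x, of d n] n by simp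
    then have "x # run d (s d x 1) (2 * g - 2) = a # B" using w1(2) a by (metis append_Cons append_Nil)
    then have "a = x \<and> B = run d (s d x 1) (2 * g - 2)" by (metis list.inject)
    then have "a = x" "B = run d (s d x 1) (2 * g - 2)" by blast+
    moreover have "a = s d x (D + 4 * int g + 1)" using lastw[OF w1(1,3)] a mu by simp
    ultimately have "s d x (D + 4 * int g + 1) = s d x 0" using x by simp
    then have "D = - 1" using d D gi by (auto simp: s_eq8)
    then show ?thesis using c 3(1) \<open>B = _\<close> by blast
  qed
qed

lemma chain_shape:
  assumes d: "dir d" and f: "inr f" and l: "inr l" and m: "midok (- d) f mid l"
    and p: "p = [f] \<or> p = [] \<and> 1 \<le> i" and q: "q = [l] \<or> q = [] \<and> 1 \<le> j"
    and md: "md = p @ pw i (blk (- d) f) @ mid @ pw j (blk (- d) (bar l)) @ q"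
  shows "2 \<le> length md" "successively (stp (- d)) md"
    "hd md = (if p = [f] then f else s d f (- 1))" "last md = (if q = [l] then l else s d l 1)"
proof -
  have e: "dir (- d)" using d by simp
  have "successively (stp (- d)) ([f] @ pw i (blk (- d) f) @ mid @ pw j (blk (- d) (bar l)) @ [l])"
    using chain_succ[OF e f l m, of i j] by simp
  moreover have "sublist md ([f] @ pw i (blk (- d) f) @ mid @ pw j (blk (- d) (bar l)) @ [l])"
  proof -
    have "\<exists>r1. [f] = r1 @ p" "\<exists>r2. [l] = q @ r2" using p q by auto
    then obtain r1 r2 where "[f] = r1 @ p" "[l] = q @ r2" by blast
    then have "[f] @ pw i (blk (- d) f) @ mid @ pw j (blk (- d) (bar l)) @ [l] = r1 @ md @ r2" using md by simp
    then show ?thesis unfolding sublist_def by blast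
  qed
  ultimately show "successively (stp (- d)) md" using successively_sublist by blast
  have li: "1 \<le> k \<Longrightarrow> 3 \<le> length (pw k (blk e z))" for k e z
  proof -
    assume "1 \<le> k"
    then have "2 * g - 1 \<le> k * (2 * g - 1)" by simp
    moreover have "3 \<le> 2 * g - 1" using g2 by simp
    ultimately have "3 \<le> k * (2 * g - 1)" by (rule order_trans[rotated])
    then show ?thesis by simp
  qed
  show "2 \<le> length md" using p q li[of i "- d" f] li[of j "- d" "bar l"] unfolding md by auto
  show "hd md = (if p = [f] then f else s d f (- 1))"
    using p unfolding md by (auto simp: hd_append s_uminus)
  have "s (- d) (bar l) (2 * int g - 1) = s d l 1"
    using d by (simp add: s_uminus)
  then show "last md = (if q = [l] then l else s d l 1)"
    using q unfolding md by (auto simp: last_append)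
qed

lemma glue_both:
  assumes d: "dir d" and x: "inr x" and y: "inr y" and J: "JL d u x" "JR d v y"
    and L: "L u" "L v" "L w" and w: "2 \<le> length w" "successively (stp (- d)) w"
      "hd w = s d x (2 * int g - 1)" "last w = s d y (2 * int g + 1)"
  shows "L (u @ w @ v)"
proof -
  obtain w2 ws where w1: "w = s d x (2 * int g - 1) # w2 # ws"
    using w(1,3) by (cases w; cases "tl w") auto
  have n1: "\<not> adj d (s d x (2 * int g - 1)) w2"
    using w(2) stp_nadj[of "- d" "s d x (2 * int g - 1)" w2] d unfolding w1 by simp
  obtain us u2 where w3: "w = us @ [u2, s d y (2 * int g + 1)]"
  proof -
    have "w = butlast w @ [last w]" "butlast w \<noteq> []" using w(1) by (cases w; cases "tl w"; auto)+
    then have "w = butlast (butlast w) @ [last (butlast w), last w]"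
      by (metis append.assoc append_Cons append_Nil append_butlast_last_id)
    then show ?thesis using that w(4) by metis
  qed
  have n2: "\<not> adj d u2 (s d y (2 * int g + 1))"
    using w(2) stp_nadj[of "- d" u2 "s d y (2 * int g + 1)"] d unfolding w3 by (simp add: successively_append_iff)
  have "L (w @ v)" by (rule JR_glue[OF d y L(3) L(2) w3 n2 J(2)])
  then show ?thesis using JL_glue[OF d x L(1), of "w @ v" w2 "ws @ v"] w1 n1 J(1) by simp
qed

lemma glue_self:
  assumes d: "dir d" and x: "inr x" and J: "JL d u x" and L: "L u" "L w"
    and w: "2 \<le> length w" "successively (stp (- d)) w" "hd w = s d x (2 * int g - 1)" "prefix w w'" "L w'"
  shows "L (u @ w')"
proof -
  obtain w2 ws where w1: "w = s d x (2 * int g - 1) # w2 # ws"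
    using w(1,3) by (cases w; cases "tl w") auto
  have n1: "\<not> adj d (s d x (2 * int g - 1)) w2"
    using w(2) stp_nadj[of "- d" "s d x (2 * int g - 1)" w2] d unfolding w1 by simp
  obtain r where "w' = s d x (2 * int g - 1) # w2 # (ws @ r)" using w(4) w1 by (auto simp: prefix_def)
  then show ?thesis using JL_glue[OF d x L(1) w(5) _ n1 J] by blast
qed

section \<open>Annular strips\<close>

definition rs :: "int \<Rightarrow> int \<Rightarrow> int list \<Rightarrow> bool" where
  "rs e f w \<longleftrightarrow> (\<forall>b. inr b \<longrightarrow> sublist (run e b (2 * g)) w \<longrightarrow> b = f)"

lemma rs_norun: "norun e w \<Longrightarrow> rs e f w"
  by (simp add: rs_def norun_def)

lemma rs_glue:
  assumes "dir e" "rs e f u" "rs e f v" "u = [] \<or> v = [] \<or> hd v \<noteq> s e (last u) 1"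
  shows "rs e f (u @ v)"
  unfolding rs_def
proof (intro allI impI)
  fix b assume b: "inr b" "sublist (run e b (2 * g)) (u @ v)"
  then have "sublist (run e b (2 * g)) u \<or> sublist (run e b (2 * g)) v"
    using g2 assms(1,4) by (intro run_glue) simp_all
  then show "b = f" using assms(2,3) b(1) unfolding rs_def by blast
qed

lemma rs_Cons: "rs e f w \<Longrightarrow> rs e f (f # w)"
  unfolding rs_def
proof (intro allI impI)
  fix b assume w: "\<forall>b. inr b \<longrightarrow> sublist (run e b (2 * g)) w \<longrightarrow> b = f" and b: "inr b" "sublist (run e b (2 * g)) (f # w)"
  have "prefix (run e b (2 * g)) (f # w) \<Longrightarrow> b = f"
    using prefix_hd[of "run e b (2 * g)" "f # w"] g2 b(1) by simp
  then show "b = f" using sublist_ConsD[OF b(2)] w b(1) by blast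
qed

lemma rs_snoc:
  assumes "dir e" "rs e f w" "inr x" "f = s e x (1 - 2 * int g)" shows "rs e f (w @ [x])"
  unfolding rs_def
proof (intro allI impI)
  fix b assume b: "inr b" "sublist (run e b (2 * g)) (w @ [x])"
  have "b = f" if "suffix (run e b (2 * g)) (w @ [x])"
  proof -
    have "x = s e b (2 * int g - 1)" using suffix_last[OF that] g2 by simp
    then show ?thesis using assms(4) b(1) by simp
  qed
  then show "b = f" using sublist_snocD[OF b(2)] assms(2) b(1) unfolding rs_def by blast
qed

text \<open>Relaxes \<open>norun\<close>: half relators may start at \<open>f\<close> only, and that
  half is good. A forbidden factor would have to be longer and contain a second half, starting at
  \<open>s e f 1\<close>.\<close>

lemma rs_L:
  assumes e: "dir e" and w: "W w" "successively (stp e) w" "rs e f w" and f: "\<not> bad e f"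
  shows "L w"
proof (rule desc_L[OF e w(1,2)])
  fix fw assume fb: "forbd e fw"
  obtain b r where b0: "inr b \<and> fw = run e b (2 * g) @ r \<and> hd fw = b \<and> (r = [] \<longrightarrow> bad e b) \<and>
    (r \<noteq> [] \<longrightarrow> last fw = bar b \<and> (\<exists>r'. r' \<noteq> [] \<and> fw = r' @ run e (s e b 1) (2 * g)))"
    using forbd_start[OF e fb] by (elim exE)
  show "\<not> sublist fw w"
  proof
    assume sf: "sublist fw w"
    have "sublist (run e b (2 * g)) fw" using b0 by (metis sublist_append_rightI)
    then have bf: "b = f" using w(3) b0 sublist_order.order_trans[OF _ sf] unfolding rs_def by blast
    then have "r \<noteq> []" using b0 f by blast
    then obtain r' where "fw = r' @ run e (s e b 1) (2 * g)" using b0 by blast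
    then have "sublist (run e (s e b 1) (2 * g)) fw" by (metis sublist_append_leftI)
    then have "s e b 1 = f" using w(3) sublist_order.order_trans[OF _ sf] unfolding rs_def by (meson inr_s)
    then show False using bf b0 e gi eq_s_self8[of b e 1] by auto
  qed
qed

text \<open>The only configuration in which the strips on the left and on the right share their last cell, so that
  the powers close up to an annulus of cells. It is the reason for the second rotation.\<close>

lemma annular:
  fixes d x :: int and i j :: nat
  defines "f \<equiv> s d x (2 * int g - 1)"
  defines "M0 \<equiv> pw i (blk (- d) f) @ run (- d) (s (- d) f 1) (2 * g - 2) @ pw j (blk (- d) (bar x))"
  defines "Wd \<equiv> M0 @ run (- d) f (2 * g)"
  assumes d: "dir d" and x: "inr x" and b: "bad d x"
  shows "L (f # pw k Wd @ M0 @ [x])" "successively (stp (- d)) (f # pw k Wd @ M0 @ [x])" "L (Wd @ Wd)"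
proof -
  define e where "e = - d"
  have e: "dir e" using d by (simp add: e_def)
  define F where "F = run e f (2 * g)"
  define mid where "mid = run e (s e f 1) (2 * g - 2)"
  have f: "inr f" by (simp add: f_def)
  have xf: "x = s e f (2 * int g - 1)" "f = s e x (1 - 2 * int g)" using x by (simp_all add: f_def e_def s_uminus)
  have fm: "f # mid @ [x] = F"
  proof -
    obtain n where n: "2 * g - 1 = Suc n" "n = 2 * g - 2" "int n = 2 * int g - 2" using g2 by simp
    have "run e (s e f 1) (2 * g - 1) = mid @ [x]"
      using run_Suc2[of e "s e f 1" n] n xf(1) by (simp add: mid_def)
    then show ?thesis using Cons_blk[OF f, of e] by (simp add: blk_def F_def)
  qed
  have midne: "mid \<noteq> []" using g2 by (simp add: mid_def)
  have midlast: "last mid = s d x 1" "hd mid = s e f 1"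
    using g2 by (simp_all add: mid_def of_nat_diff e_def s_uminus f_def)
  have mok: "midok e f mid x"
    unfolding midok_def using succ_stp_run[OF e, of f "2 * g"] fm midne midlast W_run x
    by (simp add: F_def mid_def e_def s_uminus)
  have M: "M0 = pw i (blk e f) @ mid @ pw j (blk e (bar x))" by (simp add: M0_def e_def mid_def)
  have nm: "norun e mid" using g2 by (intro norun_short) (simp add: mid_def)
  have nM: "norun e M0" unfolding M by (rule chain_norun(1)[OF e f x mok nm])
  have sM: "successively (stp e) (f # M0 @ [x])" using chain_succ[OF e f x mok, of i j] by (simp add: M)
  have M0ne: "M0 \<noteq> []" using midne by (simp add: M)
  have Mends: "hd M0 = s e f 1" "last M0 = s d x 1"
  proof -
    show "hd M0 = s e f 1" using midne midlast by (cases "i = 0") (simp_all add: M hd_append)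
    have "s e (bar x) (2 * int g - 1) = s d x 1" using d by (simp add: e_def s_uminus)
    then show "last M0 = s d x 1" using midne midlast by (cases "j = 0") (simp_all add: M last_append)
  qed
  have WM: "W M0" using W_pw[OF W_blk] W_run by (auto simp: M mid_def)
  have Fends: "F \<noteq> []" "hd F = f" "last F = x" "W F" using g2 f W_run xf(1)[symmetric] by (simp_all add: F_def)
  have sF: "successively (stp e) F" using succ_stp_run[OF e] by (simp add: F_def)
  have rF: "rs e f F"
  proof -
    have "rs e f mid" using nm by (rule rs_norun)
    then have "rs e f (mid @ [x])" by (rule rs_snoc[OF e _ x xf(2)])
    then have "rs e f (f # mid @ [x])" by (rule rs_Cons)
    then show ?thesis by (simp add: fm)
  qed
  have jMF: "f \<noteq> s e (last M0) 1" "stp e (last M0) f"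
  proof -
    have "s e (last M0) 1 = s d x 0" by (simp add: Mends e_def s_uminus)
    then show "f \<noteq> s e (last M0) 1" using d gi by (simp add: f_def s_eq8)
    have "s d x (2 * int g - 1) = s d x (- 1 - 2 * int g)" using d gi by (simp add: s_eq8)
    then show "stp e (last M0) f" by (simp add: Mends e_def s_uminus stp_def f_def)
  qed
  have jFM: "hd M0 \<noteq> s e (last F) 1" "stp e (last F) (hd M0)"
  proof -
    have h: "hd M0 = s d x (2 * int g - 2)" by (simp add: Mends e_def s_uminus f_def)
    then show "hd M0 \<noteq> s e (last F) 1" using d gi Fends by (simp add: e_def s_uminus s_eq8)
    have "s d x (2 * int g - 2) = s d x (- (2 * int g) - 2)" using d gi by (simp add: s_eq8)
    then show "stp e (last F) (hd M0)" using h Fends by (simp add: e_def s_uminus stp_def)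
  qed
  \<comment> \<open>Regrouping the powers of \<open>Wd = M0 @ F\<close> into powers of
    \<open>F @ M0\<close> lets the induction prepend one period at a time, always in front of the
    half \<open>F\<close>.\<close>
  define T where "T = (\<lambda>n. pw n (F @ M0) @ F @ M0 @ [x])"
  have T: "rs e f (T n) \<and> successively (stp e) (T n) \<and> hd (T n) = f \<and> T n \<noteq> [] \<and> W (T n)" for n
  proof (induction n)
    case 0
    have "rs e f (F @ (M0 @ [x]))"
      using rs_glue[OF e rF rs_snoc[OF e rs_norun[OF nM] x xf(2)]] jFM M0ne by (auto simp: hd_append)
    moreover have "successively (stp e) (F @ (M0 @ [x]))"
      using succ_append[OF sF, of "M0 @ [x]"] sM jFM M0ne by (auto simp: hd_append successively_Cons split: if_splits)
    ultimately show ?case using Fends WM x by (auto simp: T_def hd_append)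
  next
    case (Suc n)
    have e1: "T (Suc n) = F @ (M0 @ T n)" by (simp add: T_def)
    have "rs e f (M0 @ T n)" using rs_glue[OF e rs_norun[OF nM], of f "T n"] Suc jMF by auto
    then have "rs e f (F @ (M0 @ T n))" using rs_glue[OF e rF] jFM M0ne by (auto simp: hd_append)
    moreover have "successively (stp e) M0" using sM by (auto simp: successively_append_iff successively_Cons)
    then have "successively (stp e) (M0 @ T n)" using succ_append[of "stp e" M0 "T n"] Suc jMF by auto
    then have "successively (stp e) (F @ (M0 @ T n))" using succ_append[OF sF] jFM M0ne by (auto simp: hd_append)
    ultimately show ?case unfolding e1 using Fends WM Suc by (auto simp: hd_append)
  qed
  have swap: "pw n (M0 @ F) @ M0 = M0 @ pw n (F @ M0)" for n by (induction n) auto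
  have Z: "rs e f (f # pw k Wd @ M0 @ [x]) \<and> successively (stp e) (f # pw k Wd @ M0 @ [x]) \<and> W (f # pw k Wd @ M0 @ [x])" for k
  proof (cases k)
    case 0
    have "rs e f (f # (M0 @ [x]))" by (intro rs_Cons rs_snoc[OF e _ x xf(2)] rs_norun nM)
    then show ?thesis using 0 sM WM f x by auto
  next
    case (Suc n)
    have "pw k Wd @ M0 @ [x] = (pw k (M0 @ F) @ M0) @ [x]" by (simp add: Wd_def F_def e_def)
    also have "\<dots> = M0 @ pw n (F @ M0) @ F @ M0 @ [x]" unfolding swap using Suc pw_Suc2[of n "F @ M0"] by simp
    finally have eq: "f # pw k Wd @ M0 @ [x] = (f # M0) @ T n" by (simp add: T_def)
    have "rs e f ((f # M0) @ T n)" using rs_glue[OF e rs_Cons[OF rs_norun[OF nM]]] T[of n] jMF M0ne by auto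
    moreover have "successively (stp e) (f # M0)"
      using sM successively_append_iff[of "stp e" "f # M0" "[x]"] by simp
    then have "successively (stp e) ((f # M0) @ T n)" using succ_append[of "stp e" "f # M0" "T n"] T[of n] jMF M0ne by auto
    ultimately show ?thesis unfolding eq using T[of n] WM f by auto
  qed
  have nb: "\<not> bad e f" using bad_compl[OF d x] b by (simp add: e_def f_def)
  have LZ: "L (f # pw k Wd @ M0 @ [x])" for k using rs_L[OF e _ _ _ nb] Z[of k] by blast
  then show "L (f # pw k Wd @ M0 @ [x])" .
  show "successively (stp (- d)) (f # pw k Wd @ M0 @ [x])" using Z[of k] e_def by simp
  have "f # pw 2 Wd @ M0 @ [x] = [f] @ (Wd @ Wd) @ (M0 @ [x])" by (simp add: numeral_2_eq_2)
  then show "L (Wd @ Wd)" using LZ[of 2] L_factor by metis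
qed

text \<open>The two ways in which a reduced junction \<open>m\<close> yields the normal forms of all powers: \<open>m @ B\<close> is
  cyclically reduced, or (\<open>flippable\<close>) becomes so after rotating one letter and reducing again.\<close>

definition loopable :: "int list \<Rightarrow> int list \<Rightarrow> int list \<Rightarrow> int list \<Rightarrow> bool" where
  "loopable P B R m \<longleftrightarrow> L ((m @ B) @ (m @ B)) \<and> (\<forall>k. L (P @ B @ pw (Suc k) (m @ B) @ R))"

definition flippable :: "int list \<Rightarrow> int list \<Rightarrow> int list \<Rightarrow> int list \<Rightarrow> bool" where
  "flippable P B R m \<longleftrightarrow> (\<exists>a n V. m = a # n \<and> eqv (n @ B @ [a]) V \<and> L (V @ V) \<and>
     length V = length (m @ B) \<and> (\<forall>k. L (P @ B @ a # pw k V @ n @ B @ R)))"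

text \<open>The junction \<open>C' @ [c] @ A'\<close> has the other side
  \<open>f # mid @ [l]\<close>. Its strip is extended by \<open>Lw\<close> to the left and by
  \<open>Rw\<close> to the right; the conditions on the letters next to \<open>B0\<close> confine
  both extensions to \<open>B0\<close> and keep them disjoint. With \<open>B\<close> the rest of
  \<open>B0\<close>, \<open>JL_mB\<close> separates the loopable case from the annular one.\<close>

lemma outcome_core:
  fixes d x y D :: int and U A' B0 C' V mid :: "int list"
  defines "f \<equiv> s d x (2 * int g - 1)" and "l \<equiv> s d y (2 * int g + 1)"
  assumes d: "dir d" and x: "inr x" and y: "y = s d x (D + 2 * int g)" and D: "- 1 \<le> D" "D \<le> 2 * int g - 3"
    and LX: "L (U @ A' @ B0 @ C' @ V)"
    and mok: "midok (- d) f mid l"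
    and c2: "norun (- d) (f # mid @ [l]) \<and> D \<noteq> - 1 \<or>
      (mid = run (- d) (s (- d) f 1) (2 * g - 2) \<and> bad d x \<and> D = - 1)"
    and eqm: "eqv (C' @ [c] @ A') (f # mid @ [l])"
    and wL: "weak d (U @ A' @ B0) x" and nL: "\<not> suffix [s d x (- 1)] (U @ A' @ B0)"
    and wR: "weak d (mir (B0 @ C' @ V)) (neg y)" and nR: "\<not> prefix [s d y 1] (B0 @ C' @ V)"
    and a0: "U @ A' \<noteq> []" "last (U @ A') = y \<or> (A' = [] \<and> last (U @ A') = s d y (2 * int g - 1))"
    and a1: "hd (B0 @ C' @ V) \<noteq> s d (last (U @ A')) 1"
    and g0: "C' @ V \<noteq> []" "hd (C' @ V) = x \<or> (C' = [] \<and> hd (C' @ V) = s d x (2 * int g + 1))"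
    and g1: "last (U @ A' @ B0) \<noteq> s d (hd (C' @ V)) (- 1)"
    and ne: "A' \<noteq> [] \<or> C' \<noteq> []"
  shows "\<exists>A2 B C2 m. A' @ B0 @ C' = A2 @ B @ C2 \<and> eqv (C2 @ [c] @ A2) m \<and> L m \<and> m \<noteq> [] \<and>
    (loopable (U @ A2) B (C2 @ V) m \<or> flippable (U @ A2) B (C2 @ V) m)"
proof -
  have f: "inr f" and l: "inr l" and iy: "inr y" by (simp_all add: f_def l_def y)
  have bf: "bar f = s d x (- 1)" using d s_period[OF d, of "4 * int g - 1" "- 1" x] by (simp add: f_def)
  have bl: "bar l = s d y 1" using d s_period[OF d, of "4 * int g + 1" 1 y] by (simp add: l_def)
  have fx: "s d f (1 - 2 * int g) = x" using x by (simp add: f_def)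
  have ly: "s d l (2 * int g - 1) = y" using iy s_period[OF d, of "4 * int g" 0 y] by (simp add: l_def)
  have lx: "l = s d x (D + 4 * int g + 1)" by (simp add: l_def y algebra_simps)
  have c4: "l \<noteq> bar f" unfolding lx bf using d D gi by (simp add: s_eq8)
  have LU: "L (U @ A' @ B0)" using LX L_app1[of "U @ A' @ B0" "C' @ V"] by simp
  have LV: "L (B0 @ C' @ V)" using LX L_app2[of "U @ A'" "B0 @ C' @ V"] by simp
  from left_ext[OF d f LU] obtain u Lw \<kappa> p i where
    le: "U @ A' @ B0 = u @ Lw" "JL d u \<kappa>" "inr \<kappa>" "eqv (Lw @ [f]) (p @ pw i (blk (- d) f))"
    and lf: "(\<kappa> = x \<and> Lw = pw i (blk d (bar f)) \<and> p = [f] \<and> (i = 0 \<or> bad d x)) \<or>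
      (\<kappa> = bar f \<and> Lw = bar f # pw i (blk d (bar f)) \<and> p = [] \<and> 1 \<le> i)"
    using wL nL unfolding fx bf by metis
  from right_ext[OF d l LV] obtain v Rw \<mu> q j where
    re: "B0 @ C' @ V = Rw @ v" "JR d v \<mu>" "inr \<mu>" "eqv ([l] @ Rw) (pw j (blk (- d) (bar l)) @ q)"
    and rf: "(\<mu> = y \<and> Rw = pw j (blk d l) \<and> q = [l] \<and> (j = 0 \<or> bad d l)) \<or>
      (\<mu> = bar l \<and> Rw = pw j (blk d l) @ [bar l] \<and> q = [] \<and> 1 \<le> j)"
    using wR nR unfolding ly bl by metis
  have lform: "Lw = pw i (blk d (bar f)) \<or> (Lw = bar f # pw i (blk d (bar f)) \<and> 1 \<le> i)" using lf by auto
  have rform: "Rw = pw j (blk d l) \<or> (Rw = pw j (blk d l) @ [bar l] \<and> 1 \<le> j)" using rf by auto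
  have zend: "s d (bar f) (2 * int g - 1) = s d x (2 * int g - 2)" using bf by simp
  have lend: "s d l 1 = s d x (D + 2)" using lx d gi D by (simp add: s_eq8)
  have lastRw: "Rw \<noteq> [] \<Longrightarrow> last Rw = \<mu>"
    using rf ly by auto
  have hdLw: "Lw \<noteq> [] \<Longrightarrow> hd Lw = \<kappa>"
    using lf x s_period[OF d, of "2 * int g + 1" "1 - 2 * int g" f] d fx by (auto simp: bar_s[of d] add.commute)
  \<comment> \<open>If \<open>Lw\<close> reached beyond \<open>B0\<close>, the last letter of
    \<open>U @ A'\<close> would end a block and have offset \<open>2 * g - 2\<close> from
    \<open>x\<close>. By \<open>a0\<close> its offset is \<open>D + 2 * g\<close> or
    \<open>D + 4 * g - 1\<close>, which the bounds on \<open>D\<close> separate from that.\<close>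
  have "\<exists>B1. B0 = B1 @ Lw"
  proof -
    have "(U @ A') @ B0 = u @ Lw" using le(1) by simp
    then obtain us where us: "U @ A' = u @ us \<and> us @ B0 = Lw \<or> (U @ A') @ us = u \<and> B0 = us @ Lw"
      using append_eq_append_conv2[of "U @ A'" B0 u Lw] by blast
    show ?thesis
    proof (rule ccontr)
      assume c: "\<not> ?thesis"
      then have u1: "U @ A' = u @ us" "us @ B0 = Lw" "us \<noteq> []" using us by auto
      define a where "a = last (U @ A')"
      have "us = butlast us @ [a]" using u1(1,3) by (simp add: a_def)
      then have "Lw = butlast us @ [a] @ B0" using u1(2) by (metis append.assoc)
      moreover have "B0 \<noteq> [] \<Longrightarrow> hd B0 \<noteq> s d a 1" using a1 by (simp add: a_def hd_append)
      ultimately have "a = s d x (2 * int g - 2)" using reach[OF d _ lform, of "butlast us" a B0] zend by simp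
      moreover have "a = s d x (D + 2 * int g) \<or> a = s d x (D + 4 * int g - 1)"
        using a0(2) y by (auto simp: a_def algebra_simps)
      ultimately show False using d gi D by (auto simp: s_eq8)
    qed
  qed
  then obtain B1 where B1: "B0 = B1 @ Lw" by blast
  have "\<exists>B2. B0 = Rw @ B2"
  proof -
    have "B0 @ (C' @ V) = Rw @ v" using re(1) by simp
    then obtain us where us: "B0 = Rw @ us \<and> us @ (C' @ V) = v \<or> B0 @ us = Rw \<and> C' @ V = us @ v"
      using append_eq_append_conv2[of B0 "C' @ V" Rw v] by blast
    show ?thesis
    proof (rule ccontr)
      assume c: "\<not> ?thesis"
      then have u1: "C' @ V = us @ v" "Rw = B0 @ us" "us \<noteq> []" using us by auto
      define a where "a = hd (C' @ V)"
      have "us = [a] @ tl us" using u1(1,3) by (cases us) (auto simp: a_def)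
      then have "Rw = B0 @ [a] @ tl us" using u1(2) by metis
      moreover have "a \<noteq> s d (last B0) 1" if "B0 \<noteq> []"
      proof
        assume "a = s d (last B0) 1"
        moreover have "inr (last B0)" using that LV by (simp add: L_def)
        ultimately have "last B0 = s d a (- 1)" by simp
        then show False using g1 that by (simp add: a_def last_append)
      qed
      ultimately have "a = s d x (D + 2)" using reach_right[OF d l rform, of B0 a "tl us"] lend by simp
      moreover have "a = s d x 0 \<or> a = s d x (2 * int g + 1)"
        using g0(2) x by (auto simp: a_def)
      ultimately show False using d gi D by (auto simp: s_eq8)
    qed
  qed
  then obtain B2 where B2: "B0 = Rw @ B2" by blast
  have v: "v = B2 @ C' @ V" using re(1) B2 by simp
  have u: "u = U @ A' @ B1" using le(1) B1 by simp
  have muval: "\<mu> = s d x (D + 2 * int g) \<or> \<mu> = s d x (D + 2 * int g + 1)"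
    using rf y bl by auto
  have vne: "v \<noteq> []" using v g0(1) by simp
  \<comment> \<open>The two extensions are disjoint: otherwise \<mu>, the last letter of
    \<open>Rw\<close>, would end a block of the left one, which its residue forbids.\<close>
  have "\<exists>B. B1 = Rw @ B"
  proof -
    have "B1 @ Lw = Rw @ B2" using B1 B2 by simp
    then obtain us where us: "B1 = Rw @ us \<and> us @ Lw = B2 \<or> B1 @ us = Rw \<and> Lw = us @ B2"
      using append_eq_append_conv2[of B1 Lw Rw B2] by blast
    show ?thesis
    proof (rule ccontr)
      assume c: "\<not> ?thesis"
      then have u1: "Rw = B1 @ us" "Lw = us @ B2" "us \<noteq> []" using us by auto
      have "last us = \<mu>" using lastRw u1 by auto
      then have "us = butlast us @ [\<mu>]" using u1(3) by (metis append_butlast_last_id)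
      then have "Lw = butlast us @ [\<mu>] @ B2" using u1(2) by (metis append.assoc)
      moreover have "B2 \<noteq> [] \<Longrightarrow> hd B2 \<noteq> s d \<mu> 1" using JR_hd[OF re(2) vne] v by (simp add: hd_append)
      ultimately have "\<mu> = s d x (2 * int g - 2)" using reach[OF d _ lform, of "butlast us" \<mu> B2] zend by simp
      then show False using muval d gi D by (auto simp: s_eq8)
    qed
  qed
  then obtain B where B: "B1 = Rw @ B" by blast
  have B2': "B2 = B @ Lw" using B1 B2 B by simp
  define P where "P = U @ A' @ Rw"
  define R where "R = Lw @ C' @ V"
  have u': "u = P @ B" using u B by (simp add: P_def)
  have v': "v = B @ R" using v B2' by (simp add: R_def)
  define m where "m = p @ pw i (blk (- d) f) @ mid @ pw j (blk (- d) (bar l)) @ q"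
  have pp: "p = [f] \<and> (i = 0 \<or> bad d x) \<or> p = [] \<and> 1 \<le> i" using lf by auto
  have qq: "q = [l] \<and> (j = 0 \<or> bad d l) \<or> q = [] \<and> 1 \<le> j" using rf by auto
  have lx1: "D = - 1 \<Longrightarrow> l = x"
    using lx x s_period[OF d, of "4 * int g" 0 x] by simp
  have c2': "norun (- d) (f # mid @ [l]) \<or>
      (f # mid @ [l] = run (- d) f (2 * g) \<and> bad d (s d f (1 - 2 * int g)) \<and> bad d l)"
    using c2
  proof
    assume a: "mid = run (- d) (s (- d) f 1) (2 * g - 2) \<and> bad d x \<and> D = - 1"
    then have "l = x" using lx1 by simp
    obtain n where n: "2 * g - 1 = Suc n" "n = 2 * g - 2" "int n = 2 * int g - 2" using g2 by simp
    have "x = s (- d) f (2 * int g - 1)" using x by (simp add: f_def s_uminus)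
    then have "run (- d) (s (- d) f 1) (2 * g - 1) = mid @ [l]"
      using run_Suc2[of "- d" "s (- d) f 1" n] n a \<open>l = x\<close> by simp
    then have "f # mid @ [l] = run (- d) f (2 * g)" using Cons_blk[OF f, of "- d"] by (simp add: blk_def)
    then show ?thesis using a \<open>l = x\<close> fx by simp
  qed simp
  have Lm: "L m" unfolding m_def by (rule chain_L(2)[OF d f l mok c2' c4]) (use pp qq fx in auto)
  have pq: "p = [f] \<or> p = [] \<and> 1 \<le> i" "q = [l] \<or> q = [] \<and> 1 \<le> j" using pp qq by auto
  note sh = chain_shape[OF d f l mok pq m_def]
  have hm: "hd m = s d \<kappa> (2 * int g - 1)"
    using sh(3) lf bf by (auto simp: f_def)
  have lm: "last m = s d \<mu> (2 * int g + 1)"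
    using sh(4) rf bl by (auto simp: l_def)
  have eqm2: "eqv ((Lw @ C') @ [c] @ (A' @ Rw)) m"
  proof -
    have WL: "W Lw" "W Rw" using le(1) re(1) LU LV by (auto simp: L_def)
    have Wm: "W mid" using mok by (simp add: midok_def)
    have "eqv (Lw @ (C' @ [c] @ A') @ Rw) (Lw @ (f # mid @ [l]) @ Rw)" by (rule eqv_ctx[OF WL eqm])
    moreover have "eqv ((Lw @ [f]) @ mid @ ([l] @ Rw)) ((p @ pw i (blk (- d) f)) @ mid @ (pw j (blk (- d) (bar l)) @ q))"
      by (intro eqv_app le(4) re(4) eqv_refl Wm)
    ultimately show ?thesis using eqv_trans unfolding m_def by simp
  qed
  \<comment> \<open>The offset after extension: an end letter absorbed by cancellation moves the
    corresponding border by one, so each of \<open>p = []\<close> and \<open>q = []\<close> adds one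
    to \<open>D\<close>.\<close>
  define E where "E = D + (if p = [] then 1 else 0) + (if q = [] then 1 else 0)"
  have mk: "\<mu> = s d \<kappa> (E + 2 * int g)"
    using lf rf bf bl y by (auto simp: E_def algebra_simps)
  have E: "- 1 \<le> E" "E \<le> 2 * int g - 1" using D by (auto simp: E_def)
  have Pne: "P \<noteq> []" using a0(1) by (auto simp: P_def)
  have Rne: "R \<noteq> []" using g0(1) by (simp add: R_def)
  have N: "last P = \<mu> \<or> hd R = \<kappa>"
  proof (rule ccontr)
    assume c: "\<not> ?thesis"
    have "Rw \<noteq> [] \<Longrightarrow> last P = last Rw" by (simp add: P_def)
    then have Rw: "Rw = []" using c lastRw by metis
    then have "\<mu> = y" using rf g2 by auto
    then have "A' = []" using c a0 Rw by (auto simp: P_def)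
    have "Lw \<noteq> [] \<Longrightarrow> hd R = hd Lw" by (simp add: R_def)
    then have Lw: "Lw = []" using c hdLw by metis
    then have "\<kappa> = x" using lf by auto
    then have "C' = []" using c g0 Lw by (auto simp: R_def)
    then show False using ne \<open>A' = []\<close> by simp
  qed
  have LuB: "L (P @ B)" and LBv: "L (B @ R)" using le(1) re(1) LU LV u' v' L_app1[of u Lw] L_app2[of Rw v] by simp_all
  have Ju: "JL d (P @ B) \<kappa>" using le(2) u' by simp
  have Jv: "JR d (B @ R) \<mu>" using re(2) v' by simp
  have split: "A' @ B0 @ C' = (A' @ Rw) @ B @ (Lw @ C')" using B1 B by simp
  have both: "L ((P @ B) @ w @ (B @ R))" if "L w" "2 \<le> length w" "successively (stp (- d)) w"
      "hd w = s d \<kappa> (2 * int g - 1)" "last w = s d \<mu> (2 * int g + 1)" for w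
    by (rule glue_both[OF d le(3) re(3) Ju Jv LuB LBv that])
  have mne: "m \<noteq> []" using sh(1) by auto
  have LmB: "L (m @ B)"
    using both[OF Lm sh(1,2) hm lm] L_factor[of "P @ B" "m @ B" R] by simp
  have "loopable P B R m \<or> flippable P B R m"
    using JL_mB[OF d le(3) mk E sh(1,2) lm Ju Jv Pne Rne N]
  proof
    assume J: "JL d (m @ B) \<kappa>"
    have sq: "L ((m @ B) @ (m @ B))"
      by (rule glue_self[OF d le(3) J LmB Lm sh(1,2) hm _ LmB]) simp
    have "L (P @ B @ pw (Suc k) (m @ B) @ R)" for k
    proof -
      have pk: "pw (Suc k) (m @ B) = (pw k (m @ B) @ m) @ B" by (simp add: pw_comm)
      have "L (pw (Suc k) (m @ B))" by (rule L_pw[OF sq])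
      then have L1: "L (pw k (m @ B) @ m)" unfolding pk using L_app1 by blast
      have pre: "prefix m (pw k (m @ B) @ m)" by (cases k) auto
      obtain us u2 where w3: "m = us @ [u2, s d \<mu> (2 * int g + 1)]"
      proof -
        have "m = butlast m @ [last m]" "butlast m \<noteq> []" using sh(1) by (cases m; cases "tl m"; auto)+
        then have "m = butlast (butlast m) @ [last (butlast m), last m]"
          by (metis append.assoc append_Cons append_Nil append_butlast_last_id)
        then show ?thesis using that lm by metis
      qed
      have n2: "\<not> adj d u2 (s d \<mu> (2 * int g + 1))"
        using sh(2) stp_nadj[of "- d" u2 "s d \<mu> (2 * int g + 1)"] d unfolding w3 by (simp add: successively_append_iff)
      have "pw k (m @ B) @ m = (pw k (m @ B) @ us) @ [u2, s d \<mu> (2 * int g + 1)]" using w3 by simp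
      then have L2: "L ((pw k (m @ B) @ m) @ (B @ R))" by (rule JR_glue[OF d re(3) L1 LBv _ n2 Jv])
      have "prefix m ((pw k (m @ B) @ m) @ (B @ R))" using pre by (rule prefix_order.order_trans) simp
      then have "L ((P @ B) @ ((pw k (m @ B) @ m) @ (B @ R)))"
        by (rule glue_self[OF d le(3) Ju LuB Lm sh(1,2) hm _ L2])
      then show ?thesis unfolding pk by simp
    qed
    then show ?thesis using sq by (simp add: loopable_def)
  next
    assume A: "E = - 1 \<and> bad d \<kappa> \<and> B = run d (s d \<kappa> 1) (2 * g - 2)"
    then have Dm: "D = - 1" "p \<noteq> []" "q \<noteq> []" using D by (auto simp: E_def split: if_splits)
    then have forms: "\<kappa> = x" "p = [f]" "\<mu> = y" "q = [l]" "l = x" using lf rf lx1 by auto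
    have bx: "bad d x" using A forms by simp
    have mid: "mid = run (- d) (s (- d) f 1) (2 * g - 2)" using c2 Dm by blast
    define M0 where "M0 = pw i (blk (- d) f) @ run (- d) (s (- d) f 1) (2 * g - 2) @ pw j (blk (- d) (bar x))"
    define Wd where "Wd = M0 @ run (- d) f (2 * g)"
    have mM: "m = f # M0 @ [x]" using forms mid by (simp add: m_def M0_def)
    note an = annular[OF d x bx, where i = i and j = j, folded f_def, folded M0_def, folded Wd_def]
    \<comment> \<open>Moving the first letter \<open>f\<close> of \<open>m\<close> behind
      \<open>B\<close> completes the bad half starting at \<open>x\<close>, the last letter of
      \<open>m\<close>. Replacing it by its complement produces \<open>Wd\<close>.\<close>
    have "[x] @ B @ [f] = run d x (2 * g)"
    proof -
      obtain n where n: "2 * g - 1 = Suc n" "n = 2 * g - 2" "int n = 2 * int g - 2" using g2 by simp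
      have "B @ [f] = run d (s d x 1) (2 * g - 1)"
        using run_Suc2[of d "s d x 1" n] n A forms by (simp add: f_def)
      then show ?thesis using Cons_blk[OF x, of d] by (simp add: blk_def)
    qed
    moreover have "eqv (run d x (2 * g)) (run (- d) f (2 * g))"
      using eqv_run[OF d x, of "2 * g"] by (simp add: f_def)
    ultimately have "eqv (M0 @ [x] @ B @ [f]) Wd"
      unfolding Wd_def using Lm mM by (intro eqv_app eqv_refl) (auto simp: L_def)
    moreover have "L (Wd @ Wd)" by (rule an(3))
    moreover have "length Wd = length (m @ B)" using A g2 by (simp add: Wd_def mM)
    moreover have "L (P @ B @ f # pw k Wd @ (M0 @ [x]) @ B @ R)" for k
    proof -
      let ?Z = "f # pw k Wd @ M0 @ [x]"
      have "L ((P @ B) @ ?Z @ (B @ R))"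
        by (rule both[OF an(1) _ an(2)]) (use forms x in \<open>auto simp: f_def l_def\<close>)
      then show ?thesis by simp
    qed
    ultimately have "flippable P B R m"
      unfolding flippable_def using mM by (intro exI[of _ f] exI[of _ "M0 @ [x]"] exI[of _ Wd]) simp
    then show ?thesis ..
  qed
  then have "A' @ B0 @ C' = (A' @ Rw) @ B @ (Lw @ C') \<and> eqv ((Lw @ C') @ [c] @ (A' @ Rw)) m \<and> L m \<and> m \<noteq> [] \<and>
    (loopable (U @ (A' @ Rw)) B ((Lw @ C') @ V) m \<or> flippable (U @ (A' @ Rw)) B ((Lw @ C') @ V) m)"
    using split eqm2 Lm mne by (simp add: P_def R_def)
  then show ?thesis by blast
qed

section \<open>Forbidden factors around a single junction letter\<close>

lemma weak_last: "dir d \<Longrightarrow> u = [] \<or> last u \<noteq> bar e \<and> last u \<noteq> s d e 1 \<Longrightarrow> weak d u e"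
  unfolding weak_def
proof (intro allI notI)
  fix k
  assume d: "dir d" and u: "u = [] \<or> last u \<noteq> bar e \<and> last u \<noteq> s d e 1"
    and sf: "suffix (bar e # pw k (blk (- d) (bar e))) u"
  have "last u = last (bar e # pw k (blk (- d) (bar e)))" using suffix_last[OF sf] by simp
  also have "\<dots> = bar e \<or> \<dots> = s d e 1" using d by (cases "k = 0") (simp_all add: s_uminus)
  finally show False using u sf by auto
qed

lemma weak_hd:
  assumes d: "dir d" and W: "W v" and e: "inr e" and v: "v = [] \<or> hd v \<noteq> bar e \<and> hd v \<noteq> s d e (- 1)"
  shows "weak d (mir v) (neg e)"
proof (rule weak_last[OF d])
  show "mir v = [] \<or> last (mir v) \<noteq> bar (neg e) \<and> last (mir v) \<noteq> s d (neg e) 1"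
  proof (cases v)
    case (Cons a t)
    have a: "inr a" using W Cons by simp
    have "neg a \<noteq> bar (neg e)"
    proof
      assume "neg a = bar (neg e)"
      then have "neg (neg a) = neg (neg (bar e))" by simp
      then have "a = bar e" using a by (metis inr_bar neg_neg)
      then show False using v Cons by simp
    qed
    moreover have "neg a \<noteq> s d (neg e) 1"
    proof
      assume "neg a = s d (neg e) 1"
      then have "neg (neg a) = neg (s d (neg e) 1)" by simp
      then show False using a e v Cons by (simp add: neg_s)
    qed
    ultimately show ?thesis using Cons by simp
  qed simp
qed

text \<open>An overlap of the suffix and the prefix would put the first letter of the factor a
  second time into its part \<open>A\<close>.\<close>

lemma no_overlap:
  assumes s: "suffix C Q" and p: "prefix A Q" and h: "hd (C @ [e] @ A) \<notin> set (tl (C @ [e] @ A))"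
  shows "\<exists>B. Q = A @ B @ C"
proof -
  obtain q1 where q1: "Q = q1 @ C" using s by (auto simp: suffix_def)
  obtain q2 where q2: "Q = A @ q2" using p by (auto simp: prefix_def)
  have "A @ q2 = q1 @ C" using q1 q2 by simp
  then obtain us where us: "A = q1 @ us \<and> us @ q2 = C \<or> A @ us = q1 \<and> q2 = us @ C"
    using append_eq_append_conv2[of A q2 q1 C] by blast
  show ?thesis
  proof (cases "A @ us = q1 \<and> q2 = us @ C")
    case True
    then show ?thesis using q2 by auto
  next
    case False
    then have u: "A = q1 @ us" "us @ q2 = C" using us by auto
    then have "us \<noteq> []" using False by auto
    then have "hd (C @ [e] @ A) \<in> set A" using u by (cases us) auto
    moreover have "set A \<subseteq> set (tl (C @ [e] @ A))" using u \<open>us \<noteq> []\<close> by (cases C) auto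
    ultimately show ?thesis using h by blast
  qed
qed

lemma run_hd_notin: "dir d \<Longrightarrow> n \<le> 4 * g \<Longrightarrow> hd (run d x n) \<notin> set (tl (run d x n)) \<or> n = 0"
proof (cases n)
  case (Suc m)
  assume d: "dir d" and n: "n \<le> 4 * g"
  have r: "run d x n = run d x 1 @ run d (s d x 1) m" using run_append[of d x 1 m] Suc by simp
  have "s d x 0 \<notin> set (run d (s d x 1) m)"
  proof
    assume "s d x 0 \<in> set (run d (s d x 1) m)"
    then obtain i where "0 \<le> i" "i < int m" "s d x 0 = s d x (1 + i)" using d by (auto simp: set_run)
    then show False using d n Suc by (simp add: s_eq4)
  qed
  then show ?thesis unfolding r by (simp add: run_def)
qed simp

lemma max_nat:
  assumes "P (0::nat)" "\<And>n. P n \<Longrightarrow> n \<le> N"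
  shows "\<exists>m. P m \<and> \<not> P (Suc m)"
proof (rule ccontr)
  assume "\<not> ?thesis"
  then have step: "P m \<Longrightarrow> P (Suc m)" for m by blast
  have "P n" for n by (induction n) (use assms(1) step in auto)
  then show False using assms(2)[of "Suc N"] by simp
qed

text \<open>Lengths of the direction-\<open>d\<close> runs that end just before, respectively start just after, the letter \<open>e\<close>
  when \<open>e\<close> is placed between two copies of \<open>Q\<close>.\<close>

definition sruns :: "int \<Rightarrow> int \<Rightarrow> int list \<Rightarrow> nat \<Rightarrow> bool" where
  "sruns d e Q n \<longleftrightarrow> suffix (run d (s d e (- int n)) n) Q"

definition pruns :: "int \<Rightarrow> int \<Rightarrow> int list \<Rightarrow> nat \<Rightarrow> bool" where
  "pruns d e Q n \<longleftrightarrow> prefix (run d (s d e 1) n) Q"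

lemma sruns_max: "\<exists>n. sruns d e Q n \<and> \<not> sruns d e Q (Suc n)"
proof (rule max_nat)
  fix n assume "sruns d e Q n"
  then show "n \<le> length Q" using suffix_length_le unfolding sruns_def by fastforce
qed (simp add: sruns_def)

lemma pruns_max: "\<exists>n. pruns d e Q n \<and> \<not> pruns d e Q (Suc n)"
proof (rule max_nat)
  fix n assume "pruns d e Q n"
  then show "n \<le> length Q" using prefix_length_le unfolding pruns_def by fastforce
qed (simp add: pruns_def)

lemma sruns_le:
  assumes "sruns d e Q n" "m \<le> n" shows "sruns d e Q m"
proof -
  have "run d (s d e (- int n)) n = run d (s d e (- int n)) (n - m) @ run d (s d e (- int m)) m"
    using run_append[of d "s d e (- int n)" "n - m" m] assms(2) by (simp add: of_nat_diff)
  then show ?thesis using assms(1) unfolding sruns_def by (metis suffix_appendD)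
qed

lemma pruns_le:
  assumes "pruns d e Q n" "m \<le> n" shows "pruns d e Q m"
proof -
  have "run d (s d e 1) n = run d (s d e 1) m @ run d (s d e (1 + int m)) (n - m)"
    using run_append[of d "s d e 1" m "n - m"] assms(2) by simp
  then show ?thesis using assms(1) unfolding pruns_def by (metis append_prefixD)
qed

lemma sruns_Suc:
  assumes "Q = A @ run d (s d e (- int n)) n" "A \<noteq> []" "last A = s d e (- int n - 1)"
  shows "sruns d e Q (Suc n)"
proof -
  have "run d (s d e (- int n - 1)) (Suc n) = s d e (- int n - 1) # run d (s d e (- int n)) n"
    by (subst run_Suc) simp_all
  moreover have "Q = butlast A @ (s d e (- int n - 1) # run d (s d e (- int n)) n)"
    using assms by (metis append.assoc append_Cons append_Nil append_butlast_last_id)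
  moreover have "- int (Suc n) = - int n - 1" by simp
  ultimately show ?thesis unfolding sruns_def suffix_def by metis
qed

lemma pruns_Suc:
  assumes "Q = run d (s d e 1) n @ A" "A \<noteq> []" "hd A = s d e (int n + 1)"
  shows "pruns d e Q (Suc n)"
proof -
  have "run d (s d e 1) (Suc n) = run d (s d e 1) n @ [s d e (int n + 1)]"
    by (subst run_Suc2) (simp add: add.commute)
  moreover have "Q = (run d (s d e 1) n @ [s d e (int n + 1)]) @ tl A"
    using assms by (cases A) auto
  ultimately show ?thesis unfolding pruns_def prefix_def by metis
qed

text \<open>Covers both kinds of junction. Without a stack, \<open>e\<close> is the last letter of
  the word, so \<open>L (Q @ [e])\<close> holds and \<open>V\<close> starts with \<open>e\<close>;
  with a stack, the neighbouring letters are those at the inner ends of its blocks. The bound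
  \<open>4 * g - 3\<close> on the two runs leaves at least two letters on the other side of the
  cell.\<close>

definition good_sides :: "int \<Rightarrow> int \<Rightarrow> int list \<Rightarrow> int list \<Rightarrow> int list \<Rightarrow> bool" where
  "good_sides d e U Q V \<longleftrightarrow>
     L (U @ Q @ V) \<and> weak d (U @ Q) e \<and> weak d (mir (Q @ V)) (neg e) \<and>
     (\<forall>r1 r2. sruns d e Q r1 \<longrightarrow> pruns d e Q r2 \<longrightarrow> r1 + r2 \<le> 4 * g - 3) \<and>
     (\<forall>r. sruns d e Q r \<longrightarrow> r \<le> 2 * g - 1) \<and>
     (U \<noteq> [] \<and> last U = s d e (2 * int g - 1) \<or> L (Q @ [e])) \<and>
     V \<noteq> [] \<and> (hd V = e \<or> hd V = s d e (2 * int g + 1) \<and> (\<forall>r. pruns d e Q r \<longrightarrow> r \<le> 2 * g - 1))"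

lemma weak_left_part:
  assumes d: "dir d" and gs: "good_sides d e U Q V" and Q: "Q = A @ B @ C" and x: "inr x"
    and c: "C \<noteq> [] \<and> hd C = x \<or> C = [] \<and> x = e"
  shows "weak d (U @ A @ B) x"
proof (cases "C = []")
  case True
  then show ?thesis using gs Q c by (simp add: good_sides_def)
next
  case False
  then have "U @ Q @ V = (U @ A @ B) @ [x] @ (tl C @ V)" using c Q by (cases C) auto
  then have "L ((U @ A @ B) @ [x])" using gs L_app1[of "(U @ A @ B) @ [x]" "tl C @ V"] by (simp add: good_sides_def)
  then show ?thesis by (rule weak_of_L[OF d x])
qed

lemma weak_right_part:
  assumes d: "dir d" and gs: "good_sides d e U Q V" and Q: "Q = A @ B @ C" and y: "inr y"
    and c: "A \<noteq> [] \<and> last A = y \<or> A = [] \<and> y = e"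
  shows "weak d (mir (B @ C @ V)) (neg y)"
proof (cases "A = []")
  case True
  then show ?thesis using gs Q c by (simp add: good_sides_def)
next
  case False
  then have "U @ Q @ V = (U @ butlast A) @ ([y] @ (B @ C @ V))" using c Q
    by (metis append.assoc append_butlast_last_id)
  then have "L ([y] @ (B @ C @ V))" using gs L_app2[of "U @ butlast A" "[y] @ (B @ C @ V)"] by (simp add: good_sides_def)
  then have "L (mir ([y] @ (B @ C @ V)))" by (rule L_mir)
  then have "L (mir (B @ C @ V) @ [neg y])" by simp
  then show ?thesis by (rule weak_of_L[OF d inr_neg])
qed

lemma JR_hd_weak: "weak d (mir v) (neg y) \<Longrightarrow> v \<noteq> [] \<Longrightarrow> hd v \<noteq> bar y"
proof
  assume w: "weak d (mir v) (neg y)" and ne: "v \<noteq> []" and h: "hd v = bar y"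
  obtain a t where v: "v = a # t" using ne by (cases v) auto
  have "suffix (bar (neg y) # pw 0 (blk (- d) (bar (neg y)))) (mir v)" using h v by (simp add: suffix_def)
  then show False using w unfolding weak_def by blast
qed

lemma weak_last_ne: "weak d u x \<Longrightarrow> u \<noteq> [] \<Longrightarrow> last u \<noteq> bar x"
proof
  assume w: "weak d u x" and ne: "u \<noteq> []" and h: "last u = bar x"
  have "u = butlast u @ [bar x]" using ne h by (metis append_butlast_last_id)
  then have "suffix [bar x] u" by (rule suffixI)
  then have "suffix (bar x # pw 0 (blk (- d) (bar x))) u" by simp
  then show False using w unfolding weak_def by blast
qed


definition outcome :: "int \<Rightarrow> int list \<Rightarrow> int list \<Rightarrow> int list \<Rightarrow> bool" where
  "outcome e U Q V \<longleftrightarrow> (\<exists>A2 B C2 m. Q = A2 @ B @ C2 \<and> eqv (C2 @ [e] @ A2) m \<and> L m \<and> m \<noteq> [] \<and>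
    (loopable (U @ A2) B (C2 @ V) m \<or> flippable (U @ A2) B (C2 @ V) m))"

lemma core_base:
  fixes d x y D e :: int and U Q V A' B0 C' mid :: "int list"
  defines "f \<equiv> s d x (2 * int g - 1)" and "l \<equiv> s d y (2 * int g + 1)"
  assumes d: "dir d" and e: "inr e" and gs: "good_sides d e U Q V" and Q: "Q = A' @ B0 @ C'"
    and x: "inr x" and y: "y = s d x (D + 2 * int g)" and D: "- 1 \<le> D" "D \<le> 2 * int g - 3"
    and mok: "midok (- d) f mid l"
    and c2: "norun (- d) (f # mid @ [l]) \<and> D \<noteq> - 1 \<or>
      (mid = run (- d) (s (- d) f 1) (2 * g - 2) \<and> bad d x \<and> D = - 1)"
    and eqm: "eqv (C' @ [e] @ A') (f # mid @ [l])"
    and nL: "\<not> suffix [s d x (- 1)] (U @ A' @ B0)" and nR: "\<not> prefix [s d y 1] (B0 @ C' @ V)"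
    and C: "C' \<noteq> [] \<and> hd C' = x \<or> C' = [] \<and> x = e"
    and A: "A' \<noteq> [] \<and> last A' = y \<or> A' = [] \<and> y = e \<and> U \<noteq> [] \<and> last U = s d e (2 * int g - 1)"
    and ne: "A' \<noteq> [] \<or> C' \<noteq> []"
  shows "outcome e U Q V"
proof -
  have iy: "inr y" by (simp add: y)
  have gsV: "V \<noteq> []" "hd V = e \<or> hd V = s d e (2 * int g + 1)" and LX: "L (U @ A' @ B0 @ C' @ V)"
    using gs Q by (auto simp: good_sides_def)
  have wL: "weak d (U @ A' @ B0) x" by (rule weak_left_part[OF d gs Q x C])
  have wR: "weak d (mir (B0 @ C' @ V)) (neg y)" by (rule weak_right_part[OF d gs Q iy]) (use A in auto)
  have a0: "U @ A' \<noteq> []" using A by auto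
  have a0': "last (U @ A') = y \<or> (A' = [] \<and> last (U @ A') = s d y (2 * int g - 1))" using A by auto
  have g0: "C' @ V \<noteq> []" using gsV by simp
  have g0': "hd (C' @ V) = x \<or> (C' = [] \<and> hd (C' @ V) = s d x (2 * int g + 1))" using C gsV by auto
  have vne: "B0 @ C' @ V \<noteq> []" using gsV by simp
  have a1: "hd (B0 @ C' @ V) \<noteq> s d (last (U @ A')) 1"
  proof (cases "last (U @ A') = y")
    case True
    then show ?thesis using nR vne by (cases "B0 @ C' @ V") auto
  next
    case False
    then have "last (U @ A') = s d y (2 * int g - 1)" using a0' by blast
    then have "s d (last (U @ A')) 1 = s d y (2 * int g - 1 + 1)" by (simp only: s_s)
    then have "s d (last (U @ A')) 1 = bar y" unfolding bar_s[OF d] by (simp only: diff_add_cancel)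
    then show ?thesis using JR_hd_weak[OF wR vne] by simp
  qed
  have une: "U @ A' @ B0 \<noteq> []" using a0 by auto
  have g1: "last (U @ A' @ B0) \<noteq> s d (hd (C' @ V)) (- 1)"
  proof (cases "hd (C' @ V) = x")
    case True
    have "suffix [last (U @ A' @ B0)] (U @ A' @ B0)" using une by (metis append_butlast_last_id suffixI)
    then show ?thesis using nL True by auto
  next
    case False
    then have "hd (C' @ V) = s d x (2 * int g + 1)" using g0' by blast
    then have "s d (hd (C' @ V)) (- 1) = s d x (2 * int g + 1 + - 1)" by (simp only: s_s)
    then have "s d (hd (C' @ V)) (- 1) = bar x" unfolding bar_s[OF d] by simp
    then show ?thesis using weak_last_ne[OF wL une] by simp
  qed
  show ?thesis
    unfolding outcome_def Q
    by (rule outcome_core[OF d x y D LX mok[unfolded f_def l_def] c2[unfolded f_def l_def] eqm[unfolded f_def l_def] wL nL wR nR a0 a0' a1 g0 g0' g1 ne])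
qed

lemma run_mid:
  assumes f: "inr f" and n: "2 \<le> n"
  shows "run e f n = f # run e (s e f 1) (n - 2) @ [s e f (int n - 1)]"
proof -
  obtain m where m: "n = Suc (Suc m)" using n by (metis Suc_le_D add_2_eq_Suc le_add_diff_inverse numeral_2_eq_2)
  have "run e f n = f # run e (s e f 1) (Suc m)" unfolding m by (rule run_Suc[OF f])
  then show ?thesis using m run_Suc2[of e "s e f 1" m] by simp
qed

lemma midok_run:
  assumes e: "dir e" and f: "inr f" and n: "2 \<le> n"
  shows "midok e f (run e (s e f 1) (n - 2)) (s e f (int n - 1))"
proof (cases "n = 2")
  case True
  then show ?thesis by (simp add: midok_def stp_def)
next
  case False
  then show ?thesis using n succ_stp_run[OF e, of f n] run_mid[OF f n, of e] W_run
    by (auto simp: midok_def of_nat_diff)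
qed

text \<open>The maximal run through \<open>e\<close> has \<open>n = r1 + 1 + r2\<close> letters and
  is replaced by the other \<open>4 * g - n\<close> letters of its cell. Its maximality within
  \<open>Q\<close> and the known outer letters supply the conditions on the neighbours required by
  \<open>core_base\<close>.\<close>

lemma run_base:
  assumes d: "dir d" and e: "inr e" and gs: "good_sides d e U Q V"
    and r1: "sruns d e Q r1" "\<not> sruns d e Q (Suc r1)" and r2: "pruns d e Q r2" "\<not> pruns d e Q (Suc r2)"
    and r: "2 * g \<le> r1 + r2 + 1" "r1 + r2 + 1 = 2 * g \<Longrightarrow> bad d (s d e (- int r1))"
  shows "outcome e U Q V"
proof -
  define x where "x = s d e (- int r1)"
  define y where "y = s d e (int r2)"
  define n where "n = r1 + r2 + 1"
  define D where "D = int n - 1 - 2 * int g"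
  define A' where "A' = run d (s d e 1) r2"
  define C' where "C' = run d x r1"
  have rle: "r1 + r2 \<le> 4 * g - 3" "r1 \<le> 2 * g - 1"
    using gs r1 r2 by (auto simp: good_sides_def)
  then have n: "n \<le> 4 * g - 2" "2 * g \<le> n" using r(1) g2 by (auto simp: n_def)
  have x: "inr x" by (simp add: x_def)
  have yx: "y = s d x (D + 2 * int g)" by (simp add: y_def x_def D_def n_def)
  have D: "- 1 \<le> D" "D \<le> 2 * int g - 3" using n g2 by (auto simp: D_def)
  have all: "C' @ [e] @ A' = run d x n"
  proof -
    have "run d x n = run d x r1 @ run d (s d x (int r1)) (Suc r2)"
      using run_append[of d x r1 "Suc r2"] by (simp add: n_def)
    moreover have "s d x (int r1) = e" using e by (simp add: x_def)
    ultimately show ?thesis using run_Suc[OF e, of d r2] by (simp add: C'_def A'_def)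
  qed
  have "\<exists>B. Q = A' @ B @ C'"
  proof (rule no_overlap)
    show "suffix C' Q" using r1(1) by (simp add: C'_def x_def sruns_def)
    show "prefix A' Q" using r2(1) by (simp add: A'_def pruns_def)
    show "hd (C' @ [e] @ A') \<notin> set (tl (C' @ [e] @ A'))"
      unfolding all using run_hd_notin[OF d, of n x] n by (auto simp: n_def)
  qed
  then obtain B0 where Q: "Q = A' @ B0 @ C'" by blast
  define f where "f = s d x (2 * int g - 1)"
  define l where "l = s d y (2 * int g + 1)"
  have f: "inr f" by (simp add: f_def)
  define k where "k = 4 * g - n"
  have k: "2 \<le> k" "k \<le> 2 * g" using n g2 by (auto simp: k_def)
  have ed: "dir (- d)" using d by simp
  have lf: "l = s (- d) f (int k - 1)"
  proof -
    have "l = s d x (int n - 1 + (2 * int g + 1))" by (simp add: l_def yx D_def)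
    moreover have "s (- d) f (int k - 1) = s d x (2 * int g - 1 - (4 * int g - int n - 1))"
      using n by (simp add: f_def s_uminus k_def of_nat_diff)
    ultimately show ?thesis using s_period[OF d, of "int n - 1 + (2 * int g + 1)" "2 * int g - 1 - (4 * int g - int n - 1)" x] by simp
  qed
  define mid where "mid = run (- d) (s (- d) f 1) (k - 2)"
  have fm: "f # mid @ [l] = run (- d) f k" using run_mid[OF f k(1), of "- d"] lf by (simp add: mid_def)
  have mok: "midok (- d) f mid l" unfolding mid_def lf by (rule midok_run[OF ed f k(1)])
  have c2: "norun (- d) (f # mid @ [l]) \<and> D \<noteq> - 1 \<or>
      (mid = run (- d) (s (- d) f 1) (2 * g - 2) \<and> bad d x \<and> D = - 1)"
  proof (cases "n = 2 * g")
    case True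
    then show ?thesis using r(2) by (auto simp: mid_def k_def D_def x_def n_def)
  next
    case False
    then have "k < 2 * g" using n by (auto simp: k_def)
    then have "norun (- d) (f # mid @ [l])" unfolding fm by (intro norun_short) simp
    then show ?thesis using False n by (auto simp: D_def)
  qed
  have eqm: "eqv (C' @ [e] @ A') (f # mid @ [l])"
    unfolding all fm using eqv_run[OF d x, of n] n by (simp add: f_def k_def)
  have hdrun: "r1 \<noteq> 0 \<Longrightarrow> hd C' = x" using x by (simp add: C'_def)
  have lastrun: "r2 \<noteq> 0 \<Longrightarrow> last A' = y" by (simp add: A'_def y_def)
  have Cn: "C' = [] \<longleftrightarrow> r1 = 0" and An: "A' = [] \<longleftrightarrow> r2 = 0" by (simp_all add: C'_def A'_def)
  have HA: "U \<noteq> [] \<and> last U = s d e (2 * int g - 1) \<or> L (Q @ [e])" and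
    HV: "V \<noteq> []" "hd V = e \<or> hd V = s d e (2 * int g + 1) \<and> r2 \<le> 2 * g - 1"
    using gs r2(1) by (auto simp: good_sides_def)
  \<comment> \<open>With \<open>r2 = 0\<close> the run would be a bad half lying entirely in
    \<open>Q @ [e]\<close>.\<close>
  have r2pos: "r2 \<noteq> 0" if "L (Q @ [e])"
  proof
    assume 0: "r2 = 0"
    have "r1 + 1 = 2 * g" using 0 rle(2) r(1) g2 by arith
    then have rr: "r1 = 2 * g - 1" "n = 2 * g" using 0 by (auto simp: n_def)
    have "C' @ [e] = run d x (2 * g)" using all An 0 rr by simp
    then have "forb (C' @ [e])" using forb_F3[OF d x] r(2) rr by (simp add: x_def n_def)
    moreover have "Q @ [e] = (A' @ B0) @ (C' @ [e]) @ []" using Q by simp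
    ultimately show False using not_L that by metis
  qed
  have nL: "\<not> suffix [s d x (- 1)] (U @ A' @ B0)"
  proof
    assume "suffix [s d x (- 1)] (U @ A' @ B0)"
    then have la: "last (U @ A' @ B0) = s d x (- 1)" "U @ A' @ B0 \<noteq> []" by (auto simp: suffix_def)
    show False
    proof (cases "A' @ B0 = []")
      case False
      then have "last (A' @ B0) = s d e (- int r1 - 1)" using la by (simp add: x_def)
      then have "sruns d e Q (Suc r1)" using sruns_Suc[of Q "A' @ B0" d e r1] False Q by (simp add: C'_def x_def)
      then show False using r1 by simp
    next
      case True
      then have "last U = s d e (2 * int g - 1)" using HA r2pos An by auto
      moreover have "last U = s d e (- int r1 - 1)" using la True by (simp add: x_def)
      moreover have "int r1 \<le> 2 * int g - 1" using rle(2) g2 by linarith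
      ultimately show False using d gi by (auto simp: s_eq8)
    qed
  qed
  have nR: "\<not> prefix [s d y 1] (B0 @ C' @ V)"
  proof
    assume "prefix [s d y 1] (B0 @ C' @ V)"
    then have ha: "hd (B0 @ C' @ V) = s d y 1" by (auto simp: prefix_def)
    show False
    proof (cases "B0 @ C' = []")
      case False
      then have "hd (B0 @ C') = s d e (int r2 + 1)" using ha by (simp add: y_def hd_append split: if_splits)
      then have "pruns d e Q (Suc r2)" using pruns_Suc[of Q d e r2 "B0 @ C'"] False Q by (simp add: A'_def)
      then show False using r2 by simp
    next
      case True
      then have hV: "hd V = s d e (int r2 + 1)" using ha by (simp add: y_def)
      have r2b: "int r2 \<le> 4 * int g - 3" using rle(1) g2 by linarith
      from HV(2) show False
      proof
        assume "hd V = e"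
        then have "s d e 0 = s d e (int r2 + 1)" using hV e by simp
        then show False using d gi r2b by (auto simp: s_eq8)
      next
        assume a: "hd V = s d e (2 * int g + 1) \<and> r2 \<le> 2 * g - 1"
        then have "int r2 \<le> 2 * int g - 1" using g2 by linarith
        moreover have "s d e (2 * int g + 1) = s d e (int r2 + 1)" using a hV by simp
        ultimately show False using d gi by (auto simp: s_eq8)
      qed
    qed
  qed
  show ?thesis
  proof (rule core_base[OF d e gs Q x yx D])
    show "midok (- d) (s d x (2 * int g - 1)) mid (s d y (2 * int g + 1))" using mok by (simp add: f_def l_def)
    show "norun (- d) (s d x (2 * int g - 1) # mid @ [s d y (2 * int g + 1)]) \<and> D \<noteq> - 1 \<or>
      mid = run (- d) (s (- d) (s d x (2 * int g - 1)) 1) (2 * g - 2) \<and> bad d x \<and> D = - 1"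
      using c2 by (simp add: f_def l_def)
    show "eqv (C' @ [e] @ A') (s d x (2 * int g - 1) # mid @ [s d y (2 * int g + 1)])" using eqm by (simp add: f_def l_def)
    show "\<not> suffix [s d x (- 1)] (U @ A' @ B0)" by (rule nL)
    show "\<not> prefix [s d y 1] (B0 @ C' @ V)" by (rule nR)
    show "C' \<noteq> [] \<and> hd C' = x \<or> C' = [] \<and> x = e" using Cn hdrun e by (auto simp: x_def)
    show "A' \<noteq> [] \<and> last A' = y \<or> A' = [] \<and> y = e \<and> U \<noteq> [] \<and> last U = s d e (2 * int g - 1)"
      using An lastrun HA r2pos e by (auto simp: y_def)
    show "A' \<noteq> [] \<or> C' \<noteq> []" using Cn An r(1) g2 by auto
  qed
qed

text \<open>If \<open>s d x (- 1)\<close> preceded the factor, there would be a run of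
  \<open>2 * g + 1\<close> letters. Should \<open>C\<close> contain its last \<open>2 * g\<close>
  letters, it is a forbidden factor of the given word; otherwise it passes through \<open>e\<close>
  and exceeds the bound on runs.\<close>

lemma F2_left:
  assumes d: "dir d" and e: "inr e" and L: "L (U @ A @ B @ C)" and x: "inr x" and k: "2 \<le> k"
    and f: "C @ [e] @ A = x # pw k (blk d x) @ [bar x]"
    and r: "\<And>r1 r2. sruns d e (A @ B @ C) r1 \<Longrightarrow> pruns d e (A @ B @ C) r2 \<Longrightarrow> r1 + r2 + 1 \<le> 2 * g"
  shows "\<not> suffix [s d x (- 1)] (U @ A @ B)"
proof
  assume sf: "suffix [s d x (- 1)] (U @ A @ B)"
  then obtain w where w: "U @ A @ B = w @ [s d x (- 1)]" by (auto simp: suffix_def)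
  obtain j where j: "k = Suc j" using k by (cases k) auto
  have f': "C @ ([e] @ A) = run d x (2 * g) @ (pw j (blk d x) @ [bar x])"
    using f j Cons_blk[OF x, of d] by simp
  then obtain us where us: "C = run d x (2 * g) @ us \<and> us @ ([e] @ A) = pw j (blk d x) @ [bar x] \<or>
     C @ us = run d x (2 * g) \<and> [e] @ A = us @ (pw j (blk d x) @ [bar x])"
    using append_eq_append_conv2[of C "[e] @ A" "run d x (2 * g)" "pw j (blk d x) @ [bar x]"] by blast
  show False
  proof (cases "us = [] \<or> C = run d x (2 * g) @ us \<and> us @ ([e] @ A) = pw j (blk d x) @ [bar x]")
    case True
    then obtain t where t: "C = run d x (2 * g) @ t" using us by auto
    define z where "z = s d x (- 1)"
    have z: "inr z" "s d z 1 = x" using x by (simp_all add: z_def)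
    have "z # pw 1 (blk d z) @ [bar z] = [z] @ run d x (2 * g)" using blk_snoc_run[OF d z(1)] z by simp
    then have "U @ A @ B @ C = w @ (z # pw 1 (blk d z) @ [bar z]) @ t" using w t z_def by (metis append.assoc)
    then show False using L not_L forb_F2[OF d z(1), of 1] by metis
  next
    case False
    then have u: "C @ us = run d x (2 * g)" "us \<noteq> []" "[e] @ A = us @ (pw j (blk d x) @ [bar x])" using us by auto
    define c where "c = length C"
    have rs: "C = run d x c" "us = run d (s d x (int c)) (length us)" "2 * g = c + length us"
      using run_split[OF u(1)] by (auto simp: c_def)
    have "hd us = e" using u(2,3) by (cases us) auto
    then have ec: "e = s d x (int c)" using rs(2) u(2) by (metis hd_run length_greater_0_conv s_s add.right_neutral)
    then have xe: "x = s d e (- int c)" using x by simp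
    obtain n where n: "length us = Suc n" using u(2) by (cases us) auto
    have "us = e # run d (s d e 1) n" using rs(2) n ec run_Suc[of e d n] e by simp
    then have A: "A = run d (s d e 1) n @ (pw j (blk d x) @ [bar x])" using u(3) by simp
    then have "pruns d e (A @ B @ C) n" by (simp add: pruns_def)
    moreover have "A @ B \<noteq> []" using A by simp
    then have "last (A @ B) = last (U @ A @ B)" by simp
    then have "last (A @ B) = s d e (- int c - 1)" unfolding w xe by simp
    then have "sruns d e (A @ B @ C) (Suc c)"
      using sruns_Suc[of "A @ B @ C" "A @ B" d e c] \<open>A @ B \<noteq> []\<close> rs(1) xe by simp
    ultimately have "Suc c + n + 1 \<le> 2 * g" using r by blast
    then show False using rs(3) n by simp
  qed
qed

lemma sruns_mir: "dir d \<Longrightarrow> inr e \<Longrightarrow> W Q \<Longrightarrow> sruns d (neg e) (mir Q) n \<longleftrightarrow> pruns d e Q n"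
proof -
  assume d: "dir d" and e: "inr e" and W: "W Q"
  have m: "mir (run d (s d e 1) n) = run d (s d (neg e) (- int n)) n" by (simp add: mir_run neg_s)
  have m': "mir (run d (s d (neg e) (- int n)) n) = run d (s d e 1) n" unfolding m[symmetric] by (rule mir_mir) (rule W_run)
  show ?thesis
  proof
    assume "sruns d (neg e) (mir Q) n"
    then obtain r where "mir Q = r @ run d (s d (neg e) (- int n)) n" by (auto simp: sruns_def suffix_def)
    then have "mir (mir Q) = run d (s d e 1) n @ mir r" by (simp add: m')
    then show "pruns d e Q n" using mir_mir[OF W] by (simp add: pruns_def prefix_def)
  next
    assume "pruns d e Q n"
    then obtain r where "Q = run d (s d e 1) n @ r" by (auto simp: pruns_def prefix_def)
    then show "sruns d (neg e) (mir Q) n" by (simp add: m sruns_def suffix_def)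
  qed
qed

lemma F2_right:
  assumes d: "dir d" and e: "inr e" and L: "L (A @ B @ C @ V)" and x: "inr x" and k: "2 \<le> k"
    and f: "C @ [e] @ A = x # pw k (blk d x) @ [bar x]"
    and r: "\<And>r1 r2. sruns d e (A @ B @ C) r1 \<Longrightarrow> pruns d e (A @ B @ C) r2 \<Longrightarrow> r1 + r2 + 1 \<le> 2 * g"
  shows "\<not> prefix [s d (bar x) 1] (B @ C @ V)"
proof
  assume "prefix [s d (bar x) 1] (B @ C @ V)"
  then obtain t where t: "B @ C @ V = s d (bar x) 1 # t" by (auto simp: prefix_def)
  have W: "W (A @ B @ C)" using L L_app1[of "A @ B @ C" V] by (simp add: L_def)
  have L': "L (mir V @ mir C @ mir B @ mir A)" using L_mir[OF L] by simp
  have "mir (C @ [e] @ A) = mir ([x] @ pw k (blk d x) @ [bar x])" using f by simp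
  then have f': "mir A @ [neg e] @ mir C = bar (neg x) # pw k (blk d (bar (neg x))) @ [bar (bar (neg x))]"
    using d by (simp add: mir_pw mir_blk)
  have Q: "mir C @ mir B @ mir A = mir (A @ B @ C)" by simp
  have WQ: "W (mir (A @ B @ C))" using set_mir_inr by blast
  have p: "pruns d (neg e) (mir (A @ B @ C)) n \<longleftrightarrow> sruns d e (A @ B @ C) n" for n
    by (rule sruns_mir[OF d inr_neg[of e] WQ, unfolded mir_mir[OF W] neg_neg[OF e], symmetric])
  have r': "r1 + r2 + 1 \<le> 2 * g" if "sruns d (neg e) (mir C @ mir B @ mir A) r1" "pruns d (neg e) (mir C @ mir B @ mir A) r2" for r1 r2
    using that r[of r2 r1] unfolding Q p sruns_mir[OF d e W] by simp
  have "\<not> suffix [s d (bar (neg x)) (- 1)] (mir V @ mir C @ mir B)"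
    by (rule F2_left[OF d inr_neg L' _ k f' r']) simp
  moreover have "mir V @ mir C @ mir B = mir t @ [s d (bar (neg x)) (- 1)]"
  proof -
    have "mir V @ mir C @ mir B = mir (s d (bar x) 1 # t)" unfolding t[symmetric] by simp
    also have "\<dots> = mir t @ [s d (bar (neg x)) (- 1)]" using neg_s[of d "bar x" 1] by (simp del: s_bar)
    finally show ?thesis .
  qed
  ultimately show False unfolding suffix_def by blast
qed

text \<open>The other side of the strip consists of \<open>k\<close> blocks of direction
  \<open>- d\<close>, whose first and last letters serve as \<open>f\<close> and \<open>l\<close>.
  As the factor goes from \<open>x\<close> to \<open>bar x\<close>, the offset parameter
  \<open>D\<close> is \<open>0\<close>.\<close>

lemma F2_base:
  assumes d: "dir d" and e: "inr e" and gs: "good_sides d e U Q V"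
    and x: "inr x" and k: "2 \<le> k" and Q: "Q = A' @ B0 @ C'"
    and f: "C' @ [e] @ A' = x # pw k (blk d x) @ [bar x]"
    and r: "\<And>r1 r2. sruns d e Q r1 \<Longrightarrow> pruns d e Q r2 \<Longrightarrow> r1 + r2 + 1 \<le> 2 * g"
  shows "outcome e U Q V"
proof -
  define y where "y = bar x"
  define fl where "fl = s d x (2 * int g - 1)"
  define l where "l = s d y (2 * int g + 1)"
  define E where "E = blk (- d) (bar x)"
  have LX: "L (U @ A' @ B0 @ C' @ V)" using gs Q by (simp add: good_sides_def)
  obtain n where n: "2 * g - 1 = Suc (Suc (Suc n))" using g2 that[of "2 * g - 4"] by simp
  have ni: "int n = 2 * int g - 4" using n g2 by arith
  have ed: "dir (- d)" using d by simp
  have l1: "l = s d x 1" using s_period[OF d, of "4 * int g + 1" 1 x] d by (simp add: l_def y_def)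
  have Eh: "E = fl # s (- d) fl 1 # tl (tl E)"
  proof -
    obtain r where "E = s (- d) (bar x) 1 # s (- d) (bar x) 2 # r" using blk_Cons2 E_def by metis
    then show ?thesis using d by (simp add: fl_def s_uminus)
  qed
  have El: "E = butlast (butlast E) @ [s (- d) l (- 1), l]"
  proof -
    have "E = run (- d) (s (- d) (bar x) 1) (Suc n) @ [s d x 2] @ [s d x 1]"
      unfolding E_def blk_def n run_Suc2[of _ _ "Suc (Suc n)"] run_Suc2[of _ _ "Suc n"]
      using ni d by (simp add: s_uminus)
    then show ?thesis by (simp add: l1 s_uminus butlast_append)
  qed
  define P where "P = pw k E"
  obtain j where j: "k = Suc (Suc j)" using k by (metis Suc_le_D add_2_eq_Suc le_add_diff_inverse numeral_2_eq_2)
  define mid where "mid = tl E @ pw j E @ butlast E"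
  have Pm: "P = fl # mid @ [l]"
  proof -
    have "P = E @ pw j E @ E" unfolding P_def j by (simp add: pw_comm)
    also have "E @ pw j E @ E = (fl # tl E) @ pw j E @ (butlast E @ [l])" using Eh El
      by (metis append_butlast_last_id last_snoc append_Cons append_Nil append.assoc butlast_append butlast_snoc list.sel(3) list.distinct(1))
    finally show ?thesis by (simp add: mid_def)
  qed
  have tE: "tl E \<noteq> []" "hd (tl E) = s (- d) fl 1" using Eh by (metis list.sel(3) list.distinct(1), metis list.sel(1,3))
  have bE: "butlast E \<noteq> []" "last (butlast E) = s (- d) l (- 1)" using El
    by (metis Nil_is_append_conv butlast_append butlast_snoc append_Cons append_Nil append.assoc list.distinct(1),
      metis append_Cons append_Nil append.assoc butlast_snoc last_snoc)
  have mok: "midok (- d) fl mid l"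
  proof -
    have "successively (stp (- d)) (fl # mid @ [l])"
      unfolding Pm[symmetric] P_def E_def by (rule succ_stp_pw'[OF ed]) simp
    moreover have "W mid"
    proof -
      have "W P" unfolding P_def E_def by (rule inr_pw)
      then show ?thesis unfolding Pm by simp
    qed
    moreover have "mid \<noteq> []" "hd mid = s (- d) fl 1" using tE by (simp_all add: mid_def)
    moreover have "l = s (- d) (last mid) 1" using bE l1 by (simp add: mid_def last_append)
    ultimately show ?thesis by (simp add: midok_def)
  qed
  have nr: "norun (- d) (fl # mid @ [l])" unfolding Pm[symmetric] P_def E_def by (rule norun_pw[OF ed])
  have eqm: "eqv (C' @ [e] @ A') (fl # mid @ [l])"
    unfolding f Pm[symmetric] P_def E_def by (rule eqv_F2[OF d x])
  have yx: "y = s d x (0 + 2 * int g)" using d by (simp add: y_def bar_s)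
  have LQ: "L (U @ A' @ B0 @ C')" using LX L_app1[of "U @ A' @ B0 @ C'" V] by simp
  have LV: "L (A' @ B0 @ C' @ V)" using LX L_app2[of U] by simp
  have nL: "\<not> suffix [s d x (- 1)] (U @ A' @ B0)"
    by (rule F2_left[OF d e LQ x k f]) (use r Q in simp)
  have nR: "\<not> prefix [s d y 1] (B0 @ C' @ V)"
    unfolding y_def by (rule F2_right[OF d e LV x k f]) (use r Q in simp)
  have HA: "U \<noteq> [] \<and> last U = s d e (2 * int g - 1) \<or> L (Q @ [e])" using gs by (auto simp: good_sides_def)
  have A0: "A' \<noteq> []" if "L (Q @ [e])"
  proof
    assume "A' = []"
    then have "C' @ [e] = x # pw k (blk d x) @ [bar x]" using f by simp
    then have "forb (C' @ [e])" using forb_F2[OF d x] by simp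
    moreover have "Q @ [e] = (A' @ B0) @ (C' @ [e]) @ []" using Q by simp
    ultimately show False using not_L that by metis
  qed
  show ?thesis
  proof (rule core_base[OF d e gs Q x yx])
    show "- 1 \<le> (0::int)" "0 \<le> 2 * int g - 3" using gi by auto
    show "midok (- d) (s d x (2 * int g - 1)) mid (s d y (2 * int g + 1))" using mok by (simp add: fl_def l_def)
    show "norun (- d) (s d x (2 * int g - 1) # mid @ [s d y (2 * int g + 1)]) \<and> (0::int) \<noteq> - 1 \<or>
      mid = run (- d) (s (- d) (s d x (2 * int g - 1)) 1) (2 * g - 2) \<and> bad d x \<and> (0::int) = - 1"
      using nr by (simp add: fl_def l_def)
    show "eqv (C' @ [e] @ A') (s d x (2 * int g - 1) # mid @ [s d y (2 * int g + 1)])" using eqm by (simp add: fl_def l_def)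
    show "\<not> suffix [s d x (- 1)] (U @ A' @ B0)" by (rule nL)
    show "\<not> prefix [s d y 1] (B0 @ C' @ V)" by (rule nR)
    show "C' \<noteq> [] \<and> hd C' = x \<or> C' = [] \<and> x = e" using f by (cases C') auto
    show "A' \<noteq> [] \<and> last A' = y \<or> A' = [] \<and> y = e \<and> U \<noteq> [] \<and> last U = s d e (2 * int g - 1)"
    proof (cases "A' = []")
      case False
      have "last (C' @ [e] @ A') = bar x" unfolding f by simp
      then show ?thesis using False by (simp add: y_def)
    next
      case True
      have "last (C' @ [e] @ A') = bar x" unfolding f by simp
      then show ?thesis using True HA A0 by (auto simp: y_def)
    qed
    show "A' \<noteq> [] \<or> C' \<noteq> []" using f k by (cases k) auto
  qed
qed

text \<open>A replaceable run through \<open>e\<close> is treated first. If there is none, all runs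
  through \<open>e\<close> have at most \<open>2 * g\<close> letters: this excludes
  \<open>k = 1\<close>, which is a run of \<open>2 * g + 1\<close> letters, and a bad half would be
  the maximal run itself. Only strips with \<open>k >= 2\<close> remain.\<close>

lemma outcome_of_forbd:
  assumes d: "dir d" and e: "inr e" and gs: "good_sides d e U Q V"
    and fd: "forbd d f" and f: "f = C' @ [e] @ A'" "suffix C' Q" "prefix A' Q"
  shows "outcome e U Q V"
proof -
  have ff: "forb f" using fd d by (auto simp: forb_def)
  obtain B0 where Q: "Q = A' @ B0 @ C'"
    using no_overlap[OF f(2,3), of e] forb_hd[OF ff] f(1) by auto
  obtain r1 where r1: "sruns d e Q r1" "\<not> sruns d e Q (Suc r1)" using sruns_max by blast
  obtain r2 where r2: "pruns d e Q r2" "\<not> pruns d e Q (Suc r2)" using pruns_max by blast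
  have m1: "n \<le> r1" if "sruns d e Q n" for n using sruns_le[OF that, of "Suc r1"] r1(2) by (meson not_less_eq_eq)
  have m2: "n \<le> r2" if "pruns d e Q n" for n using pruns_le[OF that, of "Suc r2"] r2(2) by (meson not_less_eq_eq)
  show ?thesis
  proof (cases "2 * g < r1 + r2 + 1 \<or> r1 + r2 + 1 = 2 * g \<and> bad d (s d e (- int r1))")
    case True
    then show ?thesis by (intro run_base[OF d e gs r1 r2]) auto
  next
    case False
    have rb: "a + b + 1 \<le> 2 * g" if "sruns d e Q a" "pruns d e Q b" for a b
      using m1[OF that(1)] m2[OF that(2)] False by linarith
    have inrun: "\<exists>a b. sruns d e Q a \<and> pruns d e Q b \<and> a + b + 1 = n \<and> x = s d e (- int a)"
      if "C' @ [e] @ A' = run d x n" "inr x" for x n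
    proof -
      define a where "a = length C'"
      have "C' @ ([e] @ A') = run d x n" using that by simp
      from run_split[OF this] have c: "C' = run d x a" "e # A' = run d (s d x (int a)) (Suc (length A'))" "n = a + Suc (length A')"
        by (auto simp: a_def)
      have eA: "e = s d x (int a)" "A' = run d (s d e 1) (length A')"
        using c(2) run_Suc[of "s d x (int a)" d "length A'"] by auto
      have x: "x = s d e (- int a)" using eA(1) that(2) by simp
      have "sruns d e Q a" using f(2) c(1) x by (simp add: sruns_def)
      moreover have "pruns d e Q (length A')" using f(3) eA(2) unfolding pruns_def by metis
      ultimately show ?thesis using c(3) x by (intro exI[of _ a] exI[of _ "length A'"]) simp
    qed
    from fd consider x k where "inr x" "1 \<le> k" "f = x # pw k (blk d x) @ [bar x]"
      | x where "inr x" "bad d x" "f = x # blk d x"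
      unfolding forbd_def by blast
    then show ?thesis
    proof cases
      case (1 x k)
      have "k \<noteq> 1"
      proof
        assume "k = 1"
        then have "f = run d x (2 * g + 1)" using 1 Cons_blk[of x d] d run_Suc2[of d x "2 * g"] by (simp add: bar_s)
        then obtain a b where "sruns d e Q a" "pruns d e Q b" "a + b + 1 = 2 * g + 1"
          using inrun[of x "2 * g + 1"] 1 f(1) by auto
        then show False using rb by fastforce
      qed
      then have k2: "2 \<le> k" using 1 by simp
      have f2: "C' @ [e] @ A' = x # pw k (blk d x) @ [bar x]" using 1 f(1) by simp
      show ?thesis by (rule F2_base[OF d e gs 1(1) k2 Q f2 rb])
    next
      case (2 x)
      then have "C' @ [e] @ A' = run d x (2 * g)" using f(1) Cons_blk by simp
      then obtain a b where ab: "sruns d e Q a" "pruns d e Q b" "a + b + 1 = 2 * g" "x = s d e (- int a)"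
        using inrun 2 by blast
      then have "a = r1" "r1 + r2 + 1 = 2 * g" using m1[OF ab(1)] m2[OF ab(2)] rb[OF r1(1) r2(1)] by auto
      then show ?thesis using False 2 ab by simp
    qed
  qed
qed

subsection \<open>Powers of a cyclically freely reduced word\<close>

lemma adj_not_bar: "dir d \<Longrightarrow> adj d a b \<Longrightarrow> b \<noteq> bar a"
  using gi by (auto simp: adj_def bar_s[of d] s_eq8)

text \<open>The letter \<open>z\<close> follows the two different letters \<open>last f1\<close> and
  \<open>last w\<close>, so one step is \<open>1\<close> and the other \<open>2 * g + 2\<close>. If
  the block boundary lay before \<open>w\<close>, the letter \<open>a\<close> of the strip would
  recur inside its blocks. So it lies behind \<open>w\<close>, and \<open>w\<close> consists of
  whole blocks.\<close>

lemma forbd_pred: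
  assumes d: "dir d" and f: "forbd d (f1 @ w @ z # r)" and ne: "f1 \<noteq> []" "w \<noteq> []" "hd w = z" "last f1 \<noteq> last w"
    and i: "inr (last f1)" "inr (last w)"
  shows "\<exists>a k. inr a \<and> 1 \<le> k \<and> f1 = [a] \<and> w = pw k (blk d a)"
proof -
  have 1: "adj d (last f1) z" using forbd_adj[OF d f ne(1)] ne(2,3) by simp
  have f': "forbd d ((f1 @ w) @ z # r)" using f by simp
  have 2: "adj d (last w) z" using forbd_adj[OF d f'] ne(1,2) by simp
  have inj: "last f1 = last w" if "z = s d (last f1) t" "z = s d (last w) t" for t
    using that i by (metis add.right_inverse s_0 s_s)
  show ?thesis
  proof (cases "z = s d (last w) 1")
    case False
    then have "hd (z # r) = s d (last (f1 @ w)) (2 * int g + 2)" using 2 ne(2) by (simp add: adj_def)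
    then obtain a k1 k2 where a: "inr a" "1 \<le> k1" "f1 @ w = a # pw k1 (blk d a)" "1 \<le> k2" "z # r = pw k2 (blk d a) @ [bar a]"
      using forbd_break[OF d f'] ne(1) by auto
    have "z = hd (pw k2 (blk d a) @ [bar a])" using a(5) by (metis list.sel(1))
    then have za: "z = s d a 1" using a(4) by (simp add: hd_append)
    have "z = s d (last f1) 1" using 1 False inj[of "2 * int g + 2"] 2 ne(4) by (auto simp: adj_def)
    then have "last f1 = a" using za i(1) a(1) by (metis add.right_inverse s_0 s_s)
    then have "butlast f1 @ a # w = [] @ a # pw k1 (blk d a)" using a(3) ne(1)
      by (metis append.assoc append_Cons append_Nil append_butlast_last_id)
    moreover have "a \<notin> set (pw k1 (blk d a))" by (rule notin_pw(1)[OF d a(1)])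
    moreover have "f1 = [a]"
    proof -
      obtain t where t: "f1 = a # t" "t @ w = pw k1 (blk d a)" using a(3) ne(1) by (cases f1) auto
      have "t = []"
      proof (rule ccontr)
        assume "t \<noteq> []"
        then have "a \<in> set t" using \<open>last f1 = a\<close> t(1) by (metis last_ConsR last_in_set)
        then have "a \<in> set (pw k1 (blk d a))" using t(2) by (metis Un_iff set_append)
        then show False using notin_pw(1)[OF d a(1)] by blast
      qed
      then show ?thesis using t by simp
    qed
    ultimately show ?thesis using a by auto
  next
    case True
    then have "z \<noteq> s d (last f1) 1" using inj[of 1] ne(4) by auto
    then have "hd (w @ z # r) = s d (last f1) (2 * int g + 2)" using 1 ne(2,3) by (simp add: adj_def)
    then obtain a k1 k2 where a: "inr a" "1 \<le> k2" "w @ z # r = pw k2 (blk d a) @ [bar a]"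
      using forbd_break[OF d f ne(1)] by auto
    have "z = hd (pw k2 (blk d a) @ [bar a])" using a(3) ne(2,3) by (metis hd_append2)
    then have "z = s d a 1" using a(2) by (simp add: hd_append)
    then have "last w = a" using True i(2) a(1) by (metis add.right_inverse s_0 s_s)
    then have "a \<in> set (butlast (w @ z # r))" using ne(2) by (auto simp: butlast_append)
    then have "a \<in> set (pw k2 (blk d a))" unfolding a(3) by simp
    then show ?thesis using notin_pw(1)[OF d a(1)] by blast
  qed
qed

text \<open>A forbidden factor starting in \<open>U\<close> that does not fit into
  \<open>U @ w\<close> contains all of \<open>w\<close> and the next letter, which is
  \<open>hd w\<close> again. Then \<open>forbd_pred\<close> leaves only the stated
  exception.\<close>

lemma per_left:
  assumes Uw: "L (U @ w)" and wV: "L (pw k w @ V)" and w: "w \<noteq> []" and k: "2 \<le> k \<or> 1 \<le> k \<and> V \<noteq> [] \<and> hd V = hd w"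
    and t: "U = [] \<or> last U \<noteq> last w"
  shows "L (U @ pw k w @ V) \<or> (\<exists>d a j. dir d \<and> inr a \<and> 1 \<le> j \<and> U \<noteq> [] \<and> last U = a \<and> w = pw j (blk d a))"
proof (rule ccontr)
  assume c: "\<not> ?thesis"
  have LU: "L U" using Uw L_app1 by blast
  then have "W (U @ pw k w @ V)" using wV by (auto simp: L_def)
  then obtain f where f: "forb f" "sublist f (U @ (pw k w @ V))" using c by (auto simp: L_def)
  moreover have nf: "\<not> sublist f U" "\<not> sublist f (pw k w @ V)" "\<not> sublist f (U @ w)" using LU wV Uw f by (auto simp: L_def)
  ultimately obtain f1 f2 where ff: "f = f1 @ f2" "suffix f1 U" "prefix f2 (pw k w @ V)"
    using sublist_append[of f U "pw k w @ V"] by blast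
  have f1: "f1 \<noteq> []" using ff nf by auto
  have Une: "U \<noteq> []" using ff f1 by auto
  obtain k' where k': "k = Suc k'" using k by (cases k) auto
  have np: "\<not> prefix f2 w"
  proof
    assume "prefix f2 w"
    then have "sublist f (U @ w)" unfolding ff(1) sublist_append using ff(2) by blast
    then show False using nf by simp
  qed
  have "prefix f2 (w @ (pw k' w @ V))" using ff(3) k' by simp
  then obtain r0 where r0: "f2 = w @ r0" "prefix r0 (pw k' w @ V)" using np by (auto simp: prefix_append)
  have "r0 \<noteq> []" using r0 np by auto
  then obtain z r where r: "r0 = z # r" by (cases r0) auto
  have "hd (pw k' w @ V) = hd w" using k k' w by (cases "k' = 0") (auto simp: hd_append)
  then have z: "hd w = z" using prefix_hd[OF r0(2) \<open>r0 \<noteq> []\<close>] r by simp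
  have lf: "last f1 = last U" using suffix_last[OF ff(2) f1] .
  have inr1: "inr (last f1)" using lf LU Une by (simp add: L_def)
  have inr2: "inr (last w)" using Uw w by (simp add: L_def)
  have fe: "f = f1 @ w @ z # r" using ff r0 r by simp
  from f(1) consider x where "f = [x, bar x]" | d where "dir d" "forbd d f" unfolding forb_def by blast
  then show False
  proof cases
    case 1
    then have "length f = 2" by simp
    moreover have "length f = length f1 + length w + 1 + length r" using fe by simp
    moreover have "0 < length f1" "0 < length w" using f1 w by auto
    ultimately show False by linarith
  next
    case 2
    from forbd_pred[OF 2(1) 2(2)[unfolded fe] f1 w z _ inr1 inr2] t Une lf
    obtain a j where "inr a" "1 \<le> j" "f1 = [a]" "w = pw j (blk d a)" by auto
    then show False using c 2(1) Une lf by auto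
  qed
qed

lemma per_right:
  assumes wV: "L (w @ V)" and Uw: "L (U @ pw k w)" and w: "w \<noteq> []" and k: "2 \<le> k \<or> 1 \<le> k \<and> U \<noteq> [] \<and> last U = last w"
    and t: "V = [] \<or> hd V \<noteq> hd w"
  shows "L (U @ pw k w @ V) \<or> (\<exists>d a j. dir d \<and> inr a \<and> 1 \<le> j \<and> V \<noteq> [] \<and> hd V = bar a \<and> w = pw j (blk d a))"
proof -
  have Wa: "W w" "W V" "W U" using wV Uw by (auto simp: L_def)
  have m1: "L (mir V @ mir w)" using L_mir[OF wV] by simp
  have m2: "L (pw k (mir w) @ mir U)" using L_mir[OF Uw] by (simp add: mir_pw)
  have lm: "last (mir v) = neg (hd v)" if "v \<noteq> []" for v using that by (cases v) auto
  have hm: "hd (mir v) = neg (last v)" if "v \<noteq> []" for v using that by (cases v rule: rev_cases) auto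
  have k': "2 \<le> k \<or> 1 \<le> k \<and> mir U \<noteq> [] \<and> hd (mir U) = hd (mir w)" using k w by (auto simp: hm)
  have t': "mir V = [] \<or> last (mir V) \<noteq> last (mir w)"
  proof (cases "V = []")
    case False
    have "neg (hd V) \<noteq> neg (hd w)"
    proof
      assume "neg (hd V) = neg (hd w)"
      moreover have "inr (hd V)" "inr (hd w)" using Wa False w by auto
      ultimately have "hd V = hd w" by (metis neg_neg)
      then show False using t False by simp
    qed
    then show ?thesis using lm False w by simp
  qed simp
  from per_left[OF m1 m2 _ k' t'] w
  consider "L (mir V @ pw k (mir w) @ mir U)"
    | d a j where "dir d" "inr a" "1 \<le> j" "mir V \<noteq> []" "last (mir V) = a" "mir w = pw j (blk d a)" by auto
  then show ?thesis
  proof cases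
    case 1
    then have "L (mir (U @ pw k w @ V))" by (simp add: mir_pw)
    moreover have "W (U @ pw k w @ V)" using Wa W_pw[OF Wa(1)] by auto
    ultimately show ?thesis using L_mir_iff by blast
  next
    case 2
    have V: "V \<noteq> []" using 2 by auto
    have "mir (mir w) = pw j (blk d (bar (neg a)))" unfolding 2(6) using 2(1) by (simp add: mir_pw mir_blk)
    then have "w = pw j (blk d (bar (neg a)))" using mir_mir[OF Wa(1)] by simp
    moreover have "hd V = bar (bar (neg a))"
    proof -
      have "neg (hd V) = a" using 2(5) lm V by simp
      moreover have "inr (hd V)" using Wa V by auto
      ultimately show ?thesis by auto
    qed
    ultimately show ?thesis using 2 V inr_bar by blast
  qed
qed

text \<open>In the exceptional alternatives of \<open>per_left\<close> and \<open>per_right\<close>,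
  \<open>X\<close> is a power of a block of the last letter of \<open>Y\<close>; then
  \<open>Y @ X @ winv Y\<close> itself contains a forbidden factor.\<close>

lemma L_conj_pw:
  assumes X: "X \<noteq> []" "L (X @ X)" and YX: "L (Y @ X @ winv Y)"
  shows "L (Y @ pw (Suc k) X @ winv Y)"
proof (cases k)
  case 0
  then show ?thesis using YX by simp
next
  case (Suc k')
  let ?k = "Suc k"
  have k2: "2 \<le> ?k" using Suc by simp
  have WY: "W Y" using YX by (auto simp: L_def)
  have Lk: "L (pw ?k X)" by (rule L_pw[OF X(2)])
  have L1: "L (X @ winv Y)" "L (Y @ X)" using YX L_app2[of Y] L_app1[of "Y @ X" "winv Y"] by auto
  have hw: "hd (winv Y) = bar (last Y)" if "Y \<noteq> []" using that by (cases Y rule: rev_cases) (auto simp: winv_def)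
  have wne: "winv Y = [] \<longleftrightarrow> Y = []" by (simp add: winv_def)
  have nb: False if "Y \<noteq> []" "dir d" "inr a" "last Y = a" "X = pw j (blk d a)" for d a j
  proof -
    have "Y = butlast Y @ [a]" using that by (metis append_butlast_last_id)
    moreover have "winv Y = [bar a] @ tl (winv Y)" using hw that wne by (metis append_Cons append_Nil list.collapse)
    ultimately have "Y @ X @ winv Y = butlast Y @ (a # pw j (blk d a) @ [bar a]) @ tl (winv Y)" using that(5) by (metis append.assoc append_Cons append_Nil)
    then show False using YX not_L forb_F2[OF that(2,3)] by metis
  qed
  have wr: "winv Y = [] \<or> hd (winv Y) \<noteq> hd X"
  proof (rule ccontr)
    assume c: "\<not> ?thesis"
    then have Y: "Y \<noteq> []" "hd X = bar (last Y)" using hw wne by auto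
    then have "Y @ X = butlast Y @ [last Y, bar (last Y)] @ tl X" using X(1)
      by (metis append.assoc append_Cons append_Nil append_butlast_last_id list.collapse)
    moreover have "inr (last Y)" using WY Y by simp
    ultimately show False using L1(2) not_L forb_F1 by metis
  qed
  have wl: "Y = [] \<or> last Y \<noteq> last X"
  proof (rule ccontr)
    assume c: "\<not> ?thesis"
    then have Y: "Y \<noteq> []" "last X = last Y" by auto
    then have "X @ winv Y = butlast X @ [last Y, bar (last Y)] @ tl (winv Y)" using X(1) hw wne
      by (metis append.assoc append_Cons append_Nil append_butlast_last_id list.collapse)
    moreover have "inr (last Y)" using WY Y by simp
    ultimately show False using L1(1) not_L forb_F1 by metis
  qed
  have R: "L (pw ?k X @ winv Y)"
  proof -
    have "L ([] @ pw ?k X @ winv Y) \<or> (\<exists>d a j. dir d \<and> inr a \<and> 1 \<le> j \<and> winv Y \<noteq> [] \<and> hd (winv Y) = bar a \<and> X = pw j (blk d a))"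
      by (rule per_right[OF L1(1) _ X(1) _ wr]) (use Lk k2 in auto)
    then show ?thesis
    proof
      assume "\<exists>d a j. dir d \<and> inr a \<and> 1 \<le> j \<and> winv Y \<noteq> [] \<and> hd (winv Y) = bar a \<and> X = pw j (blk d a)"
      then obtain d a j where a: "dir d" "inr a" "winv Y \<noteq> []" "hd (winv Y) = bar a" "X = pw j (blk d a)" by blast
      then have Y: "Y \<noteq> []" "bar (last Y) = bar a" using hw wne by auto
      then have "last Y = a" using a(2) WY by (metis bar_bar last_in_set)
      then show ?thesis using nb Y a by blast
    qed simp
  qed
  have "L (Y @ pw ?k X @ winv Y) \<or> (\<exists>d a j. dir d \<and> inr a \<and> 1 \<le> j \<and> Y \<noteq> [] \<and> last Y = a \<and> X = pw j (blk d a))"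
    by (rule per_left[OF L1(2) R X(1) _ wl]) (use k2 in auto)
  then show ?thesis using nb by blast
qed

text \<open>The conclusion of the theorem in codes, with \<open>V\<close> for the cyclically
  irreducible word. The index \<open>k\<close> counts the copies of \<open>V\<close> and corresponds
  to the exponent \<open>k + 2\<close>.\<close>

definition Res :: "int list \<Rightarrow> int list \<Rightarrow> bool" where
  "Res Y X \<longleftrightarrow> (\<exists>i j X' V. 1 \<le> i \<and> i \<le> length X \<and> L X' \<and> eqv (drop i X @ take i X) X' \<and>
     1 \<le> j \<and> j \<le> length X' \<and> eqv (drop j X' @ take j X') V \<and> L (V @ V) \<and> length V = length X' \<and>
     (\<forall>k. L (Y @ take i X @ take j X' @ pw k V @ drop j X' @ drop i X @ winv Y)))"

text \<open>Takes \<open>i = length (A @ B)\<close> and \<open>j = length X'\<close>, so that the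
  second rotation is trivial and \<open>V = X' = m @ B\<close>.\<close>

lemma Res_loop:
  assumes X: "X = A @ B @ C" and ne: "A @ B \<noteq> []" and m: "eqv (C @ A) m" "L m" "m \<noteq> []"
    and WX: "W X" and l: "loopable (Y @ A) B (C @ winv Y) m"
  shows "Res Y X"
proof -
  have e: "eqv (drop (length (A @ B)) X @ take (length (A @ B)) X) (m @ B)"
    using eqv_app[OF m(1) eqv_refl[of B]] WX X by simp
  have LL: "L ((m @ B) @ (m @ B))" "\<And>k. L ((Y @ A) @ B @ pw (Suc k) (m @ B) @ C @ winv Y)"
    using l by (auto simp: loopable_def)
  have Lm: "L (m @ B)" using L_app1[OF LL(1)] .
  have e2: "eqv (drop (length (m @ B)) (m @ B) @ take (length (m @ B)) (m @ B)) (m @ B)"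
    using eqv_refl[of "m @ B"] Lm by (simp add: L_def)
  have "L (Y @ take (length (A @ B)) X @ take (length (m @ B)) (m @ B) @ pw k (m @ B) @
      drop (length (m @ B)) (m @ B) @ drop (length (A @ B)) X @ winv Y)" for k
    using LL(2)[of k] X by simp
  moreover have "1 \<le> length (A @ B)" using ne by (simp add: Suc_le_eq)
  moreover have "length (A @ B) \<le> length X" using X by simp
  moreover have "1 \<le> length (m @ B)" using m by (simp add: Suc_le_eq)
  ultimately show ?thesis unfolding Res_def
    using e e2 LL(1) Lm by (metis order_refl)
qed

text \<open>Takes \<open>j = 1\<close>: the second rotation moves exactly the letter
  \<open>a\<close>.\<close>

lemma Res_flip:
  assumes X: "X = A @ B @ C" and ne: "A @ B \<noteq> []" and m: "eqv (C @ A) m"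
    and WX: "W X" and l: "flippable (Y @ A) B (C @ winv Y) m"
  shows "Res Y X"
proof -
  obtain a n V where f: "m = a # n" "eqv (n @ B @ [a]) V" "L (V @ V)" "length V = length (m @ B)"
    "\<And>k. L ((Y @ A) @ B @ a # pw k V @ n @ B @ C @ winv Y)" using l by (auto simp: flippable_def)
  have e: "eqv (drop (length (A @ B)) X @ take (length (A @ B)) X) (m @ B)"
    using eqv_app[OF m(1) eqv_refl[of B]] WX X by simp
  have "L (((Y @ A) @ B) @ (m @ B) @ (C @ winv Y))" using f(5)[of 0] f(1) by simp
  then have Lm: "L (m @ B)" by (rule L_factor)
  have e2: "eqv (drop 1 (m @ B) @ take 1 (m @ B)) V" using f by simp
  have "L (Y @ take (length (A @ B)) X @ take 1 (m @ B) @ pw k V @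
      drop 1 (m @ B) @ drop (length (A @ B)) X @ winv Y)" for k
    using f(5)[of k] X f(1) by simp
  moreover have "1 \<le> length (A @ B)" using ne by (simp add: Suc_le_eq)
  moreover have "length (A @ B) \<le> length X" using X by simp
  moreover have "1 \<le> length (m @ B)" using f by simp
  ultimately show ?thesis unfolding Res_def
    using e e2 f(3,4) Lm by (metis order_refl)
qed

lemma Res_type0:
  assumes X: "X \<noteq> []" "L (X @ X)" and YX: "L (Y @ X @ winv Y)"
  shows "Res Y X"
proof -
  have WX: "W X" using X by (auto simp: L_def)
  have "L (Y @ X @ pw (Suc k) X @ winv Y)" for k using L_conj_pw[OF X YX, of "Suc k"] by simp
  then have "loopable (Y @ X) [] ([] @ winv Y) X" using X by (simp add: loopable_def)
  then show ?thesis
    using Res_loop[of X X "[]" "[]" X Y] X WX eqv_refl[OF WX] L_app1[OF X(2)] by simp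
qed

lemma Res_outcome:
  assumes X: "X = P @ Q @ S" and YX: "L (Y @ X @ winv Y)" and SP: "eqv (S @ P) [e]" and nXX: "\<not> L (X @ X)"
    and out: "outcome e (Y @ P) Q (S @ winv Y)"
  shows "Res Y X"
proof -
  obtain A2 B C2 m where o: "Q = A2 @ B @ C2" "eqv (C2 @ [e] @ A2) m" "L m" "m \<noteq> []"
    "loopable ((Y @ P) @ A2) B (C2 @ S @ winv Y) m \<or> flippable ((Y @ P) @ A2) B (C2 @ S @ winv Y) m"
    using out by (auto simp: outcome_def)
  have LX: "L X" using L_factor[OF YX] .
  then have WX: "W X" by (simp add: L_def)
  have X': "X = (P @ A2) @ B @ (C2 @ S)" using X o by simp
  have "eqv (C2 @ (S @ P) @ A2) (C2 @ [e] @ A2)"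
    by (rule eqv_ctx) (use SP WX X' in auto)
  then have em: "eqv ((C2 @ S) @ (P @ A2)) m" using eqv_trans[OF _ o(2)] by simp
  \<comment> \<open>Needed for \<open>1 <= i\<close>. If this part were empty, \<open>X\<close>
    would equal \<open>m\<close> by uniqueness, and both alternatives would make
    \<open>X @ X\<close> reduced.\<close>
  have ne: "(P @ A2) @ B \<noteq> []"
  proof
    assume a: "(P @ A2) @ B = []"
    then have "eqv X m" using em X' by simp
    then have "X = m" using L_unique[OF LX o(3)] by simp
    moreover have "L (m @ m)"
      using o(5)
    proof
      assume "loopable ((Y @ P) @ A2) B (C2 @ S @ winv Y) m"
      then show ?thesis using a by (simp add: loopable_def)
    next
      assume "flippable ((Y @ P) @ A2) B (C2 @ S @ winv Y) m"
      then obtain a' n V where "m = a' # n" "\<And>k. L (((Y @ P) @ A2) @ B @ a' # pw k V @ n @ B @ C2 @ S @ winv Y)"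
        by (auto simp: flippable_def)
      from this(2)[of 0] have "L (Y @ (m @ X) @ winv Y)" using a X' \<open>m = _\<close> by simp
      then have "L (m @ X)" by (rule L_factor)
      then show ?thesis using \<open>X = m\<close> by simp
    qed
    ultimately show False using nXX by simp
  qed
  have as: "(Y @ P) @ A2 = Y @ (P @ A2)" "C2 @ S @ winv Y = (C2 @ S) @ winv Y" by simp_all
  from o(5) show ?thesis
    unfolding as using Res_loop[OF X' ne em o(3,4) WX] Res_flip[OF X' ne em WX] by blast
qed

section \<open>Stacks of relator cells at the junction\<close>

text \<open>In both forms \<open>S @ P\<close> collapses to the letter \<open>bar a\<close> through a stack of \<open>M\<close> pairs of relator cells.
  Removing a maximal stack leaves a junction with a single letter.\<close>

definition stk :: "int \<Rightarrow> nat \<Rightarrow> int \<Rightarrow> int list \<Rightarrow> int list \<Rightarrow> bool" where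
  "stk d M a P S \<longleftrightarrow> dir d \<and> inr a \<and> 1 \<le> M \<and>
     ((S = pw M (blk d a) @ [bar a] \<and> P = pw M (blk d (bar a))) \<or>
      (S = pw M (blk d a) \<and> P = bar a # pw M (blk d (bar a))))"

lemma winv_blk: "dir d \<Longrightarrow> winv (blk d a) = blk (- d) a"
proof -
  assume d: "dir d"
  have "s d a (2 * int g - 1 + 2 * int g) = s d a (- 1)" by (rule s_period[OF d]) simp
  then show ?thesis using winv_run[OF d, of "s d a 1" "2 * g - 1"] g2 d by (simp add: blk_def of_nat_diff s_uminus)
qed

lemma winv_pw: "winv (pw k w) = pw k (winv w)"
  by (simp add: winv_def map_pw rev_pw)

text \<open>Moving \<open>bar a\<close> to the left turns the blocks of \<open>P\<close> into blocks
  of direction \<open>- d\<close>, which are the inverses of the blocks of \<open>S\<close> and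
  cancel against them.\<close>

lemma stk_eqv:
  assumes "stk d M a P S" shows "eqv (S @ P) [bar a]"
proof -
  have d: "dir d" and a: "inr a" using assms by (auto simp: stk_def)
  have SP: "S @ P = pw M (blk d a) @ ([bar a] @ pw M (blk d (bar a)))" using assms by (auto simp: stk_def)
  have "eqv ([bar a] @ pw M (blk d (bar a))) (pw M (blk (- d) a) @ [bar a])"
    using eqv_swaps[OF d, of "bar a" M] a by simp
  then have 1: "eqv (S @ P) (pw M (blk d a) @ (pw M (blk (- d) a) @ [bar a]))"
    unfolding SP by (rule eqv_app[OF eqv_refl[OF W_pw[OF W_blk]]])
  have "eqv (pw M (blk d a) @ pw M (blk (- d) a)) []"
    using eqv_winv[OF W_pw[OF W_blk[of d a]], of M] d by (simp add: winv_pw winv_blk)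
  then have "eqv ([] @ (pw M (blk d a) @ pw M (blk (- d) a)) @ [bar a]) ([] @ [bar a])"
    by (intro eqv_del) auto
  then have 2: "eqv (pw M (blk d a) @ (pw M (blk (- d) a) @ [bar a])) [bar a]" by simp
  show ?thesis by (rule eqv_trans[OF 1 2])
qed

lemma Lnot: "L w \<Longrightarrow> w = p @ f @ r \<Longrightarrow> forb f \<Longrightarrow> False"
  using not_L by blast

text \<open>A letter \<open>a\<close> at an end of \<open>Q\<close>, alone or separated from that
  end by one block, would either complete a forbidden factor with the blocks of the stack or, in the
  other form, produce half relators at two opposite letters in one direction; \<open>bad_bar\<close>
  makes one of these bad.\<close>

lemma stk_facts:
  assumes st: "stk d M a P S" and LX: "L (Y @ P @ Q @ S @ Z)"
  shows "P \<noteq> []" "S \<noteq> []" "last P = s d a (- 1)" "hd S = s d a 1"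
    "\<not> suffix [a] Q" "\<not> prefix [a] Q" "\<not> suffix [s d (bar a) 1] Q" "\<not> prefix [s d (bar a) (- 1)] Q"
    "sruns d (bar a) Q r \<Longrightarrow> r \<le> 2 * g - 1" "pruns d (bar a) Q r \<Longrightarrow> r \<le> 2 * g - 1"
proof -
  have d: "dir d" and a: "inr a" and M: "1 \<le> M" using st by (auto simp: stk_def)
  obtain M' where M': "M = Suc M'" using M by (cases M) auto
  have per: "s d (bar a) (2 * int g - 1) = s d a (- 1)"
    using d s_period[OF d, of "4 * int g - 1" "- 1" a] by simp
  have "length (blk d z) = 2 * g - 1" for z by (simp add: blk_def)
  then have "blk d z \<noteq> []" for z using g2 by fastforce
  then have bn: "pw M (blk d z) \<noteq> []" for z using M' by simp
  show P: "P \<noteq> []" and S: "S \<noteq> []"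
    using st bn[of a] bn[of "bar a"] unfolding stk_def by (metis append_is_Nil_conv list.distinct(1))+
  show lP: "last P = s d a (- 1)" using st M per by (auto simp: stk_def)
  show hS: "hd S = s d a 1" using st M by (auto simp: stk_def hd_append)
  \<comment> \<open>In either form one of the two half relators around the letter is good, which bounds the runs of \<open>Q\<close>.\<close>
  have full: False if "w @ S = x1 @ run d a (2 * g) @ x2" "sublist (P @ w @ S) (Y @ P @ Q @ S @ Z)" "S = pw M (blk d a)" for w x1 x2
  proof -
    have "L (P @ w @ S)" using L_sublist[OF LX that(2)] .
    moreover have "P = run d (bar a) (2 * g) @ pw M' (blk d (bar a))"
      using st that(3) M' Cons_blk[OF inr_bar, of a d] by (auto simp: stk_def)
    ultimately have "\<not> bad d (bar a)" "\<not> bad d a"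
      using Lnot[of "P @ w @ S" "[]" "run d (bar a) (2 * g)" "pw M' (blk d (bar a)) @ w @ S"] forb_F3[OF d inr_bar, of a]
        Lnot[of "P @ w @ S" "P @ x1" "run d a (2 * g)" x2] forb_F3[OF d a] that(1) by auto
    then show False using bad_bar[OF d a] by simp
  qed
  have noa: False if "Q = q @ a # t" "t = [] \<or> t = blk d a" for q t
  proof -
    from st consider "S = pw M (blk d a) @ [bar a]" | "S = pw M (blk d a)" by (auto simp: stk_def)
    then show False
    proof cases
      case 1
      have "a # t @ S = a # pw (if t = [] then M else Suc M) (blk d a) @ [bar a]" using 1 that(2) by auto
      then have "Y @ P @ Q @ S @ Z = (Y @ P @ q) @ (a # pw (if t = [] then M else Suc M) (blk d a) @ [bar a]) @ Z"
        using that(1) by simp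
      then show False using Lnot[OF LX] forb_F2[OF d a] by metis
    next
      case 2
      have "\<exists>x2. Q @ S = q @ run d a (2 * g) @ x2"
      proof (cases "t = []")
        case True
        then have "Q @ S = q @ run d a (2 * g) @ pw M' (blk d a)" using that(1) 2 M' Cons_blk[OF a, of d, symmetric] by simp
        then show ?thesis by blast
      next
        case False
        then have "Q @ S = q @ run d a (2 * g) @ S" using that Cons_blk[OF a, of d, symmetric] by simp
        then show ?thesis by blast
      qed
      then obtain x2 where "Q @ S = q @ run d a (2 * g) @ x2" by blast
      moreover have "Y @ P @ Q @ S @ Z = Y @ (P @ Q @ S) @ Z" by simp
      then have "sublist (P @ Q @ S) (Y @ P @ Q @ S @ Z)" unfolding sublist_def by blast
      ultimately show False using full 2 by blast
    qed
  qed
  have nob: False if "Q = t @ a # q" "t = [] \<or> t = blk d (bar a)" for q t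
  proof -
    from st consider "S = pw M (blk d a) @ [bar a]" "P = pw M (blk d (bar a))" | "P = bar a # pw M (blk d (bar a))" by (auto simp: stk_def)
    then show False
    proof cases
      case 2
      have "P @ t @ [a] = bar a # pw (if t = [] then M else Suc M) (blk d (bar a)) @ [bar (bar a)]"
        using 2 that(2) a by (auto simp: pw_comm)
      then have "Y @ P @ Q @ S @ Z = Y @ (bar a # pw (if t = [] then M else Suc M) (blk d (bar a)) @ [bar (bar a)]) @ (q @ S @ Z)"
        using that(1) by (metis append.assoc append_Cons append_Nil)
      then show False using Lnot[OF LX] forb_F2[OF d inr_bar] by metis
    next
      case 1
      define b where "b = s d a 1"
      have b: "inr b" "bar b = s d (bar a) 1" using d by (simp_all add: b_def bar_s[of d] add.commute)
      have "blk d (bar a) @ [a] = run d (bar b) (2 * g)" using blk_snoc_run[OF d, of "bar a"] a b by simp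
      moreover have "\<exists>t1. P @ t @ [a] = t1 @ blk d (bar a) @ [a]" using 1 M' that(2) by (auto simp: pw_comm)
      ultimately obtain t1 where t1: "P @ t @ [a] = t1 @ run d (bar b) (2 * g)" by auto
      have "blk d a @ [bar a] = run d b (2 * g)" using blk_snoc_run[OF d a] b_def by simp
      then have "S = pw M' (blk d a) @ run d b (2 * g)" using 1 M' by (simp add: pw_comm)
      then have e1: "Y @ P @ Q @ S @ Z = (Y @ P @ Q @ pw M' (blk d a)) @ run d b (2 * g) @ Z" by simp
      have e2: "Y @ P @ Q @ S @ Z = (Y @ t1) @ run d (bar b) (2 * g) @ (q @ S @ Z)"
        using t1 that(1) by (metis append.assoc append_Cons append_Nil)
      have "\<not> bad d b" "\<not> bad d (bar b)"
        using Lnot[OF LX e1] Lnot[OF LX e2] forb_F3[OF d b(1)] forb_F3[OF d inr_bar, of b] by auto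
      then show False using bad_bar[OF d b(1)] by simp
    qed
  qed
  show "\<not> suffix [a] Q" using noa by (auto simp: suffix_def)
  show "\<not> prefix [a] Q" using nob by (auto simp: prefix_def)
  show "\<not> suffix [s d (bar a) 1] Q"
  proof
    assume "suffix [s d (bar a) 1] Q"
    then obtain q where q: "Q = q @ [s d (bar a) 1]" by (auto simp: suffix_def)
    define y where "y = s d (bar a) 1"
    have "bar y = s d a 1" using d s_period[OF d, of "4 * int g + 1" 1 a] by (simp add: y_def)
    then have "S = bar y # tl S" using hS S by (cases S) auto
    then have "Y @ P @ Q @ S @ Z = (Y @ P @ q) @ [y, bar y] @ (tl S @ Z)" using q y_def by (metis append.assoc append_Cons append_Nil)
    then show False using Lnot[OF LX] forb_F1[of y] y_def by (metis inr_s)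
  qed
  show "\<not> prefix [s d (bar a) (- 1)] Q"
  proof
    assume "prefix [s d (bar a) (- 1)] Q"
    then obtain q where q: "Q = s d (bar a) (- 1) # q" by (auto simp: prefix_def)
    define y where "y = s d a (- 1)"
    have "bar y = s d (bar a) (- 1)" using d by (simp add: y_def add.commute)
    moreover have "P = butlast P @ [y]" using lP P y_def by (metis append_butlast_last_id)
    ultimately have "Y @ P @ Q @ S @ Z = (Y @ butlast P) @ [y, bar y] @ (q @ S @ Z)" using q by (metis append.assoc append_Cons append_Nil)
    then show False using Lnot[OF LX] forb_F1[of y] y_def by (metis inr_s)
  qed
  show "r \<le> 2 * g - 1" if "sruns d (bar a) Q r"
  proof (rule ccontr)
    assume "\<not> r \<le> 2 * g - 1"
    then have "sruns d (bar a) Q (2 * g)" using sruns_le[OF that, of "2 * g"] by simp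
    moreover have "s d (bar a) (- int (2 * g)) = a" using d a by simp
    ultimately have "suffix (run d a (2 * g)) Q" by (simp add: sruns_def)
    then obtain q where "Q = q @ a # blk d a" using Cons_blk[OF a, of d] by (auto simp: suffix_def)
    then show False using noa by blast
  qed
  show "r \<le> 2 * g - 1" if "pruns d (bar a) Q r"
  proof (rule ccontr)
    assume "\<not> r \<le> 2 * g - 1"
    then have "pruns d (bar a) Q (2 * g)" using pruns_le[OF that, of "2 * g"] by simp
    then have "prefix (blk d (bar a) @ [a]) Q" using blk_snoc_run[OF d, of "bar a"] a by (simp add: pruns_def)
    then obtain q where "Q = blk d (bar a) @ a # q" by (auto simp: prefix_def)
    then show False using nob by blast
  qed
qed

lemma forb_across:
  assumes "L u" "L v" "\<not> L (u @ v)"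
  obtains f1 f2 where "forb (f1 @ f2)" "suffix f1 u" "prefix f2 v" "f1 \<noteq> []" "f2 \<noteq> []"
proof -
  have "W (u @ v)" using assms by (auto simp: L_def)
  then obtain f where f: "forb f" "sublist f (u @ v)" using assms(3) by (auto simp: L_def)
  moreover have "\<not> sublist f u" "\<not> sublist f v" using assms f(1) by (auto simp: L_def)
  ultimately show thesis using that unfolding sublist_append
    by (metis append.right_neutral append_Nil prefix_imp_sublist suffix_imp_sublist)
qed

lemma forb_pair:
  assumes "forb (f1 @ f2)" "f1 \<noteq> []" "f2 \<noteq> []" "hd f2 \<noteq> bar (last f1)"
  obtains d where "dir d" "forbd d (f1 @ f2)" "adj d (last f1) (hd f2)"
proof -
  have "\<not> (\<exists>x. inr x \<and> f1 @ f2 = [x, bar x])"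
    using assms(2-4) by (auto simp: append_eq_Cons_conv)
  then obtain d where d: "dir d" "forbd d (f1 @ f2)" using assms(1) by (auto simp: forb_def)
  then show thesis using that forbd_adj[OF d assms(2,3)] by blast
qed

lemma glue_nonadj:
  assumes "L u" "L v" "u \<noteq> []" "v \<noteq> []" "hd v \<noteq> bar (last u)" "\<And>d. dir d \<Longrightarrow> \<not> adj d (last u) (hd v)"
  shows "L (u @ v)"
proof (rule ccontr)
  assume "\<not> L (u @ v)"
  then obtain f1 f2 where f: "forb (f1 @ f2)" "suffix f1 u" "prefix f2 v" "f1 \<noteq> []" "f2 \<noteq> []"
    using forb_across[OF assms(1,2)] by blast
  have "last f1 = last u" "hd f2 = hd v" using suffix_last[OF f(2,4)] prefix_hd[OF f(3,5)] by auto
  then show False using forb_pair[OF f(1,4,5)] assms(5,6) by metis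
qed

lemma run_around:
  "inr e \<Longrightarrow> run d (s d e (- int n)) n @ [e] @ run d (s d e 1) m = run d (s d e (- int n)) (n + Suc m)"
  using run_append[of d "s d e (- int n)" n "Suc m"] run_Suc[of e d m] by simp

lemma Nil_eq_pw: "[] = pw k u \<longleftrightarrow> k = 0 \<or> u = []"
  by (metis pw_eq_Nil)

lemma Nil_neq_blk: "[] \<noteq> blk d x"
  by (metis blk_neq_Nil)

lemma pw_slide: "pw k (u @ v) @ u = u @ pw k (v @ u)"
  by (induction k) auto

text \<open>Blocks have at least three letters, so a strip has no two consecutive block boundaries,
  and its first and last steps are unit steps. Each of its letters therefore has a neighbour at a
  unit step.\<close>

lemma forbd_turn:
  assumes d: "dir d" and e: "inr e" and f: "forbd d (C @ [e] @ A)"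
    and C: "C \<noteq> [] \<Longrightarrow> last C \<noteq> s d e (- 1)" and A: "A \<noteq> [] \<Longrightarrow> hd A \<noteq> s d e 1"
  shows False
proof (cases "C = []")
  case True
  have "length (C @ [e] @ A) \<noteq> 1" using f g2 by (auto simp: forbd_def Nil_neq_blk)
  then have Ane: "A \<noteq> []" using True by auto
  have f': "forbd d ([e] @ A)" using f True by simp
  have "hd A = s d (last [e]) (2 * int g + 2)" using forbd_adj[OF d f' _ Ane] A[OF Ane] by (simp add: adj_def)
  then obtain x k where "1 \<le> k" "[e] = x # pw k (blk d x)" using forbd_break[OF d f' _ Ane] by auto
  then show False by (simp add: Nil_eq_pw)
next
  case False
  have a: "adj d (last C) e" using forbd_adj[OF d f False] by simp
  have "e \<noteq> s d (last C) 1"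
  proof
    assume h: "e = s d (last C) 1"
    obtain x k where x: "inr x" "C @ [e] @ A = x # pw k (blk d x) @ [bar x] \<or> C @ [e] @ A = x # blk d x"
      using f by (auto simp: forbd_def)
    have "W (x # pw k (blk d x) @ [bar x])" "W (x # blk d x)" using x(1) W_pw[OF W_blk[of d x], of k] W_blk[of d x] by auto
    then have "W (C @ [e] @ A)" using x(2) by metis
    then have "inr (last C)" using False by simp
    then show False using C[OF False] h by simp
  qed
  then have "hd ([e] @ A) = s d (last C) (2 * int g + 2)" using a by (simp add: adj_def)
  then obtain x k where x: "inr x" "1 \<le> k" "[e] @ A = pw k (blk d x) @ [bar x]"
    using forbd_break[OF d f False] by auto
  obtain k' where k': "k = Suc k'" using x(2) by (cases k) auto
  have n: "2 * g - 1 = Suc (2 * g - 2)" using g2 by simp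
  have "blk d x = s d x 1 # run d (s d x 2) (2 * g - 2)" unfolding blk_def n by (subst run_Suc) auto
  then have "e = s d x 1" "A = run d (s d x 2) (2 * g - 2) @ pw k' (blk d x) @ [bar x]" using x(3) k' by auto
  moreover have "0 < 2 * g - 2" using g2 by simp
  ultimately have "A \<noteq> []" "hd A = s d e 1" by (auto simp: hd_append)
  then show False using A by blast
qed

text \<open>The junction letter \<open>e\<close> is the last letter of \<open>X\<close>, and the
  step from \<open>e\<close> to \<open>hd X\<close> determines the direction. The absence of stacks
  serves to bound the run through \<open>e\<close>.\<close>

lemma res_no_stack:
  assumes YX: "L (Y @ X @ winv Y)" and X: "X \<noteq> []" "hd X \<noteq> bar (last X)" "\<not> L (X @ X)"
    and ns: "\<And>d M a P Q S. stk d M a P S \<Longrightarrow> X \<noteq> P @ Q @ S"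
  shows "Res Y X"
proof -
  obtain Q e where XQ: "X = Q @ [e]" using X(1) by (cases X rule: rev_cases) auto
  have LX: "L X" using L_factor[OF YX] .
  have e: "inr e" using LX XQ by (simp add: L_def)
  have LQ: "L Q" using LX XQ L_app1 by blast
  obtain f1 f2 where f: "forb (f1 @ f2)" "suffix f1 X" "prefix f2 X" "f1 \<noteq> []" "f2 \<noteq> []"
    using forb_across[OF LX LX X(3)] .
  have lf: "last f1 = e" using suffix_last[OF f(2,4)] XQ by simp
  have hf: "hd f2 = hd X" using prefix_hd[OF f(3,5)] .
  have "f2 \<noteq> X"
  proof
    assume a: "f2 = X"
    have "hd f1 \<in> set X" using f(2,4) set_mono_suffix by (metis hd_in_set subsetD)
    then have "hd (f1 @ f2) \<in> set (tl (f1 @ f2))" using f(4) a by (cases f1) auto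
    then show False using forb_hd[OF f(1)] by blast
  qed
  then have p2: "prefix f2 Q" using f(3) XQ by (auto simp: prefix_snoc)
  have Qne: "Q \<noteq> []" using p2 f(5) by auto
  have hq: "hd f2 = hd Q" using prefix_hd[OF p2 f(5)] .
  have nb: "hd f2 \<noteq> bar (last f1)" using hf lf X(2) XQ by simp
  obtain d where d: "dir d" "forbd d (f1 @ f2)" "adj d (last f1) (hd f2)" using forb_pair[OF f(1,4,5) nb] .
  then have ad: "adj d e (hd Q)" using lf hq by simp
  define C' where "C' = butlast f1"
  have C: "f1 = C' @ [e]" using f(4) lf C'_def by (metis append_butlast_last_id)
  have sC: "suffix C' Q" using f(2) C XQ by simp
  have be: "s d e (- (2 * int g)) = bar e" using d(1) s_period[OF d(1), of "2 * int g" "- (2 * int g)" e] bar_s[of d e] by simp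
  have rs: "r \<le> 2 * g - 1" if "sruns d e Q r" for r
  proof (rule ccontr)
    assume "\<not> r \<le> 2 * g - 1"
    then have "sruns d e Q (2 * g)" using sruns_le[OF that, of "2 * g"] by simp
    then have "suffix (bar e # blk d (bar e)) Q" using be Cons_blk[of "bar e" d] by (simp add: sruns_def)
    then obtain q where "Q = q @ bar e # blk d (bar e)" by (auto simp: suffix_def)
    then have "X = q @ (bar e # pw 1 (blk d (bar e)) @ [bar (bar e)]) @ []" using XQ e by simp
    then show False using Lnot[OF LX] forb_F2[OF d(1) inr_bar] by blast
  qed
  have rp: "r \<le> 2 * g" if "pruns d e Q r" for r
  proof (rule ccontr)
    assume "\<not> r \<le> 2 * g"
    then have "pruns d e Q (Suc (2 * g))" using pruns_le[OF that, of "Suc (2 * g)"] by simp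
    moreover have "run d (s d e 1) (Suc (2 * g)) = s d e 1 # pw 1 (blk d (s d e 1)) @ [bar (s d e 1)]"
      using run_Suc2[of d "s d e 1" "2 * g"] Cons_blk[of "s d e 1" d] d(1) by simp
    ultimately obtain q where "Q = [] @ (s d e 1 # pw 1 (blk d (s d e 1)) @ [bar (s d e 1)]) @ q"
      by (auto simp: pruns_def prefix_def)
    then show False using Lnot[OF LQ] forb_F2[OF d(1) inr_s] by blast
  qed
  have dec: "\<exists>B. Q = run d (s d e 1) m @ B @ run d (s d e (- int n)) n"
    if "sruns d e Q n" "pruns d e Q m" "n + Suc m \<le> 4 * g" for n m
    using no_overlap[of "run d (s d e (- int n)) n" Q "run d (s d e 1) m" e] that
      run_hd_notin[OF d(1) that(3), of "s d e (- int n)"] run_around[OF e, of d n m]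
    by (simp add: sruns_def pruns_def)
  have sum: "r1 + r2 \<le> 4 * g - 3" if r: "sruns d e Q r1" "pruns d e Q r2" for r1 r2
  proof (rule ccontr)
    assume c: "\<not> r1 + r2 \<le> 4 * g - 3"
    \<comment> \<open>The only ways to exceed the bound, given \<open>rs\<close> and
      \<open>rp\<close>. They exhibit a stack with \<open>M = 1\<close> in its first and second
      form, respectively.\<close>
    consider "2 * g - 1 \<le> r1" "2 * g - 1 \<le> r2" | "2 * g - 2 \<le> r1" "2 * g \<le> r2"
      using c rs[OF r(1)] rp[OF r(2)] g2 by linarith
    then show False
    proof cases
      case 1
      have "\<exists>B. Q = run d (s d e 1) (2 * g - 1) @ B @ run d (s d e (- int (2 * g - 1))) (2 * g - 1)"
        by (rule dec) (use sruns_le[OF r(1) 1(1)] pruns_le[OF r(2) 1(2)] g2 in auto)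
      moreover have "s d e (- int (2 * g - 1)) = s d (bar e) 1"
        using d(1) g2 s_period[OF d(1), of "2 * int g + 1" "1 - 2 * int g" e] by (simp add: of_nat_diff)
      ultimately obtain B where "Q = blk d e @ B @ blk d (bar e)" by (auto simp: blk_def)
      then have "X = pw 1 (blk d (bar (bar e))) @ B @ (pw 1 (blk d (bar e)) @ [bar (bar e)])" using XQ e by simp
      moreover have "stk d 1 (bar e) (pw 1 (blk d (bar (bar e)))) (pw 1 (blk d (bar e)) @ [bar (bar e)])"
        using d(1) by (simp add: stk_def)
      ultimately show False using ns by blast
    next
      case 2
      have "\<exists>B. Q = run d (s d e 1) (2 * g) @ B @ run d (s d e (- int (2 * g - 2))) (2 * g - 2)"
        by (rule dec) (use sruns_le[OF r(1) 2(1)] pruns_le[OF r(2) 2(2)] g2 in auto)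
      then obtain B where B: "Q = run d (s d e 1) (2 * g) @ B @ run d (s d e (- int (2 * g - 2))) (2 * g - 2)" by blast
      define b where "b = s d e (1 - 2 * int g)"
      have b: "inr b" "bar b = s d e 1" using d(1) by (simp_all add: b_def)
      have "s d b 1 = s d e (- int (2 * g - 2))" using g2 by (simp add: b_def of_nat_diff)
      moreover have "2 * g - 2 + Suc 0 = 2 * g - 1" using g2 by simp
      ultimately have "run d (s d e (- int (2 * g - 2))) (2 * g - 2) @ [e] = blk d b"
        using run_around[OF e, of d "2 * g - 2" 0] by (simp add: blk_def)
      then have "X = (bar b # pw 1 (blk d (bar b))) @ B @ pw 1 (blk d b)"
        using XQ B Cons_blk[of "bar b" d] b by simp
      moreover have "stk d 1 b (bar b # pw 1 (blk d (bar b))) (pw 1 (blk d b))" using d(1) b by (simp add: stk_def)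
      ultimately show False using ns by blast
    qed
  qed
  have LYQ: "L ((Y @ Q) @ [e])" using YX L_app1[of "(Y @ Q) @ [e]" "winv Y"] XQ by simp
  have gs: "good_sides d e Y Q ([e] @ winv Y)"
    unfolding good_sides_def
  proof (intro conjI allI impI)
    show "L (Y @ Q @ [e] @ winv Y)" using YX XQ by simp
    show "weak d (Y @ Q) e" by (rule weak_of_L[OF d(1) e LYQ])
    show "weak d (mir (Q @ [e] @ winv Y)) (neg e)"
    proof (rule weak_hd[OF d(1) _ e])
      show "W (Q @ [e] @ winv Y)" using YX XQ by (auto simp: L_def)
      have "hd Q \<noteq> s d e (- 1)" using ad d(1) gi by (auto simp: adj_def s_eq8)
      then show "Q @ [e] @ winv Y = [] \<or> hd (Q @ [e] @ winv Y) \<noteq> bar e \<and> hd (Q @ [e] @ winv Y) \<noteq> s d e (- 1)"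
        using Qne adj_not_bar[OF d(1) ad] by simp
    qed
    show "Y \<noteq> [] \<and> last Y = s d e (2 * int g - 1) \<or> L (Q @ [e])" using LX XQ by simp
  qed (use sum rs in auto)
  have "outcome e Y Q ([e] @ winv Y)"
    by (rule outcome_of_forbd[OF d(1) e gs d(2) _ sC p2]) (simp add: C)
  then show ?thesis
    using Res_outcome[of X "[]" Q "[e]" Y e] XQ YX X(3) eqv_refl[of "[e]"] e by simp
qed

lemma forb_around:
  assumes Q: "L Q" and e: "inr e" and n: "\<not> L (Q @ [e] @ Q)"
  obtains C A where "forb (C @ [e] @ A)" "suffix C Q" "prefix A Q"
proof -
  have "W (Q @ [e] @ Q)" using Q e by (auto simp: L_def)
  then obtain f where f: "forb f" "sublist f (Q @ e # Q)" using n by (auto simp: L_def)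
  have nf: "\<not> sublist f Q" using Q f(1) by (auto simp: L_def)
  have "\<exists>f1 f2. f = f1 @ f2 \<and> suffix f1 Q \<and> prefix f2 (e # Q)"
  proof (cases "sublist f (e # Q)")
    case True
    then have "f = [] @ f" "suffix [] Q" "prefix f (e # Q)" using nf sublist_ConsD[of f e Q] by auto
    then show ?thesis by blast
  next
    case False
    then show ?thesis using f(2) nf unfolding sublist_append by blast
  qed
  then obtain f1 f2 where ff: "f = f1 @ f2" "suffix f1 Q" "prefix f2 (e # Q)" by blast
  have "f2 \<noteq> []" using ff nf by auto
  then obtain A where "f2 = e # A" "prefix A Q" using ff(3) by (auto simp: prefix_Cons)
  then show thesis using that[of f1 A] f(1) ff by simp
qed

text \<open>A new forbidden factor must contain the last letter \<open>e\<close>. In direction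
  \<open>- d\<close> neither neighbour step at \<open>e\<close> is a unit step; in direction
  \<open>d\<close> it would start a block of \<open>e\<close> right after the junction and hence end
  in \<open>bar e\<close> instead of \<open>e\<close>.\<close>

lemma glue_end:
  assumes d: "dir d" and e: "inr e" and uQ: "L (u @ Q)" and Qe: "L (Q @ [e])"
    and u: "u \<noteq> []" "last u = s d e (2 * int g - 1)"
    and Q: "Q = [] \<or> last Q \<noteq> s d e 1" "Q = [] \<or> hd Q \<noteq> bar e"
  shows "L (u @ Q @ [e])"
proof (rule ccontr)
  assume n: "\<not> L (u @ Q @ [e])"
  have Lu: "L u" using uQ L_app1 by blast
  obtain f1 f2 where f: "forb (f1 @ f2)" "suffix f1 u" "prefix f2 (Q @ [e])" "f1 \<noteq> []" "f2 \<noteq> []"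
    using forb_across[OF Lu Qe n] .
  have "\<not> prefix f2 Q"
  proof
    assume "prefix f2 Q"
    then have "sublist (f1 @ f2) (u @ Q)" using f(2) unfolding sublist_append by blast
    then show False using uQ f(1) by (auto simp: L_def)
  qed
  then have f2: "f2 = Q @ [e]" using f(3) by (auto simp: prefix_snoc)
  have lf: "last f1 = s d e (2 * int g - 1)" using suffix_last[OF f(2,4)] u by simp
  have ne1: "e \<noteq> s d e i" if "0 < i" "i < 4 * int g" for i using eq_s_self8[OF e d, of i] that by auto
  have nb: "hd f2 \<noteq> bar (last f1)"
  proof (cases "Q = []")
    case True
    then show ?thesis using lf f2 d ne1[of "4 * int g - 1"] gi by (simp add: algebra_simps)
  next
    case False
    show ?thesis
    proof
      assume h: "hd f2 = bar (last f1)"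
      then have "Q = bar (last u) # tl Q" using u lf f2 False by (cases Q) auto
      moreover have "butlast u @ [last u] = u" using u(1) by (rule append_butlast_last_id)
      ultimately have "u @ Q = butlast u @ [last u, bar (last u)] @ tl Q" by (metis append.assoc append_Cons append_Nil)
      then show False using Lnot[OF uQ] forb_F1[of "last u"] u by (metis inr_s)
    qed
  qed
  obtain d' where d': "dir d'" "forbd d' (f1 @ f2)" "adj d' (last f1) (hd f2)" using forb_pair[OF f(1,4,5) nb] .
  from dir_cases[OF d d'(1)] show False
  proof
    assume "d' = - d"
    then have fd: "forbd (- d) ((f1 @ Q) @ [e] @ [])" using d' f2 by simp
    have "last (f1 @ Q) \<noteq> s d e 1" using Q(1) lf d gi by (cases "Q = []") (auto simp: s_eq4)
    then show False using forbd_turn[OF _ e fd] d by (simp add: s_uminus)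
  next
    assume dd: "d' = d"
    have h1: "hd f2 \<noteq> s d (last f1) 1"
    proof
      assume h: "hd f2 = s d (last f1) 1"
      then have "hd f2 = bar e" using lf bar_s[OF d, of e] by simp
      then show False using Q(2) f2 e bar_s[OF d, of e] ne1[of "2 * int g"] gi by (cases "Q = []") auto
    qed
    then have h2: "hd f2 = s d (last f1) (2 * int g + 2)" using d'(3) dd by (simp add: adj_def)
    then obtain x k where x: "inr x" "1 \<le> k" "f2 = pw k (blk d x) @ [bar x]"
      using forbd_break[OF d _ f(4,5)] d'(2) dd by blast
    have "hd f2 = s d x 1" using x by (simp add: hd_append)
    moreover have "hd f2 = s d e 1" using h2 lf s_period[OF d, of "4 * int g + 1" 1 e] by simp
    ultimately have "x = e" using x(1) e by (simp add: s_move)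
    then have "e = bar e" using f2 x(3) by simp
    then show False using e bar_s[OF d, of e] ne1[of "2 * int g"] gi by auto
  qed
qed

lemma glue_start:
  assumes d: "dir d" and e: "inr e" and Qv: "L (Q @ v)" and eQ: "L ([e] @ Q)"
    and v: "v \<noteq> []" "hd v = s d e (2 * int g + 1)"
    and Q: "Q = [] \<or> hd Q \<noteq> s d e (- 1)" "Q = [] \<or> last Q \<noteq> bar e"
  shows "L ([e] @ Q @ v)"
proof -
  have WQ: "W Q" "W v" using Qv by (auto simp: L_def)
  have lm: "last (mir w) = neg (hd w)" if "w \<noteq> []" for w using that by (cases w) auto
  have hm: "hd (mir w) = neg (last w)" if "w \<noteq> []" for w using that by (cases w rule: rev_cases) auto
  have inj: "neg p = neg q \<Longrightarrow> p = q" if "inr p" "inr q" for p q using that by (metis neg_neg)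
  have "L (mir v @ mir Q @ [neg e])"
  proof (rule glue_end[OF d])
    show "L (mir v @ mir Q)" using L_mir[OF Qv] by simp
    show "L (mir Q @ [neg e])" using L_mir[OF eQ] by simp
    show "last (mir v) = s d (neg e) (2 * int g - 1)"
      using lm v neg_s[of d e "2 * int g + 1"] s_period[OF d, of "2 * int g - 1" "- 1 - 2 * int g" "neg e"] by (simp add: algebra_simps)
    show "mir Q = [] \<or> last (mir Q) \<noteq> s d (neg e) 1"
      using Q(1) lm neg_s[of d e "- 1"] inj[of "hd Q" "s d e (- 1)"] WQ(1) by (cases "Q = []") auto
    show "mir Q = [] \<or> hd (mir Q) \<noteq> bar (neg e)"
      using Q(2) hm inj[of "last Q" "bar e"] WQ(1) by (cases "Q = []") auto
  qed (use v in auto)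
  then have "L (mir ([e] @ Q @ v))" by simp
  moreover have "W ([e] @ Q @ v)" using WQ e by auto
  ultimately show ?thesis using L_mir_iff by blast
qed

lemma pw_rot: "u @ pw t (v @ u) @ v = pw (Suc t) (u @ v)"
  by (induction t) auto

text \<open>The stack collapses to \<open>e = bar a\<close>. A forbidden factor around
  \<open>e\<close> must have the direction \<open>d\<close> of the stack, since
  \<open>stk_facts\<close> leaves no unit step of direction \<open>- d\<close> at \<open>e\<close>,
  and maximality of \<open>M\<close> bounds its runs. Without such a factor the single letter
  \<open>e\<close> is already a reduced junction.\<close>

lemma res_stack:
  assumes YX: "L (Y @ X @ winv Y)" and nXX: "\<not> L (X @ X)"
    and st: "stk d M a P S" and XX: "X = P @ Q @ S"
    and mx: "\<And>P' Q' S'. stk d (Suc M) a P' S' \<Longrightarrow> X \<noteq> P' @ Q' @ S'"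
  shows "Res Y X"
proof -
  have d: "dir d" and a: "inr a" using st by (auto simp: stk_def)
  define e where "e = bar a"
  have e: "inr e" "bar e = a" using a by (auto simp: e_def)
  define Z where "Z = winv Y"
  have LX: "L (Y @ P @ Q @ S @ Z)" using YX XX Z_def by simp
  note fc = stk_facts[OF st LX, folded e_def]
  have lP: "last P = s d e (2 * int g - 1)"
    using fc(3) d s_period[OF d, of "4 * int g - 1" "- 1" a] by (simp add: e_def)
  have hS: "hd S = s d e (2 * int g + 1)"
    using fc(4) d s_period[OF d, of "4 * int g + 1" 1 a] by (simp add: e_def)
  have sx: "suffix [last Q] Q" "prefix [hd Q] Q" if "Q \<noteq> []"
    using that by (metis append_butlast_last_id suffixI, metis append_Cons append_Nil list.collapse prefixI)
  have lQ: "last Q \<noteq> a" "last Q \<noteq> s d e 1" "hd Q \<noteq> a" "hd Q \<noteq> s d e (- 1)" if "Q \<noteq> []"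
    using sx[OF that] fc(5-8) by auto
  have SP: "eqv (S @ P) [e]" using stk_eqv[OF st] e_def by simp
  have LQ: "L Q" using LX L_app1 L_app2 by (metis append.assoc)
  have ne1: "e \<noteq> s d e i" if "- (4 * int g) < i" "i < 4 * int g" "i \<noteq> 0" for i
    using eq_s_self8[OF e(1) d, of i] that by auto
  show ?thesis
  proof (cases "L (Q @ [e] @ Q)")
    case False
    obtain C A where CA: "forb (C @ [e] @ A)" "suffix C Q" "prefix A Q" using forb_around[OF LQ e(1) False] .
    have lC: "C \<noteq> [] \<Longrightarrow> last C = last Q" "A \<noteq> [] \<Longrightarrow> hd A = hd Q" using suffix_last[OF CA(2)] prefix_hd[OF CA(3)] by auto
    have Qn: "C \<noteq> [] \<Longrightarrow> Q \<noteq> []" "A \<noteq> [] \<Longrightarrow> Q \<noteq> []" using CA by auto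
    have "C @ [e] @ A \<noteq> [x, bar x]" if "inr x" for x
    proof
      assume h: "C @ [e] @ A = [x, bar x]"
      show False
      proof (cases C)
        case Nil
        then have "hd A = a" "A \<noteq> []" using h e by auto
        then show False using lC Qn lQ by auto
      next
        case (Cons c C'')
        then have "C = [x]" "e = bar x" using h by (auto simp: append_eq_Cons_conv)
        then have "C \<noteq> []" "last C = a" using that e by auto
        then show False using lC Qn lQ by auto
      qed
    qed
    then obtain d' where d': "dir d'" "forbd d' (C @ [e] @ A)" using CA(1) by (auto simp: forb_def)
    have "d' = d"
    proof (rule ccontr)
      assume "d' \<noteq> d"
      then have "d' = - d" using dir_cases[OF d d'(1)] by auto
      then have "forbd (- d) (C @ [e] @ A)" using d'(2) by simp
      then show False using forbd_turn[of "- d" e C A] d e(1) lC Qn lQ by (auto simp: s_uminus)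
    qed
    \<comment> \<open>Full blocks on both sides of \<open>e\<close> do not overlap in
      \<open>Q\<close> and would enlarge the stack to \<open>Suc M\<close>.\<close>
    have nboth: False if "sruns d e Q (2 * g - 1)" "pruns d e Q (2 * g - 1)"
    proof -
      have r: "s d e (- int (2 * g - 1)) = s d a 1"
        using d g2 s_period[OF d, of 1 "1 - 4 * int g" a] s_period[OF d, of "2 * int g + 1" "1 - 2 * int g" a] by (simp add: e_def of_nat_diff)
      have c: "run d (s d e (- int (2 * g - 1))) (2 * g - 1) = blk d a" "run d (s d e 1) (2 * g - 1) = blk d e"
        unfolding r by (simp_all add: blk_def)
      have q: "blk d a @ [e] @ blk d e = run d (s d a 1) (2 * g - 1 + Suc (2 * g - 1))"
        using run_around[OF e(1), of d "2 * g - 1" "2 * g - 1"] unfolding c unfolding r .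
      have "hd (blk d a @ [e] @ blk d e) \<notin> set (tl (blk d a @ [e] @ blk d e))"
        unfolding q using run_hd_notin[OF d, of "2 * g - 1 + Suc (2 * g - 1)" "s d a 1"] g2 by auto
      moreover have "suffix (blk d a) Q" "prefix (blk d e) Q" using that unfolding sruns_def pruns_def c by auto
      ultimately obtain B where B: "Q = blk d e @ B @ blk d a" using no_overlap[of "blk d a" Q "blk d e" e] by blast
      have "X = (P @ blk d e) @ B @ (blk d a @ S)" using XX B by simp
      moreover have "stk d (Suc M) a (P @ blk d e) (blk d a @ S)" using st by (auto simp: stk_def e_def pw_comm)
      ultimately show False using mx by blast
    qed
    have sum: "r1 + r2 \<le> 4 * g - 3" if r: "sruns d e Q r1" "pruns d e Q r2" for r1 r2
    proof (rule ccontr)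
      assume c: "\<not> r1 + r2 \<le> 4 * g - 3"
      then have "r1 = 2 * g - 1" "r2 = 2 * g - 1" using fc(9)[OF r(1)] fc(10)[OF r(2)] g2 by linarith+
      then show False using nboth r by simp
    qed
    have gs: "good_sides d e (Y @ P) Q (S @ Z)"
      unfolding good_sides_def
    proof (intro conjI allI impI)
      show "L ((Y @ P) @ Q @ S @ Z)" using LX by simp
      have "last ((Y @ P) @ Q) \<noteq> bar e \<and> last ((Y @ P) @ Q) \<noteq> s d e 1"
      proof (cases "Q = []")
        case True
        then show ?thesis using fc(1) lP d gi bar_s[OF d, of e] by (auto simp: s_eq4)
      qed (use lQ e in simp)
      then show "weak d ((Y @ P) @ Q) e" using weak_last[OF d] by blast
      have "hd (Q @ S @ Z) \<noteq> bar e \<and> hd (Q @ S @ Z) \<noteq> s d e (- 1)"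
      proof (cases "Q = []")
        case True
        then show ?thesis using fc(2) hS d gi bar_s[OF d, of e] by (auto simp: s_eq8)
      qed (use lQ e in simp)
      moreover have "W (Q @ S @ Z)" using LX by (auto simp: L_def)
      ultimately show "weak d (mir (Q @ S @ Z)) (neg e)" using weak_hd[OF d _ e(1)] by blast
      show "Y @ P \<noteq> [] \<and> last (Y @ P) = s d e (2 * int g - 1) \<or> L (Q @ [e])" using fc(1) lP by simp
      show "hd (S @ Z) = e \<or> hd (S @ Z) = s d e (2 * int g + 1) \<and> (\<forall>r. pruns d e Q r \<longrightarrow> r \<le> 2 * g - 1)"
        using fc(2,10) hS by simp
    qed (use sum fc(2,9) in auto)
    have "outcome e (Y @ P) Q (S @ Z)"
      by (rule outcome_of_forbd[OF d e(1) gs _ HOL.refl CA(2,3)]) (use d'(2) \<open>d' = d\<close> in simp)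
    then show ?thesis using Res_outcome[OF XX YX SP nXX] by (simp add: Z_def)
  next
    case True
    \<comment> \<open>Here \<open>m = [e]\<close> and \<open>B = Q\<close>. The powers stay reduced
      next to \<open>P\<close> and \<open>S\<close> by \<open>per_left\<close> and
      \<open>per_right\<close>; their exceptions would make \<open>?w\<close> or
      \<open>Q @ [e]\<close> a power of a block, whose letters contradict \<open>ne1\<close> or
      \<open>lQ\<close>.\<close>
    let ?w = "[e] @ Q"
    have LQe: "L (Q @ [e])" using True L_app1[of "Q @ [e]" Q] by simp
    have LeQ: "L ?w" using True L_app2 by blast
    have ww: "L (?w @ ?w)"
    proof (rule ccontr)
      assume "\<not> L (?w @ ?w)"
      then obtain f1 f2 where f: "forb (f1 @ f2)" "suffix f1 ?w" "prefix f2 ?w" "f1 \<noteq> []" "f2 \<noteq> []"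
        using forb_across[OF LeQ LeQ] by blast
      have "\<not> suffix f1 Q"
      proof
        assume "suffix f1 Q"
        then have "sublist (f1 @ f2) (Q @ ?w)" using f(3) unfolding sublist_append by blast
        then show False using True f(1) by (auto simp: L_def)
      qed
      then have "f1 = e # Q" using f(2) by (auto simp: suffix_Cons)
      moreover have "hd f2 = e" using prefix_hd[OF f(3,5)] by simp
      then have "e \<in> set f2" using f(5) by (metis hd_in_set)
      ultimately show False using forb_hd[OF f(1)] by simp
    qed
    have L1: "L ((Y @ P) @ Q @ [e])"
    proof (rule glue_end[OF d e(1) _ LQe])
      show "L ((Y @ P) @ Q)" using LX L_app1[of "(Y @ P) @ Q" "S @ Z"] by simp
    qed (use fc(1) lP lQ e in auto)
    have L2: "L ([e] @ Q @ (S @ Z))"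
    proof (rule glue_start[OF d e(1) _ LeQ])
      show "L (Q @ S @ Z)" using LX L_app2[of "Y @ P" "Q @ S @ Z"] by simp
    qed (use fc(2) hS lQ e in auto)
    have "L ((Y @ P) @ Q @ pw (Suc k) ?w @ S @ Z)" for k
    proof (cases "Q = []")
      case True
      have Lp: "L (pw (Suc k) [e])" using L_pw[OF ww] True by (simp del: pw_Suc)
      have l: "last (pw (Suc k) [e]) = e" "hd (pw (Suc k) [e]) = e" by (simp_all del: pw_Suc)
      have LSZ: "L (S @ Z)" "L (Y @ P)" using LX True L_app2[of "Y @ P" "S @ Z"] L_app1[of "Y @ P" "S @ Z"] by auto
      have x: "e = s d e 0" using e by simp
      have nd: "d' = d \<or> d' = - d" if "dir d'" for d' using dir_cases[OF d that] .
      have "L (pw (Suc k) [e] @ S @ Z)"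
      proof (rule glue_nonadj[OF Lp LSZ(1)])
        show "hd (S @ Z) \<noteq> bar (last (pw (Suc k) [e]))" unfolding l using fc(2) hS d bar_s[OF d, of e] gi by (simp add: s_eq8)
        show "\<not> adj d' (last (pw (Suc k) [e])) (hd (S @ Z))" if "dir d'" for d'
          using nd[OF that] d gi fc(2) hS unfolding l adj_def by (auto simp: s_uminus s_eq8)
      qed (use fc(2) in auto)
      moreover have "hd (pw (Suc k) [e] @ S @ Z) = e" by simp
      moreover have "L ((Y @ P) @ (pw (Suc k) [e] @ S @ Z))"
      proof (rule glue_nonadj[OF LSZ(2) calculation(1)])
        show "hd (pw (Suc k) [e] @ S @ Z) \<noteq> bar (last (Y @ P))"
          using ne1[of "- 1"] fc(1) lP d s_period[OF d, of "4 * int g - 1" "- 1" e] gi by (simp add: algebra_simps)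
        show "\<not> adj d' (last (Y @ P)) (hd (pw (Suc k) [e] @ S @ Z))" if "dir d'" for d'
        proof -
          have "e \<noteq> s d e (2 * int g)" "e \<noteq> s d e (2 * int g - 2)" "e \<noteq> s d e (- 3)" "e \<noteq> s d e (4 * int g + 1)"
            using ne1[of "2 * int g"] ne1[of "2 * int g - 2"] ne1[of "- 3"] ne1[of 1] s_period[OF d, of "4 * int g + 1" 1 e] gi by auto
          then show ?thesis using nd[OF that] d fc(1) lP unfolding adj_def by (auto simp: s_uminus)
        qed
      qed (use fc(1) in auto)
      ultimately show ?thesis using True by simp
    next
      case Qne: False
      have p2: "\<exists>r. run d' z (2 * g - 1) = s d' z 0 # s d' z 1 # r" for d' z
      proof -
        have n: "2 * g - 1 = 2 + (2 * g - 3)" using g2 by simp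
        have "run d' z (2 * g - 1) = run d' z 2 @ run d' (s d' z 2) (2 * g - 3)"
          unfolding n run_append by simp
        moreover have "run d' z 2 = [s d' z 0, s d' z 1]" by (simp add: run_def upt_rec)
        ultimately show ?thesis by simp
      qed
      have l2: "\<exists>r. run d' z (2 * g - 1) = r @ [s d' z (2 * int g - 3), s d' z (2 * int g - 2)]" for d' z
      proof -
        have "2 * g - 1 = Suc (Suc (2 * g - 3))" using g2 by simp
        then have "run d' z (2 * g - 1) = run d' z (2 * g - 3) @ [s d' z (int (2 * g - 3)), s d' z (int (Suc (2 * g - 3)))]"
          by (simp add: run_Suc2)
        then show ?thesis using g2 by (simp add: of_nat_diff)
      qed
      have "L (pw (Suc (Suc k)) ?w)" by (rule L_pw[OF ww])
      then have "L ([e] @ (Q @ pw (Suc k) ?w))" by simp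
      then have Lr: "L (Q @ pw (Suc k) ?w)" by (rule L_app2)
      have R: "L (Q @ pw (Suc k) ?w @ (S @ Z))"
      proof (rule ccontr)
        assume n: "\<not> ?thesis"
        have "L (Q @ pw (Suc k) ?w @ (S @ Z)) \<or> (\<exists>d' a' j. dir d' \<and> inr a' \<and> 1 \<le> j \<and> S @ Z \<noteq> [] \<and> hd (S @ Z) = bar a' \<and> ?w = pw j (blk d' a'))"
        proof (rule per_right[OF _ Lr])
          show "L (?w @ S @ Z)" using L2 by simp
          show "S @ Z = [] \<or> hd (S @ Z) \<noteq> hd ?w" using fc(2) hS ne1[of "1 - 2 * int g"] s_period[OF d, of "2 * int g + 1" "1 - 2 * int g" e] gi by auto
        qed (use Qne in auto)
        then obtain d' a' j where h: "dir d'" "inr a'" "1 \<le> j" "hd S = bar a'" "?w = pw j (blk d' a')" using n fc(2) by auto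
        have "bar a' = bar (s d e 1)" using h(4) hS d by (simp add: add.commute)
        then have a': "a' = s d e 1" using h(2) by (metis bar_bar inr_s)
        obtain j' where "j = Suc j'" using h(3) by (cases j) auto
        moreover obtain r where "blk d' a' = s d' a' 1 # s d' a' 2 # r" using p2[of d' "s d' a' 1"] by (auto simp: blk_def)
        ultimately have w: "e = s d' a' 1" "hd Q = s d' a' 2" using h(5) by auto
        from dir_cases[OF d h(1)] show False
        proof
          assume "d' = d" then show False using w(1) a' ne1[of 2] gi by simp
        next
          assume "d' = - d" then show False using w(2) a' lQ[OF Qne] by (simp add: s_uminus)
        qed
      qed
      have sh: "pw (Suc k) (Q @ [e]) @ Q = Q @ pw (Suc k) ?w" by (rule pw_slide)
      then have R': "L (pw (Suc k) (Q @ [e]) @ (Q @ S @ Z))" using R by (metis append.assoc)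
      have "L ((Y @ P) @ pw (Suc k) (Q @ [e]) @ (Q @ S @ Z))"
      proof (rule ccontr)
        assume n: "\<not> ?thesis"
        have "L ((Y @ P) @ pw (Suc k) (Q @ [e]) @ (Q @ S @ Z)) \<or> (\<exists>d' a' j. dir d' \<and> inr a' \<and> 1 \<le> j \<and> Y @ P \<noteq> [] \<and> last (Y @ P) = a' \<and> Q @ [e] = pw j (blk d' a'))"
        proof (rule per_left[OF L1 R'])
          show "Y @ P = [] \<or> last (Y @ P) \<noteq> last (Q @ [e])" using fc(1) lP ne1[of "2 * int g - 1"] gi by auto
        qed (use Qne in auto)
        then obtain d' a' j where h: "dir d'" "1 \<le> j" "a' = last P" "Q @ [e] = pw j (blk d' a')" using n fc(1) by auto
        obtain j' where j': "j = Suc j'" using h(2) by (cases j) auto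
        obtain r where "blk d' a' = r @ [s d' a' (2 * int g - 2), s d' a' (2 * int g - 1)]"
          using l2[of d' "s d' a' 1"] by (auto simp: blk_def algebra_simps)
        then have "Q @ [e] = (pw j' (blk d' a') @ r @ [s d' a' (2 * int g - 2)]) @ [s d' a' (2 * int g - 1)]"
          using h(4) j' by (simp add: pw_comm)
        then have w: "e = s d' a' (2 * int g - 1)" "last Q = s d' a' (2 * int g - 2)" by auto
        from dir_cases[OF d h(1)] show False
        proof
          assume "d' = d"
          then show False using w(1) h(3) lP ne1[of "- 2"] s_period[OF d, of "4 * int g - 2" "- 2" e] gi by simp
        next
          assume "d' = - d" then show False using w(2) h(3) lP lQ[OF Qne] by (simp add: s_uminus)
        qed
      qed
      then show ?thesis using sh by (metis append.assoc)
    qed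
    then have lo: "loopable (Y @ P) Q (S @ winv Y) [e]" using ww by (simp add: loopable_def Z_def)
    have WX: "W X" using L_factor[OF YX] by (simp add: L_def)
    show ?thesis
      by (rule Res_loop[OF XX _ SP _ _ WX lo]) (use fc(1) L_app1[OF LeQ] in auto)
  qed
qed

text \<open>A stack of height \<open>M\<close> occupies at least \<open>M\<close> letters of
  \<open>P\<close>, so a greatest height exists, taken over all directions and letters.\<close>

lemma Res_cyclically_reduced:
  assumes YX: "L (Y @ X @ winv Y)" and X: "X \<noteq> []" "hd X \<noteq> bar (last X)"
  shows "Res Y X"
proof (cases "L (X @ X)")
  case True
  then show ?thesis using Res_type0 X YX by blast
next
  case nXX: False
  define T where "T M \<longleftrightarrow> (\<exists>d a P Q S. stk d M a P S \<and> X = P @ Q @ S)" for M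
  show ?thesis
  proof (cases "\<exists>M. T M")
    case False
    then show ?thesis using res_no_stack[OF YX X nXX] by (auto simp: T_def)
  next
    case True
    have le: "M \<le> length X" if TM: "T M" for M
    proof -
      obtain d a P Q S where h: "stk d M a P S" "X = P @ Q @ S" using TM unfolding T_def by blast
      have 1: "M * (2 * g - 1) \<le> length P" using h(1) by (auto simp: stk_def)
      have "1 \<le> 2 * g - 1" using g2 by linarith
      then have "M * 1 \<le> M * (2 * g - 1)" by (rule mult_le_mono2)
      then have "M \<le> length P" using 1 by (metis le_trans mult.right_neutral)
      then show ?thesis using h(2) by simp
    qed
    define M where "M = Greatest T"
    have M: "T M" "\<And>M'. T M' \<Longrightarrow> M' \<le> M"
      unfolding M_def using GreatestI_ex_nat[OF True le] Greatest_le_nat[OF _ le] by auto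
    then obtain d a P Q S where h: "stk d M a P S" "X = P @ Q @ S" unfolding T_def by blast
    show ?thesis
    proof (rule res_stack[OF YX nXX h])
      fix P' Q' S' assume s: "stk d (Suc M) a P' S'"
      have "\<not> T (Suc M)" using M(2)[of "Suc M"] by auto
      then show "X \<noteq> P' @ Q' @ S'" using s unfolding T_def by blast
    qed
  qed
qed

section \<open>Return from codes to the surface group\<close>

lemma winv_winv: "W w \<Longrightarrow> winv (winv w) = w"
  by (simp add: winv_def rev_map map_idI)

lemma eqv_pw: "eqv u v \<Longrightarrow> eqv (pw k u) (pw k v)"
  by (induction k) (auto simp: eqv_refl intro: eqv_app)

lemma eqv_conj_pw:
  assumes "W Y" "W X"
  shows "eqv (pw k (Y @ X @ winv Y)) (Y @ pw k X @ winv Y)"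
proof (induction k)
  case 0
  then show ?case using eqv_sym[OF eqv_winv[OF assms(1)]] by simp
next
  case (Suc k)
  have "eqv (winv Y @ Y) []" using eqv_winv[of "winv Y"] winv_winv[OF assms(1)] by simp
  then have "eqv ((Y @ X) @ (winv Y @ Y) @ (pw k X @ winv Y)) ((Y @ X) @ (pw k X @ winv Y))"
    by (rule eqv_del[rotated 2]) (use assms W_pw[OF assms(2), of k] W_winv[of Y] in auto)
  then have 1: "eqv ((Y @ X @ winv Y) @ (Y @ pw k X @ winv Y)) (Y @ pw (Suc k) X @ winv Y)" by simp
  have WW: "W (Y @ X @ winv Y)" using assms W_winv[of Y] by auto
  have "eqv (pw (Suc k) (Y @ X @ winv Y)) ((Y @ X @ winv Y) @ (Y @ pw k X @ winv Y))"
    using eqv_app[OF eqv_refl[OF WW] Suc] by simp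
  then show ?case using 1 by (rule eqv_trans)
qed

lemma element_pow:
  assumes "w \<in> words {1..2 * g}"
  shows "element g w [^]\<^bsub>surface_group g\<^esub> k = element g (word_pow k w) \<and> word_pow k w \<in> words {1..2 * g}"
proof (induction k)
  case 0
  have "monoid (surface_group g)" using group_surface_group by (rule group.is_monoid)
  then show ?case
    by (simp add: monoid.nat_pow_0 word_pow_def element_def surface_group_def one_presented_group)
next
  case (Suc k)
  have m: "monoid (surface_group g)" using group_surface_group by (rule group.is_monoid)
  have "word_pow (Suc k) w = word_pow k w @ w" using pw_Suc2[of k w] by (simp add: pw_def word_pow_def)
  then show ?case
    using Suc assms mult_pres_class[of "word_pow k w" "{1..2 * g}" w "{surface_relator g}"]
    by (simp add: monoid.nat_pow_Suc[OF m] element_def surface_group_def)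
qed

end

theorem theorem4p4:
  fixes g :: nat and x :: "nat letter list set" and X Y :: "nat letter list"
  assumes "2 \<le> g"
    and "x \<in> carrier (surface_group g)"
    and "x \<noteq> \<one>\<^bsub>surface_group g\<^esub>"
    and "nf x = Y @ X @ word_inv Y"
    and "cyclically_freely_reduced X"
  shows "\<exists>i j X' W.
      1 \<le> i \<and> i \<le> length X \<and>
      X' = nf_word g (drop i X @ take i X) \<and>
      1 \<le> j \<and> j \<le> length X' \<and>
      W = nf_word g (drop j X' @ take j X') \<and>
      cyclically_irreducible g W \<and>
      length W = length X' \<and>
      1 \<le> length X' \<and>
      (\<forall>k\<ge>2.
         nf (x [^]\<^bsub>surface_group g\<^esub> (k::nat)) = Y @ nf_word g (word_pow k X) @ word_inv Y \<and>
         Y @ nf_word g (word_pow k X) @ word_inv Y =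
           Y @ take i X @ (take j X' @ word_pow (k - 2) W @ drop j X') @ drop i X @ word_inv Y)"
proof -
  interpret surf g by unfold_locales (rule assms(1))
  define y z where "y = map dec Y" and "z = map dec X"
  have n: "L (map dec (nf x))" "nf x \<in> words {1..2 * g}" "x = element g (nf x)" using nf_L[OF assms(2)] by auto
  then have w: "Y \<in> words {1..2 * g}" "X \<in> words {1..2 * g}" using assms(4) by auto
  have yz: "map enc y = Y" "map enc z = X" "W y" "W z" using words_dec[OF w(1)] words_dec[OF w(2)] by (auto simp: y_def z_def)
  have Ya: "a \<in> Gen ` {1..2 * g} \<union> InvGen ` {1..2 * g}" if "a \<in> set Y \<or> a \<in> set X" for a
    using w that unfolding words_def lists_eq_set by blast
  have wi: "map dec (word_inv Y) = winv y"
    unfolding word_inv_def winv_def y_def rev_map[symmetric] using dec_inv[OF Ya] by (simp add: rev_map)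
  have wi2: "map enc (winv y) = word_inv Y" using words_dec[of "word_inv Y"] w(1) wi by (metis word_inv_in_words)
  have LY: "L (y @ z @ winv y)" using n(1) assms(4) wi by (simp add: y_def z_def)
  have Xne: "X \<noteq> []"
  proof
    assume "X = []"
    then have "L (y @ winv y)" using LY by (simp add: z_def)
    then have "y @ winv y = []" using L_unique[OF _ L_Nil] eqv_winv[OF yz(3)] by blast
    then have "nf x = []" using assms(4) \<open>X = []\<close> yz(1) by (simp add: word_inv_def)
    then have "x = \<one>\<^bsub>surface_group g\<^esub>" using n(3) by (simp add: element_def surface_group_def one_presented_group)
    then show False using assms(3) by contradiction
  qed
  have "hd z \<noteq> bar (last z)"
  proof
    assume h: "hd z = bar (last z)"
    have "z \<noteq> []" using Xne z_def by simp
    then have "inr (last z)" using yz(4) last_in_set by blast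
    then have "enc (hd z) = letter_inv (enc (last z))" using h enc_bar by simp
    moreover have "enc (hd z) = hd X" "enc (last z) = last X" using yz(2) Xne by (metis hd_map map_is_Nil_conv, metis last_map map_is_Nil_conv)
    ultimately show False using assms(5) Xne by (simp add: cyclically_freely_reduced_def)
  qed
  then have "Res y z" using Res_cyclically_reduced[OF LY] Xne by (simp add: z_def)
  then obtain i j Xi V where r: "1 \<le> i" "i \<le> length z" "L Xi" "eqv (drop i z @ take i z) Xi" "1 \<le> j" "j \<le> length Xi"
    "eqv (drop j Xi @ take j Xi) V" "L (V @ V)" "length V = length Xi"
    "\<And>k. L (y @ take i z @ take j Xi @ pw k V @ drop j Xi @ drop i z @ winv y)"
    unfolding Res_def by blast
  have LV: "L V" using L_app1[OF r(8)] .
  have WXi: "W Xi" using r(3) by (simp add: L_def)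
  have Wr: "W (drop t u @ take t u)" if "W u" for t u using that by (auto dest: in_set_takeD in_set_dropD)
  have e1: "map enc Xi = nf_word g (drop i X @ take i X)"
    unfolding yz(2)[symmetric] using nf_word_eq[OF Wr[OF yz(4)] r(3,4)] by (simp add: drop_map take_map)
  have e2: "map enc V = nf_word g (drop j (map enc Xi) @ take j (map enc Xi))"
    using nf_word_eq[OF Wr[OF WXi] LV r(7)] by (simp add: drop_map take_map)
  \<comment> \<open>Every rotation of \<open>V\<close> is a factor of the reduced word
    \<open>V @ V\<close>.\<close>
  have ci: "cyclically_irreducible g (map enc V)"
    unfolding cyclically_irreducible_def irreducible_word_def rotate_map
    using nf_word_L[OF L_rotate[OF r(8)]] enc_words[OF L_W[OF L_rotate[OF r(8)]]] by blast
  have "nf (x [^]\<^bsub>surface_group g\<^esub> (k::nat)) = Y @ nf_word g (word_pow k X) @ word_inv Y \<and>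
         Y @ nf_word g (word_pow k X) @ word_inv Y =
           Y @ take i X @ (take j (map enc Xi) @ word_pow (k - 2) (map enc V) @ drop j (map enc Xi)) @ drop i X @ word_inv Y"
    if k: "2 \<le> k" for k
  proof -
    obtain t where t: "k = Suc (Suc t)" using k by (metis One_nat_def Suc_1 Suc_le_D Suc_le_mono)
    define A B C D where "A = take i z" and "B = drop i z" and "C = take j Xi" and "D = drop j Xi"
    \<comment> \<open>Two factors of the power are spread out:
      \<open>C @ (D C)^t @ D = (C D)^(t + 1)\<close> and
      \<open>A @ (B A)^(t + 1) @ B = (A B)^(t + 2)\<close>. Hence \<open>t = k - 2\<close> copies of
      \<open>V\<close> remain.\<close>
    define I where "I = A @ C @ pw t V @ D @ B"
    have AB: "z = A @ B" "Xi = C @ D" by (simp_all add: A_def B_def C_def D_def)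
    have WA: "W A" "W B" "W C" "W D" using yz(4) WXi AB by auto
    have LN: "L (y @ I @ winv y)" using r(10)[of t] by (simp add: I_def A_def B_def C_def D_def)
    then have LI: "L I" by (rule L_factor)
    have "eqv (C @ pw t V @ D) (C @ pw t (D @ C) @ D)"
      using eqv_ctx[OF WA(3,4) eqv_pw[OF eqv_sym]] r(7) by (simp add: C_def D_def)
    then have "eqv (C @ pw t V @ D) (pw (Suc t) Xi)" using pw_rot[of C t D] AB(2) by simp
    moreover have "eqv (pw (Suc t) Xi) (pw (Suc t) (B @ A))"
      using eqv_pw[OF eqv_sym[OF r(4)], of "Suc t"] by (simp only: A_def B_def)
    ultimately have "eqv (C @ pw t V @ D) (pw (Suc t) (B @ A))" by (rule eqv_trans)
    then have "eqv (A @ (C @ pw t V @ D) @ B) (A @ pw (Suc t) (B @ A) @ B)" by (rule eqv_ctx[OF WA(1,2)])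
    then have "eqv (A @ (C @ pw t V @ D) @ B) (pw k z)" using pw_rot[of A "Suc t" B] AB(1) t by simp
    then have zI: "eqv (pw k z) I" using eqv_sym unfolding I_def by simp
    have wz: "W (pw k z)" using W_pw[OF yz(4)] .
    have 1: "nf_word g (word_pow k X) = map enc I"
      using nf_word_eq[OF wz LI zI] yz(2) by (simp add: map_pw word_pow_def pw_def map_concat)
    have "eqv (pw k (y @ z @ winv y)) (y @ I @ winv y)"
      using eqv_trans[OF eqv_conj_pw[OF yz(3,4)] eqv_ctx[OF yz(3) W_winv zI]] .
    then have "nf_word g (map enc (pw k (y @ z @ winv y))) = map enc (y @ I @ winv y)"
      using nf_word_eq[OF _ LN] W_pw[of "y @ z @ winv y" k] LY by (simp add: L_def)
    moreover have "map enc (pw k (y @ z @ winv y)) = word_pow k (nf x)"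
      unfolding map_pw assms(4) using yz wi2 by (simp add: word_pow_def pw_def)
    moreover have "nf (x [^]\<^bsub>surface_group g\<^esub> k) = nf_word g (word_pow k (nf x))"
      using element_pow[OF n(2), of k] n(3) by (simp add: nf_word_def)
    ultimately have 2: "nf (x [^]\<^bsub>surface_group g\<^esub> k) = Y @ map enc I @ word_inv Y" using yz wi2 by simp
    have 3: "map enc I = take i X @ (take j (map enc Xi) @ word_pow (k - 2) (map enc V) @ drop j (map enc Xi)) @ drop i X"
      unfolding I_def A_def B_def C_def D_def using yz(2) t
      by (simp add: take_map[symmetric] drop_map[symmetric] map_pw) (simp add: pw_def word_pow_def)
    show ?thesis using 1 2 3 by simp
  qed
  moreover have "i \<le> length X" using r(2) by (simp add: z_def)
  moreover have "j \<le> length (map enc Xi)" "length (map enc V) = length (map enc Xi)" "1 \<le> length (map enc Xi)"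
    using r(5,6,9) by auto
  ultimately show ?thesis using r(1,5) e1 e2 ci by blast
qed

end
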